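(* Let $k$ be a field of characteristic zero, $A$ an associative unital $k$-algebra, $B$ a commutative unital $k$-algebra, and $\varepsilon:B\to A$ a morphism of $k$-algebras with $\varepsilon(B)\subset\mathcal{Z}(A)$ (the center of $A$). Then there is a long exact sequence $$\cdots\rightarrow HC_n(A,B,\varepsilon)\stackrel{S}{\rightarrow} HC_{n-2}(A,B,\varepsilon)\stackrel{\mathsf{B}}{\rightarrow} HH_{n-1}(A,B,\varepsilon)\stackrel{I}{\rightarrow} HC_{n-1}(A,B,\varepsilon)\rightarrow\cdots,$$ where $HH_\bullet(A,B,\varepsilon)$ and $HC_\bullet(A,B,\varepsilon)$ are the secondary Hochschild homology and the cyclic homology associated to the triple $(A,B,\varepsilon)$, $S$ is induced by the truncation map $s$ of the total complex of the cyclic bicomplex, and $\mathsf{B}$ is the connecting homomorphism.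
   Context: All tensor products are over $k$. For $n\ge 0$ put $C_n(A,B,\varepsilon)=A^{\otimes(n+1)}\otimes B^{\otimes \frac{n(n+1)}{2}}$. A simple tensor in it is displayed as an upper triangular array with diagonal entries $a_0,\dots,a_n\in A$ and entries $b_{p,q}\in B$ for $0\le p<q\le n$ above the diagonal (and $1\in k$ below the diagonal); write it $(a_l;b_{p,q})$. The following $k$-linear maps are given on simple tensors. Face maps $\delta_i:C_{n}(A,B,\varepsilon)\to C_{n-1}(A,B,\varepsilon)$, $n\ge1$, $0\le i\le n$: - For $0\le i\le n-1$, $\delta_i$ merges the indices $i$ and $i+1$: $\delta_i(a_l;b_{p,q})=(a'_l;b'_{u,v})$ with $a'_l=a_l$ for $l<i$, $a'_i=a_ia_{i+1}\varepsilon(b_{i,i+1})$, $a'_l=a_{l+1}$ for $l>i$, and $b'_{u,v}=\prod_{p\in s_i^{-1}(u),\,q\in s_i^{-1}(v)}b_{p,q}$ for $0\le u<v\le n-1$, where $s_i:\{0,\dots,n\}\to\{0,\dots,n-1\}$ is $s_i(p)=p$ for $p\le i$ and $s_i(p)=p-1$ for $p>i$. - $\delta_{n}(a_l;b_{p,q})=(a'_l;b'_{u,v})$ with $a'_0=a_{n}a_0\varepsilon(b_{0,n})$, $a'_l=a_l$ for $1\le l\le n-1$, $b'_{0,v}=b_{v,n}b_{0,v}$ for $1\le v\le n-1$, and $b'_{u,v}=b_{u,v}$ for $1\le u<v\le n-1$. Put $b_n=\sum_{i=0}^{n}(-1)^i\delta_i$ and $b'_n=\sum_{i=0}^{n-1}(-1)^i\delta_i$.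 Let $HH_n(A,B,\varepsilon)$ be the $n$-th homology of the complex $(C_\bullet(A,B,\varepsilon),b)$. Let $\lambda:C_n(A,B,\varepsilon)\to C_n(A,B,\varepsilon)$ be $\lambda(a_l;b_{p,q})=(-1)^n(a'_l;b'_{u,v})$ with $a'_0=a_n$, $a'_l=a_{l-1}$ for $1\le l\le n$, $b'_{0,v}=b_{v-1,n}$ for $1\le v\le n$, $b'_{u,v}=b_{u-1,v-1}$ for $1\le u<v\le n$. One has $(1-\lambda)b'=b(1-\lambda)$, so $b$ is well defined on $C_n^\lambda(A,B,\varepsilon)=C_n(A,B,\varepsilon)/\mathrm{Im}(1-\lambda)$; $HC_n(A,B,\varepsilon)$ is the $n$-th homology of $(C_\bullet^\lambda(A,B,\varepsilon),b)$. All groups in negative degrees are zero. Cyclic bicomplex: with $N=1+\lambda+\dots+\lambda^n$ on $C_n(A,B,\varepsilon)$, one has $N(1-\lambda)=(1-\lambda)N=0$, $Nb=b'N$, $b^2=b'^2=0$. The first-quadrant double complex $C(A,B,\varepsilon)$ has $C_q(A,B,\varepsilon)$ in position (column $p$, row $q$) for all $p,q\ge 0$, vertical differential $b$ in even columns and $-b'$ in odd columns, and horizontal differential from column $p$ to column $p-1$ equal to $1-\lambda$ for $p$ odd and $N$ for $p\ge2$ even. Its total complex has $\mathrm{Tot}_n=\bigoplus_{i=0}^n C_i(A,B,\varepsilon)$, with $C_i$ in column $n-i$. In characteristic $0$ its homology is $HC_\bullet(A,B,\varepsilon)$, via the projection onto column $0$ followed by the quotient map to $C_\bullet^\lambda(A,B,\varepsilon)$.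 The truncation map $s:\mathrm{Tot}_n\to\mathrm{Tot}_{n-2}$, $s(x_0,\dots,x_n)=(x_0,\dots,x_{n-2})$, $x_i\in C_i(A,B,\varepsilon)$, is a surjective chain map that deletes columns $0$ and $1$; its kernel $\mathrm{Tot}'_\bullet$ is the total complex of columns $0$ and $1$. The homology of $\mathrm{Tot}'_\bullet$ is identified with $HH_\bullet(A,B,\varepsilon)$ through the inclusion of column $0$ (a homotopy equivalence). With these identifications $S$ is induced by $s$, $I$ by the inclusion $\mathrm{Tot}'_\bullet\to\mathrm{Tot}_\bullet$, and $\mathsf{B}$ is the connecting homomorphism of the short exact sequence formed by $\mathrm{Tot}'_\bullet$, $\mathrm{Tot}_\bullet$ and the shifted copy of $\mathrm{Tot}_\bullet$ in which $\mathrm{Tot}_{n-2}$ sits in degree $n$. *)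

theory Defs
  imports HOL.Hull "HOL-Algebra.Module" "HOL-Algebra.AbelCoset"
begin

section \<open>Modules, quotients and homology\<close>

text \<open>
  The fields \<open>mult\<close> and \<open>one\<close> of the record type of modules are irrelevant for modules
  that carry no multiplication and are left undefined.
\<close>

definition lin_map ::
    "('k, 'i) ring_scheme \<Rightarrow> ('k, 'm, 'j) module_scheme \<Rightarrow> ('k, 'n, 'l) module_scheme
      \<Rightarrow> ('m \<Rightarrow> 'n) \<Rightarrow> bool"
  where "lin_map K M N f \<longleftrightarrow>
    module K M \<and> module K N \<and> f \<in> carrier M \<rightarrow> carrier N \<and>
    (\<forall>x\<in>carrier M. \<forall>y\<in>carrier M. f (x \<oplus>\<^bsub>M\<^esub> y) = f x \<oplus>\<^bsub>N\<^esub> f y) \<and>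
    (\<forall>c\<in>carrier K. \<forall>x\<in>carrier M. f (c \<odot>\<^bsub>M\<^esub> x) = c \<odot>\<^bsub>N\<^esub> f x)"

definition lin_iso ::
    "('k, 'i) ring_scheme \<Rightarrow> ('k, 'm, 'j) module_scheme \<Rightarrow> ('k, 'n, 'l) module_scheme
      \<Rightarrow> ('m \<Rightarrow> 'n) \<Rightarrow> bool"
  where "lin_iso K M N f \<longleftrightarrow> lin_map K M N f \<and> bij_betw f (carrier M) (carrier N)"

definition exact_at ::
    "('k, 'i) ring_scheme \<Rightarrow> ('k, 'm, 'j) module_scheme \<Rightarrow> ('m \<Rightarrow> 'n)
      \<Rightarrow> ('k, 'n, 'l) module_scheme \<Rightarrow> ('n \<Rightarrow> 'p) \<Rightarrow> ('k, 'p, 'q) module_scheme \<Rightarrow> bool"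
  where "exact_at K L f M g N \<longleftrightarrow>
    lin_map K L M f \<and> lin_map K M N g \<and> f ` carrier L = a_kernel M N g"

text \<open>Finitely supported functions on \<open>X\<close>, extended by zero outside \<open>X\<close>.\<close>

definition free_mod :: "('k, 'i) ring_scheme \<Rightarrow> 'x set \<Rightarrow> ('k, 'x \<Rightarrow> 'k) module"
  where "free_mod K X =
    \<lparr>carrier = {f. (\<forall>z. f z \<in> carrier K) \<and> (\<forall>z. z \<notin> X \<longrightarrow> f z = \<zero>\<^bsub>K\<^esub>) \<and>
                   finite {z. f z \<noteq> \<zero>\<^bsub>K\<^esub>}},
     mult = undefined, one = undefined,
     zero = (\<lambda>z. \<zero>\<^bsub>K\<^esub>), add = (\<lambda>f g z. f z \<oplus>\<^bsub>K\<^esub> g z),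
     smult = (\<lambda>c f z. c \<otimes>\<^bsub>K\<^esub> f z)\<rparr>"

definition gen :: "('k, 'i) ring_scheme \<Rightarrow> 'x \<Rightarrow> 'x \<Rightarrow> 'k"
  where "gen K x = (\<lambda>z. if z = x then \<one>\<^bsub>K\<^esub> else \<zero>\<^bsub>K\<^esub>)"

text \<open>The linear extension of a map \<open>\<phi>\<close> of basis elements.\<close>

definition push :: "('k, 'i) ring_scheme \<Rightarrow> ('x \<Rightarrow> 'y) \<Rightarrow> ('x \<Rightarrow> 'k) \<Rightarrow> ('y \<Rightarrow> 'k)"
  where "push K \<phi> f = (\<lambda>y. \<Oplus>\<^bsub>K\<^esub>x\<in>{x. f x \<noteq> \<zero>\<^bsub>K\<^esub> \<and> \<phi> x = y}. f x)"

definition quot_mod :: "('k, 'm, 'i) module_scheme \<Rightarrow> 'm set \<Rightarrow> ('k, 'm set) module"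
  where "quot_mod M N =
    \<lparr>carrier = a_rcosets\<^bsub>M\<^esub> N,
     mult = undefined, one = undefined,
     zero = N, add = (\<lambda>X Y. X <+>\<^bsub>M\<^esub> Y),
     smult = (\<lambda>c X. \<Union>x\<in>X. N +>\<^bsub>M\<^esub> (c \<odot>\<^bsub>M\<^esub> x))\<rparr>"

text \<open>
  The map into the quotient of \<open>M\<close> by \<open>N\<close> that a map \<open>f\<close> into \<open>M\<close> induces on cosets. If it is
  well defined, then all the cosets in the union coincide.
\<close>

definition induced :: "('k, 'n, 'i) module_scheme \<Rightarrow> 'n set \<Rightarrow> ('m \<Rightarrow> 'n) \<Rightarrow> 'm set \<Rightarrow> 'n set"
  where "induced M N f X = (\<Union>x\<in>X. N +>\<^bsub>M\<^esub> f x)"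

text \<open>
  Complexes are indexed by the integers: \<open>d n\<close> maps \<open>M n\<close> to \<open>M (n - 1)\<close>.
\<close>

definition boundaries :: "(int \<Rightarrow> ('k, 'm, 'i) module_scheme) \<Rightarrow> (int \<Rightarrow> 'm \<Rightarrow> 'm) \<Rightarrow> int \<Rightarrow> 'm set"
  where "boundaries M d n = d (n + 1) ` carrier (M (n + 1))"

definition homology ::
    "(int \<Rightarrow> ('k, 'm, 'i) module_scheme) \<Rightarrow> (int \<Rightarrow> 'm \<Rightarrow> 'm) \<Rightarrow> int \<Rightarrow> ('k, 'm set) module"
  where "homology M d n =
    quot_mod ((M n)\<lparr>carrier := a_kernel (M n) (M (n - 1)) (d n)\<rparr>) (boundaries M d n)"

text \<open>
  The map on homology induced by \<open>f\<close>, with values in the homology of \<open>(M, d)\<close> in degree \<open>n\<close>.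
\<close>

definition hmap ::
    "(int \<Rightarrow> ('k, 'n, 'i) module_scheme) \<Rightarrow> (int \<Rightarrow> 'n \<Rightarrow> 'n) \<Rightarrow> int \<Rightarrow> ('m \<Rightarrow> 'n)
      \<Rightarrow> 'm set \<Rightarrow> 'n set"
  where "hmap M d n f = induced (M n) (boundaries M d n) f"

definition alt :: "('k, 'm, 'i) module_scheme \<Rightarrow> int \<Rightarrow> 'm \<Rightarrow> 'm"  \<comment> \<open>\<open>x \<mapsto> (-1)^i x\<close>\<close>
  where "alt M i x = (if even i then x else \<ominus>\<^bsub>M\<^esub> x)"


section \<open>The secondary Hochschild complex and the cyclic bicomplex\<close>

definition pairs :: "int \<Rightarrow> (int \<times> int) set"
  where "pairs n = {(p, q). 0 \<le> p \<and> p < q \<and> q \<le> n}"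

type_synonym ('a, 'b) array = "(int \<Rightarrow> 'a) \<times> (int \<times> int \<Rightarrow> 'b)"

locale secondary_triple =
  fixes K :: "('k, 'i) ring_scheme"
    and A :: "('k, 'a, 'j) module_scheme"
    and B :: "('k, 'b, 'l) module_scheme"
    and \<epsilon> :: "'b \<Rightarrow> 'a"
  assumes K_field: "field K"
    and A_ring: "ring A"
    and A_module: "module K A"
    and A_smult_mult_left: "\<And>c x y. \<lbrakk>c \<in> carrier K; x \<in> carrier A; y \<in> carrier A\<rbrakk> \<Longrightarrow>
          (c \<odot>\<^bsub>A\<^esub> x) \<otimes>\<^bsub>A\<^esub> y = c \<odot>\<^bsub>A\<^esub> (x \<otimes>\<^bsub>A\<^esub> y)"
    and A_smult_mult_right: "\<And>c x y. \<lbrakk>c \<in> carrier K; x \<in> carrier A; y \<in> carrier A\<rbrakk> \<Longrightarrow>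
          x \<otimes>\<^bsub>A\<^esub> (c \<odot>\<^bsub>A\<^esub> y) = c \<odot>\<^bsub>A\<^esub> (x \<otimes>\<^bsub>A\<^esub> y)"
    and B_algebra: "algebra K B"
    and eps_ring_hom: "\<epsilon> \<in> ring_hom B A"
    and eps_smult: "\<And>c \<beta>. \<lbrakk>c \<in> carrier K; \<beta> \<in> carrier B\<rbrakk> \<Longrightarrow>
          \<epsilon> (c \<odot>\<^bsub>B\<^esub> \<beta>) = c \<odot>\<^bsub>A\<^esub> \<epsilon> \<beta>"
    and eps_central: "\<And>\<beta> x. \<lbrakk>\<beta> \<in> carrier B; x \<in> carrier A\<rbrakk> \<Longrightarrow>
          \<epsilon> \<beta> \<otimes>\<^bsub>A\<^esub> x = x \<otimes>\<^bsub>A\<^esub> \<epsilon> \<beta>"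
begin

subsection \<open>The modules of chains\<close>

text \<open>
  The symbols \<open>(a\<^sub>l; b\<^sub>p\<^sub>,\<^sub>q)\<close>. There are none in negative degrees, which makes the chains in
  negative degrees zero.
\<close>

definition arrays :: "int \<Rightarrow> ('a, 'b) array set"
  where "arrays n = {(a, b). 0 \<le> n \<and> a \<in> {0..n} \<rightarrow>\<^sub>E carrier A \<and> b \<in> pairs n \<rightarrow>\<^sub>E carrier B}"

abbreviation free_chain :: "int \<Rightarrow> ('k, ('a, 'b) array \<Rightarrow> 'k) module"
  where "free_chain n \<equiv> free_mod K (arrays n)"

text \<open>The relations of multilinearity in each of the entries.\<close>

definition multilinear_rels :: "int \<Rightarrow> (('a, 'b) array \<Rightarrow> 'k) set"
  where "multilinear_rels n =
    {gen K (a(l := x \<oplus>\<^bsub>A\<^esub> y), b)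
        \<ominus>\<^bsub>free_chain n\<^esub> (gen K (a(l := x), b) \<oplus>\<^bsub>free_chain n\<^esub> gen K (a(l := y), b)) | a b l x y.
      (a, b) \<in> arrays n \<and> l \<in> {0..n} \<and> x \<in> carrier A \<and> y \<in> carrier A} \<union>
    {gen K (a(l := c \<odot>\<^bsub>A\<^esub> x), b)
        \<ominus>\<^bsub>free_chain n\<^esub> (c \<odot>\<^bsub>free_chain n\<^esub> gen K (a(l := x), b)) | a b l c x.
      (a, b) \<in> arrays n \<and> l \<in> {0..n} \<and> c \<in> carrier K \<and> x \<in> carrier A} \<union>
    {gen K (a, b(e := x \<oplus>\<^bsub>B\<^esub> y))
        \<ominus>\<^bsub>free_chain n\<^esub> (gen K (a, b(e := x)) \<oplus>\<^bsub>free_chain n\<^esub> gen K (a, b(e := y))) | a b e x y.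
      (a, b) \<in> arrays n \<and> e \<in> pairs n \<and> x \<in> carrier B \<and> y \<in> carrier B} \<union>
    {gen K (a, b(e := c \<odot>\<^bsub>B\<^esub> x))
        \<ominus>\<^bsub>free_chain n\<^esub> (c \<odot>\<^bsub>free_chain n\<^esub> gen K (a, b(e := x))) | a b e c x.
      (a, b) \<in> arrays n \<and> e \<in> pairs n \<and> c \<in> carrier K \<and> x \<in> carrier B}"

definition tensor_rels :: "int \<Rightarrow> (('a, 'b) array \<Rightarrow> 'k) set"
  where "tensor_rels n = (\<lambda>H. submodule H K (free_chain n)) hull (multilinear_rels n)"

text \<open>
  The module of \<open>n\<close>-chains, i.e. the tensor product over \<open>K\<close> of \<open>n + 1\<close> factors \<open>A\<close>, indexed by
  \<open>{0..n}\<close>, and \<open>n (n + 1) / 2\<close> factors \<open>B\<close>, indexed by \<open>pairs n\<close>.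
\<close>

definition chain :: "int \<Rightarrow> ('k, (('a, 'b) array \<Rightarrow> 'k) set) module"
  where "chain n = quot_mod (free_chain n) (tensor_rels n)"

text \<open>The linear map into the \<open>m\<close>-chains given by \<open>\<phi>\<close> on simple tensors.\<close>

definition on_simple ::
    "int \<Rightarrow> (('a, 'b) array \<Rightarrow> ('a, 'b) array)
      \<Rightarrow> (('a, 'b) array \<Rightarrow> 'k) set \<Rightarrow> (('a, 'b) array \<Rightarrow> 'k) set"
  where "on_simple m \<phi> = induced (free_chain m) (tensor_rels m) (push K \<phi>)"

subsection \<open>Faces, cyclic operator and the two differentials\<close>

definition merge_ix :: "int \<Rightarrow> int \<Rightarrow> int"
  where "merge_ix i p = (if p \<le> i then p else p - 1)"

definition merge :: "int \<Rightarrow> int \<Rightarrow> ('a, 'b) array \<Rightarrow> ('a, 'b) array"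
  where "merge n i = (\<lambda>(a, b).
    (\<lambda>l\<in>{0..n - 1}. if l < i then a l
                     else if l = i then a i \<otimes>\<^bsub>A\<^esub> a (i + 1) \<otimes>\<^bsub>A\<^esub> \<epsilon> (b (i, i + 1))
                     else a (l + 1),
     \<lambda>(u, v)\<in>pairs (n - 1).
       \<Otimes>\<^bsub>B\<^esub>e\<in>{p \<in> {0..n}. merge_ix i p = u} \<times> {q \<in> {0..n}. merge_ix i q = v}. b e))"

definition wrap :: "int \<Rightarrow> ('a, 'b) array \<Rightarrow> ('a, 'b) array"
  where "wrap n = (\<lambda>(a, b).
    (\<lambda>l\<in>{0..n - 1}. if l = 0 then a n \<otimes>\<^bsub>A\<^esub> a 0 \<otimes>\<^bsub>A\<^esub> \<epsilon> (b (0, n)) else a l,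
     \<lambda>(u, v)\<in>pairs (n - 1). if u = 0 then b (v, n) \<otimes>\<^bsub>B\<^esub> b (0, v) else b (u, v)))"

definition rotate :: "int \<Rightarrow> ('a, 'b) array \<Rightarrow> ('a, 'b) array"
  where "rotate n = (\<lambda>(a, b).
    (\<lambda>l\<in>{0..n}. if l = 0 then a n else a (l - 1),
     \<lambda>(u, v)\<in>pairs n. if u = 0 then b (v - 1, n) else b (u - 1, v - 1)))"

text \<open>Faces are used for \<open>1 \<le> n\<close> and \<open>0 \<le> i \<le> n\<close> only.\<close>

definition face :: "int \<Rightarrow> int \<Rightarrow> (('a, 'b) array \<Rightarrow> 'k) set \<Rightarrow> (('a, 'b) array \<Rightarrow> 'k) set"
  where "face n i = on_simple (n - 1) (if i < n then merge n i else wrap n)"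

definition hoch_b :: "int \<Rightarrow> (('a, 'b) array \<Rightarrow> 'k) set \<Rightarrow> (('a, 'b) array \<Rightarrow> 'k) set"
  where "hoch_b n x =
    (if 1 \<le> n then \<Oplus>\<^bsub>chain (n - 1)\<^esub>i\<in>{0..n}. alt (chain (n - 1)) i (face n i x)
     else \<zero>\<^bsub>chain (n - 1)\<^esub>)"

definition hoch_b' :: "int \<Rightarrow> (('a, 'b) array \<Rightarrow> 'k) set \<Rightarrow> (('a, 'b) array \<Rightarrow> 'k) set"
  where "hoch_b' n x =
    (if 1 \<le> n then \<Oplus>\<^bsub>chain (n - 1)\<^esub>i\<in>{0..n - 1}. alt (chain (n - 1)) i (face n i x)
     else \<zero>\<^bsub>chain (n - 1)\<^esub>)"

definition lam :: "int \<Rightarrow> (('a, 'b) array \<Rightarrow> 'k) set \<Rightarrow> (('a, 'b) array \<Rightarrow> 'k) set"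
  where "lam n x = alt (chain n) n (on_simple n (rotate n) x)"

definition one_minus_lam :: "int \<Rightarrow> (('a, 'b) array \<Rightarrow> 'k) set \<Rightarrow> (('a, 'b) array \<Rightarrow> 'k) set"
  where "one_minus_lam n x = x \<ominus>\<^bsub>chain n\<^esub> lam n x"

definition norm_op :: "int \<Rightarrow> (('a, 'b) array \<Rightarrow> 'k) set \<Rightarrow> (('a, 'b) array \<Rightarrow> 'k) set"
  where "norm_op n x = (\<Oplus>\<^bsub>chain n\<^esub>j\<in>{j::nat. int j \<le> n}. (lam n ^^ j) x)"

subsection \<open>Secondary Hochschild and cyclic homology\<close>

definition HH :: "int \<Rightarrow> ('k, (('a, 'b) array \<Rightarrow> 'k) set set) module"
  where "HH n = homology chain hoch_b n"

definition im_one_minus_lam :: "int \<Rightarrow> (('a, 'b) array \<Rightarrow> 'k) set set"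
  where "im_one_minus_lam n = one_minus_lam n ` carrier (chain n)"

definition cyc_chain :: "int \<Rightarrow> ('k, (('a, 'b) array \<Rightarrow> 'k) set set) module"
  where "cyc_chain n = quot_mod (chain n) (im_one_minus_lam n)"

definition cyc_b :: "int \<Rightarrow> (('a, 'b) array \<Rightarrow> 'k) set set \<Rightarrow> (('a, 'b) array \<Rightarrow> 'k) set set"
  where "cyc_b n = induced (chain (n - 1)) (im_one_minus_lam (n - 1)) (hoch_b n)"

definition HC :: "int \<Rightarrow> ('k, (('a, 'b) array \<Rightarrow> 'k) set set set) module"
  where "HC n = homology cyc_chain cyc_b n"

subsection \<open>The total complex of the cyclic bicomplex\<close>

text \<open>
  An element of \<open>Tot n\<close> is a family \<open>x\<close> whose component \<open>x i\<close> is an \<open>i\<close>-chain, placed in row \<open>i\<close>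
  and column \<open>n - i\<close>, and which vanishes unless \<open>0 \<le> i \<le> n\<close>.
\<close>

definition Tot :: "int \<Rightarrow> ('k, int \<Rightarrow> (('a, 'b) array \<Rightarrow> 'k) set) module"
  where "Tot n =
    \<lparr>carrier = {x. (\<forall>i. x i \<in> carrier (chain i)) \<and> (\<forall>i. i \<notin> {0..n} \<longrightarrow> x i = \<zero>\<^bsub>chain i\<^esub>)},
     mult = undefined, one = undefined,
     zero = (\<lambda>i. \<zero>\<^bsub>chain i\<^esub>), add = (\<lambda>x y i. x i \<oplus>\<^bsub>chain i\<^esub> y i),
     smult = (\<lambda>c x i. c \<odot>\<^bsub>chain i\<^esub> x i)\<rparr>"

text \<open>
  Row \<open>j\<close> of the differential, in column \<open>n - 1 - j\<close>, receives the vertical differential from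
  row \<open>j + 1\<close> of the same column and the horizontal one from row \<open>j\<close> of column \<open>n - j\<close>.
\<close>

definition bicomplex_vert ::
    "int \<Rightarrow> int \<Rightarrow> (('a, 'b) array \<Rightarrow> 'k) set \<Rightarrow> (('a, 'b) array \<Rightarrow> 'k) set"
  where "bicomplex_vert p q x = (if even p then hoch_b q x else \<ominus>\<^bsub>chain (q - 1)\<^esub> hoch_b' q x)"

definition bicomplex_horiz ::
    "int \<Rightarrow> int \<Rightarrow> (('a, 'b) array \<Rightarrow> 'k) set \<Rightarrow> (('a, 'b) array \<Rightarrow> 'k) set"
  where "bicomplex_horiz p q x = (if odd p then one_minus_lam q x else norm_op q x)"

definition tot_d ::
    "int \<Rightarrow> (int \<Rightarrow> (('a, 'b) array \<Rightarrow> 'k) set) \<Rightarrow> int \<Rightarrow> (('a, 'b) array \<Rightarrow> 'k) set"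
  where "tot_d n x = (\<lambda>j.
    if j \<in> {0..n - 1}
    then bicomplex_vert (n - 1 - j) (j + 1) (x (j + 1)) \<oplus>\<^bsub>chain j\<^esub> bicomplex_horiz (n - j) j (x j)
    else \<zero>\<^bsub>chain j\<^esub>)"

definition trunc ::
    "int \<Rightarrow> (int \<Rightarrow> (('a, 'b) array \<Rightarrow> 'k) set) \<Rightarrow> int \<Rightarrow> (('a, 'b) array \<Rightarrow> 'k) set"
  where "trunc n x = (\<lambda>i. if i \<le> n - 2 then x i else \<zero>\<^bsub>chain i\<^esub>)"

definition Tot' :: "int \<Rightarrow> ('k, int \<Rightarrow> (('a, 'b) array \<Rightarrow> 'k) set) module"
  where "Tot' n = (Tot n)\<lparr>carrier := a_kernel (Tot n) (Tot (n - 2)) (trunc n)\<rparr>"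

subsection \<open>The identifications of homology\<close>

definition col0_incl ::
    "int \<Rightarrow> (('a, 'b) array \<Rightarrow> 'k) set \<Rightarrow> int \<Rightarrow> (('a, 'b) array \<Rightarrow> 'k) set"
  where "col0_incl n y = (\<lambda>i. if i = n then y else \<zero>\<^bsub>chain i\<^esub>)"

definition cyc_proj ::
    "int \<Rightarrow> (int \<Rightarrow> (('a, 'b) array \<Rightarrow> 'k) set) \<Rightarrow> (('a, 'b) array \<Rightarrow> 'k) set set"
  where "cyc_proj n x = im_one_minus_lam n +>\<^bsub>chain n\<^esub> x n"

definition HH_ident ::
    "int \<Rightarrow> (('a, 'b) array \<Rightarrow> 'k) set set \<Rightarrow> (int \<Rightarrow> (('a, 'b) array \<Rightarrow> 'k) set) set"
  where "HH_ident n = hmap Tot' tot_d n (col0_incl n)"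

definition HC_ident ::
    "int \<Rightarrow> (int \<Rightarrow> (('a, 'b) array \<Rightarrow> 'k) set) set \<Rightarrow> (('a, 'b) array \<Rightarrow> 'k) set set set"
  where "HC_ident n = hmap cyc_chain cyc_b n (cyc_proj n)"

definition HH_ident_inv ::
    "int \<Rightarrow> (int \<Rightarrow> (('a, 'b) array \<Rightarrow> 'k) set) set \<Rightarrow> (('a, 'b) array \<Rightarrow> 'k) set set"
  where "HH_ident_inv n = inv_into (carrier (HH n)) (HH_ident n)"

definition HC_ident_inv ::
    "int \<Rightarrow> (('a, 'b) array \<Rightarrow> 'k) set set set \<Rightarrow> (int \<Rightarrow> (('a, 'b) array \<Rightarrow> 'k) set) set"
  where "HC_ident_inv n = inv_into (carrier (homology Tot tot_d n)) (HC_ident n)"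

subsection \<open>The maps of the long exact sequence\<close>

text \<open>
  The connecting homomorphism of the short exact sequence formed by \<open>Tot'\<close>, \<open>Tot\<close> and the shifted
  copy of \<open>Tot\<close>, from the homology of \<open>Tot\<close> in degree \<open>n - 2\<close> to that of \<open>Tot'\<close> in degree \<open>n - 1\<close>:
  lift a cycle in the class \<open>X\<close> along \<open>trunc\<close>, apply the differential, and take the class of the
  result, which lies in \<open>Tot'\<close>. All the cosets in the union coincide.
\<close>

definition connecting ::
    "int \<Rightarrow> (int \<Rightarrow> (('a, 'b) array \<Rightarrow> 'k) set) set \<Rightarrow> (int \<Rightarrow> (('a, 'b) array \<Rightarrow> 'k) set) set"
  where "connecting n X =
    (\<Union>x\<in>{x \<in> carrier (Tot n). trunc n x \<in> X}.
       boundaries Tot' tot_d (n - 1) +>\<^bsub>Tot' (n - 1)\<^esub> tot_d n x)"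

definition S_map :: "int \<Rightarrow> (('a, 'b) array \<Rightarrow> 'k) set set set \<Rightarrow> (('a, 'b) array \<Rightarrow> 'k) set set set"
  where "S_map n = HC_ident (n - 2) \<circ> hmap Tot tot_d (n - 2) (trunc n) \<circ> HC_ident_inv n"

definition B_map :: "int \<Rightarrow> (('a, 'b) array \<Rightarrow> 'k) set set set \<Rightarrow> (('a, 'b) array \<Rightarrow> 'k) set set"
  where "B_map n = HH_ident_inv (n - 1) \<circ> connecting n \<circ> HC_ident_inv (n - 2)"

definition I_map :: "int \<Rightarrow> (('a, 'b) array \<Rightarrow> 'k) set set \<Rightarrow> (('a, 'b) array \<Rightarrow> 'k) set set set"
  where "I_map n = HC_ident n \<circ> hmap Tot tot_d n (\<lambda>x. x) \<circ> HH_ident n"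

end

end

theory Submission
  imports Defs
begin

text \<open>
  Why the theorem holds. Write \<open>C\<^sub>n\<close> for the module of \<open>n\<close>-chains. The long exact sequence is the
  homology sequence of \<open>0 \<rightarrow> Tot' \<rightarrow> Tot \<rightarrow> Tot[2] \<rightarrow> 0\<close>, where the second map is the truncation,
  carried over to \<open>HC\<close> and \<open>HH\<close> along the two identifications (\<open>exact_at_transfer\<close>). The work lies
  in showing that \<open>Tot\<close> is a complex and that the identifications are isomorphisms.

  Put \<open>D\<^sub>i = (-1)^i \<delta>\<^sub>i\<close>. Everything about the faces follows from a few rules, which, up to
  signs, hold for the arrays themselves; they pass to chains because simple tensors span. The cyclic
  operator satisfies \<open>\<lambda>^(n+1) = 1\<close>, and it conjugates the faces into each other,
  \<open>D\<^sub>i \<lambda> = \<lambda> D\<^sub>i\<^sub>-\<^sub>1\<close> for \<open>1 \<le> i \<le> n\<close> and \<open>D\<^sub>0 \<lambda> = D\<^sub>n\<close>. So \<open>D\<^sub>i = \<lambda>^i D\<^sub>0 \<lambda>^(-i)\<close>. This has three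
  consequences. First, \<open>(1 - \<lambda>) b' = b (1 - \<lambda>)\<close> by an index shift. Second, \<open>b' N\<close> and \<open>N b\<close> are both
  equal to \<open>N D\<^sub>0 N\<close>, because \<open>N\<close> absorbs powers of \<open>\<lambda>\<close> on either side. Third, the simplicial
  relation \<open>D\<^sub>i D\<^sub>j = - D\<^sub>j\<^sub>-\<^sub>1 D\<^sub>i\<close> for \<open>i < j\<close> needs to be verified for \<open>i = 0\<close> only, and it gives
  \<open>b b = b' b' = 0\<close>.

  The identification of \<open>HH\<close>: putting a row of units in front of an array is a contracting homotopy
  of \<open>b'\<close>, so column one is acyclic and the inclusion of column zero into \<open>Tot'\<close> is a
  quasi-isomorphism (\<open>HH_ident_lin_iso\<close>).

  The identification of \<open>HC\<close>: in characteristic zero one can divide by \<open>n + 1\<close>, and then the rows are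
  exact, i.e. \<open>ker (1 - \<lambda>) = im N\<close> and \<open>ker N = im (1 - \<lambda>)\<close>. Hence the kernel of the surjection from
  \<open>Tot\<close> onto the cyclic complex is acyclic: a preimage of a cycle is built row by row, from the top
  row downwards (\<open>cyc_ker_acyclic\<close>). So the surjection is a quasi-isomorphism (\<open>HC_ident_lin_iso\<close>).
\<close>

section \<open>Linear maps and quotient modules\<close>

lemma lin_mapI:
  assumes "module K M" "module K N"
    and "\<And>x. x \<in> carrier M \<Longrightarrow> f x \<in> carrier N"
    and "\<And>x y. x \<in> carrier M \<Longrightarrow> y \<in> carrier M \<Longrightarrow> f (x \<oplus>\<^bsub>M\<^esub> y) = f x \<oplus>\<^bsub>N\<^esub> f y"
    and "\<And>c x. c \<in> carrier K \<Longrightarrow> x \<in> carrier M \<Longrightarrow> f (c \<odot>\<^bsub>M\<^esub> x) = c \<odot>\<^bsub>N\<^esub> f x"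
  shows "lin_map K M N f"
  using assms by (auto simp: lin_map_def)

lemma lin_mapD:
  assumes "lin_map K M N f"
  shows "module K M" "module K N" "abelian_group M" "abelian_group N" "cring K"
    and "\<And>x. x \<in> carrier M \<Longrightarrow> f x \<in> carrier N"
    and "\<And>x y. x \<in> carrier M \<Longrightarrow> y \<in> carrier M \<Longrightarrow> f (x \<oplus>\<^bsub>M\<^esub> y) = f x \<oplus>\<^bsub>N\<^esub> f y"
    and "\<And>c x. c \<in> carrier K \<Longrightarrow> x \<in> carrier M \<Longrightarrow> f (c \<odot>\<^bsub>M\<^esub> x) = c \<odot>\<^bsub>N\<^esub> f x"
  using assms by (auto simp: lin_map_def module_def)

lemma lin_map_zero:
  assumes "lin_map K M N f"
  shows "f \<zero>\<^bsub>M\<^esub> = \<zero>\<^bsub>N\<^esub>"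
proof -
  interpret M: abelian_group M by (rule lin_mapD[OF assms])
  interpret N: abelian_group N by (rule lin_mapD[OF assms])
  note D = lin_mapD(6,7)[OF assms]
  have "f \<zero>\<^bsub>M\<^esub> \<oplus>\<^bsub>N\<^esub> f \<zero>\<^bsub>M\<^esub> = f \<zero>\<^bsub>M\<^esub>"
    using D(2)[of "\<zero>\<^bsub>M\<^esub>" "\<zero>\<^bsub>M\<^esub>"] by simp
  then show ?thesis using D(1)[of "\<zero>\<^bsub>M\<^esub>"] by (simp add: N.add.l_cancel_one)
qed

lemma lin_map_neg:
  assumes "lin_map K M N f" "x \<in> carrier M"
  shows "f (\<ominus>\<^bsub>M\<^esub> x) = \<ominus>\<^bsub>N\<^esub> f x"
proof -
  interpret M: abelian_group M by (rule lin_mapD[OF assms(1)])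
  interpret N: abelian_group N by (rule lin_mapD[OF assms(1)])
  note D = lin_mapD(6,7)[OF assms(1)]
  have "f (\<ominus>\<^bsub>M\<^esub> x) \<oplus>\<^bsub>N\<^esub> f x = \<zero>\<^bsub>N\<^esub>"
    using D(2)[of "\<ominus>\<^bsub>M\<^esub> x" x] assms lin_map_zero[OF assms(1)] by (simp add: M.l_neg)
  then show ?thesis using D(1) assms by (metis M.a_inv_closed N.minus_equality)
qed

lemma lin_map_minus:
  assumes "lin_map K M N f" "x \<in> carrier M" "y \<in> carrier M"
  shows "f (x \<ominus>\<^bsub>M\<^esub> y) = f x \<ominus>\<^bsub>N\<^esub> f y"
proof -
  interpret M: abelian_group M by (rule lin_mapD[OF assms(1)])
  show ?thesis
    using assms lin_mapD(7)[OF assms(1)] by (simp add: a_minus_def lin_map_neg)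
qed

lemma lin_map_compose:
  assumes "lin_map K L M f" "lin_map K M N g"
  shows "lin_map K L N (\<lambda>x. g (f x))"
  using assms by (auto simp: lin_map_def Pi_iff)

lemma lin_map_id: "module K M \<Longrightarrow> lin_map K M M (\<lambda>x. x)"
  by (auto simp: lin_map_def)

lemma lin_map_const_zero:
  assumes "module K M" "module K N"
  shows "lin_map K M N (\<lambda>x. \<zero>\<^bsub>N\<^esub>)"
proof -
  interpret N: module K N by fact
  show ?thesis using assms by (intro lin_mapI) auto
qed

lemma lin_map_plus:
  assumes "lin_map K M N f" "lin_map K M N g"
  shows "lin_map K M N (\<lambda>x. f x \<oplus>\<^bsub>N\<^esub> g x)"
proof -
  interpret M: module K M by (rule lin_mapD[OF assms(1)])
  interpret N: module K N by (rule lin_mapD[OF assms(1)])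
  note F = lin_mapD[OF assms(1)] and G = lin_mapD[OF assms(2)]
  show ?thesis
    by (intro lin_mapI F) (auto simp: F G N.a_ac N.smult_r_distr)
qed

lemma lin_map_uminus:
  assumes "lin_map K M N f"
  shows "lin_map K M N (\<lambda>x. \<ominus>\<^bsub>N\<^esub> f x)"
proof -
  interpret M: module K M by (rule lin_mapD[OF assms(1)])
  interpret N: module K N by (rule lin_mapD[OF assms(1)])
  note F = lin_mapD[OF assms(1)]
  show ?thesis
    by (intro lin_mapI F) (auto simp: F N.minus_add N.smult_r_minus)
qed

lemma lin_map_diff:
  assumes "lin_map K M N f" "lin_map K M N g"
  shows "lin_map K M N (\<lambda>x. f x \<ominus>\<^bsub>N\<^esub> g x)"
  unfolding a_minus_def by (intro lin_map_plus lin_map_uminus assms)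

lemma lin_map_cong:
  assumes "lin_map K M N f" "\<And>x. x \<in> carrier M \<Longrightarrow> g x = f x"
  shows "lin_map K M N g"
proof -
  interpret M: module K M by (rule lin_mapD[OF assms(1)])
  note F = lin_mapD[OF assms(1)]
  show ?thesis
    by (intro lin_mapI F) (auto simp: F assms(2))
qed

lemma lin_map_finsum_maps:
  assumes "finite I" "module K M" "module K N" "\<And>i. i \<in> I \<Longrightarrow> lin_map K M N (f i)"
  shows "lin_map K M N (\<lambda>x. \<Oplus>\<^bsub>N\<^esub>i\<in>I. f i x)"
  using assms(1,4)
proof (induction I rule: finite_induct)
  case empty
  interpret N: module K N by fact
  show ?case using assms by (simp add: lin_map_const_zero)
next
  case (insert i I)
  interpret N: module K N by fact
  have "lin_map K M N (\<lambda>x. f i x \<oplus>\<^bsub>N\<^esub> (\<Oplus>\<^bsub>N\<^esub>i\<in>I. f i x))"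
    using insert by (intro lin_map_plus) auto
  moreover have "(\<Oplus>\<^bsub>N\<^esub>i\<in>insert i I. f i x) = f i x \<oplus>\<^bsub>N\<^esub> (\<Oplus>\<^bsub>N\<^esub>i\<in>I. f i x)"
    if "x \<in> carrier M" for x
    using insert.hyps lin_mapD(6)[OF insert.prems] that by (intro N.finsum_insert) auto
  ultimately show ?case by (rule lin_map_cong)
qed

lemma lin_map_finsum:
  assumes f: "lin_map K M N f" and "finite I" "g \<in> I \<rightarrow> carrier M"
  shows "f (\<Oplus>\<^bsub>M\<^esub>i\<in>I. g i) = (\<Oplus>\<^bsub>N\<^esub>i\<in>I. f (g i))"
  using assms(2,3)
proof (induction I rule: finite_induct)
  case empty
  interpret M: abelian_group M by (rule lin_mapD[OF assms(1)])
  interpret N: abelian_group N by (rule lin_mapD[OF assms(1)])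
  show ?case using lin_map_zero[OF f] by simp
next
  case (insert i I)
  interpret M: abelian_group M by (rule lin_mapD[OF assms(1)])
  interpret N: abelian_group N by (rule lin_mapD[OF assms(1)])
  show ?case
    using insert lin_mapD(6,7)[OF f] by (simp add: Pi_iff M.finsum_insert N.finsum_insert)
qed

lemma submodule_kernel:
  assumes "lin_map K M N f"
  shows "submodule (a_kernel M N f) K M"
proof -
  interpret M: module K M by (rule lin_mapD[OF assms(1)])
  interpret N: module K N by (rule lin_mapD[OF assms(1)])
  note F = lin_mapD[OF assms(1)]
  show ?thesis
    by (rule M.submoduleI) (auto simp: a_kernel_def' F lin_map_zero[OF assms] lin_map_neg[OF assms])
qed

lemma submodule_image:
  assumes "lin_map K M N f"
  shows "submodule (f ` carrier M) K N"
proof -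
  interpret M: module K M by (rule lin_mapD[OF assms(1)])
  interpret N: module K N by (rule lin_mapD[OF assms(1)])
  note F = lin_mapD(6-)[OF assms(1)]
  show ?thesis
  proof (rule N.submoduleI)
    show "\<zero>\<^bsub>N\<^esub> \<in> f ` carrier M"
      by (rule image_eqI[of _ _ "\<zero>\<^bsub>M\<^esub>"]) (simp_all add: lin_map_zero[OF assms])
    show "\<And>a. a \<in> f ` carrier M \<Longrightarrow> \<ominus>\<^bsub>N\<^esub> a \<in> f ` carrier M"
      by (auto simp: lin_map_neg[OF assms, symmetric])
    show "\<And>a b. a \<in> f ` carrier M \<Longrightarrow> b \<in> f ` carrier M \<Longrightarrow> a \<oplus>\<^bsub>N\<^esub> b \<in> f ` carrier M"
      by (auto simp: F(2)[symmetric])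
    show "\<And>c x. c \<in> carrier K \<Longrightarrow> x \<in> f ` carrier M \<Longrightarrow> c \<odot>\<^bsub>N\<^esub> x \<in> f ` carrier M"
      by (auto simp: F(3)[symmetric])
  qed (use F(1) in auto)
qed

lemma submodule_vimage:
  assumes "lin_map K M N f" "submodule H K N"
  shows "submodule {x \<in> carrier M. f x \<in> H} K M"
proof -
  interpret M: module K M by (rule lin_mapD[OF assms(1)])
  interpret N: module K N by (rule lin_mapD[OF assms(1)])
  interpret H: submodule H K N by fact
  note F = lin_mapD[OF assms(1)]
  note H = N.submoduleE[OF assms(2)]
  show ?thesis
    using H.one_closed
    by (intro M.submoduleI) (auto simp: F H lin_map_zero[OF assms(1)] lin_map_neg[OF assms(1)])
qed

text \<open>
  Cycles form the module \<open>M\<lparr>carrier := S\<rparr>\<close>, which has the operations of \<open>M\<close>. The rule lets cosets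
  of cycles be computed in \<open>M\<close>.
\<close>

lemma a_r_coset_carrier_update [simp]: "a_r_coset (M\<lparr>carrier := S\<rparr>) = a_r_coset M"
  by (intro ext) (simp add: a_r_coset_def r_coset_def)

lemma submodule_minus:
  assumes "module K M" "submodule H K M" "x \<in> H" "y \<in> H"
  shows "x \<ominus>\<^bsub>M\<^esub> y \<in> H"
  using module.submoduleE[OF assms(1,2)] assms(3,4) by (simp add: a_minus_def)

lemma a_minus_carrier_update:
  assumes "module K M" "submodule H K M" "x \<in> H" "y \<in> H"
  shows "x \<ominus>\<^bsub>M\<lparr>carrier := H\<rparr>\<^esub> y = x \<ominus>\<^bsub>M\<^esub> y"
proof -
  interpret M: module K M by fact
  interpret H: submodule H K M by fact
  have "\<ominus>\<^bsub>M\<lparr>carrier := H\<rparr>\<^esub> y = \<ominus>\<^bsub>M\<^esub> y"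
    using M.a_group assms H.subgroup_axioms
      group.m_inv_consistent[of "add_monoid M" H y] by (simp add: a_inv_def)
  then show ?thesis by (simp add: a_minus_def)
qed

context
  fixes K :: "('k, 'i) ring_scheme" and M :: "('k, 'm, 'j) module_scheme" and H :: "'m set"
  assumes M: "module K M" and H: "submodule H K M"
begin

interpretation M: module K M by (rule M)
interpretation H: submodule H K M by (rule H)
interpretation AS: abelian_subgroup H M
  by (rule abelian_subgroupI3) (auto intro!: additive_subgroup.intro H.subgroup_axioms M.abelian_group_axioms)

lemma coset_eq_iff:
  assumes "x \<in> carrier M" "y \<in> carrier M"
  shows "H +>\<^bsub>M\<^esub> x = H +>\<^bsub>M\<^esub> y \<longleftrightarrow> x \<ominus>\<^bsub>M\<^esub> y \<in> H"
proof
  assume "H +>\<^bsub>M\<^esub> x = H +>\<^bsub>M\<^esub> y"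
  then have "x \<in> H +>\<^bsub>M\<^esub> y" using AS.a_rcos_self[OF assms(1)] by simp
  then show "x \<ominus>\<^bsub>M\<^esub> y \<in> H" using AS.a_rcos_module assms by (simp add: a_minus_def)
next
  assume "x \<ominus>\<^bsub>M\<^esub> y \<in> H"
  then have "x \<in> H +>\<^bsub>M\<^esub> y" using AS.a_rcos_module assms by (simp add: a_minus_def)
  then show "H +>\<^bsub>M\<^esub> x = H +>\<^bsub>M\<^esub> y"
    using M.a_repr_independence[of x H y] assms H.subgroup_axioms by auto
qed

lemma coset_eq_subgroup_iff:
  assumes "x \<in> carrier M"
  shows "H +>\<^bsub>M\<^esub> x = H \<longleftrightarrow> x \<in> H"
  using M.a_coset_join1[of H x] M.a_coset_join2[of x H] assms H.subgroup_axioms by auto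

lemma mem_coset:
  assumes "x \<in> carrier M" "z \<in> H +>\<^bsub>M\<^esub> x"
  shows "z \<in> carrier M" "H +>\<^bsub>M\<^esub> z = H +>\<^bsub>M\<^esub> x"
  using assms M.a_repr_independence[of z H x] H.subgroup_axioms AS.a_elemrcos_carrier by auto

lemma mem_coset_self: "x \<in> carrier M \<Longrightarrow> x \<in> H +>\<^bsub>M\<^esub> x"
  by (rule AS.a_rcos_self)

lemma quot_mod_carrier: "carrier (quot_mod M H) = (\<lambda>x. H +>\<^bsub>M\<^esub> x) ` carrier M"
  by (auto simp: quot_mod_def A_RCOSETS_def')

lemma quot_mod_zero: "\<zero>\<^bsub>quot_mod M H\<^esub> = H"
  by (simp add: quot_mod_def)

lemma quot_mod_zero_coset: "\<zero>\<^bsub>quot_mod M H\<^esub> = H +>\<^bsub>M\<^esub> \<zero>\<^bsub>M\<^esub>"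
  using coset_eq_subgroup_iff[of "\<zero>\<^bsub>M\<^esub>"] H.one_closed by (simp add: quot_mod_def)

lemma quot_mod_add:
  assumes "x \<in> carrier M" "y \<in> carrier M"
  shows "(H +>\<^bsub>M\<^esub> x) \<oplus>\<^bsub>quot_mod M H\<^esub> (H +>\<^bsub>M\<^esub> y) = H +>\<^bsub>M\<^esub> (x \<oplus>\<^bsub>M\<^esub> y)"
  using AS.a_rcos_sum[OF assms] by (simp add: quot_mod_def)

lemma quot_mod_smult:
  assumes "c \<in> carrier K" "x \<in> carrier M"
  shows "c \<odot>\<^bsub>quot_mod M H\<^esub> (H +>\<^bsub>M\<^esub> x) = H +>\<^bsub>M\<^esub> (c \<odot>\<^bsub>M\<^esub> x)"
proof -
  have "H +>\<^bsub>M\<^esub> (c \<odot>\<^bsub>M\<^esub> z) = H +>\<^bsub>M\<^esub> (c \<odot>\<^bsub>M\<^esub> x)" if "z \<in> H +>\<^bsub>M\<^esub> x" for z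
  proof -
    note z = mem_coset[OF assms(2) that]
    have "z \<ominus>\<^bsub>M\<^esub> x \<in> H" using z assms coset_eq_iff by simp
    then have "c \<odot>\<^bsub>M\<^esub> (z \<ominus>\<^bsub>M\<^esub> x) \<in> H" using assms by simp
    moreover have "c \<odot>\<^bsub>M\<^esub> (z \<ominus>\<^bsub>M\<^esub> x) = c \<odot>\<^bsub>M\<^esub> z \<ominus>\<^bsub>M\<^esub> c \<odot>\<^bsub>M\<^esub> x"
      using assms z by (simp add: a_minus_def M.smult_r_distr M.smult_r_minus)
    ultimately show ?thesis using assms z coset_eq_iff by simp
  qed
  then have "(\<Union>z\<in>H +>\<^bsub>M\<^esub> x. H +>\<^bsub>M\<^esub> (c \<odot>\<^bsub>M\<^esub> z)) = H +>\<^bsub>M\<^esub> (c \<odot>\<^bsub>M\<^esub> x)"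
    using mem_coset_self[OF assms(2)] by blast
  then show ?thesis by (simp add: quot_mod_def)
qed

lemma module_quot_mod: "module K (quot_mod M H)"
proof (rule moduleI)
  show "cring K" by (rule M.is_cring)
  show "abelian_group (quot_mod M H)"
  proof (rule abelian_groupI)
    fix X assume "X \<in> carrier (quot_mod M H)"
    then obtain x where x: "x \<in> carrier M" "X = H +>\<^bsub>M\<^esub> x" by (auto simp: quot_mod_carrier)
    have "(H +>\<^bsub>M\<^esub> (\<ominus>\<^bsub>M\<^esub> x)) \<oplus>\<^bsub>quot_mod M H\<^esub> X = \<zero>\<^bsub>quot_mod M H\<^esub>"
      using x by (simp add: quot_mod_add quot_mod_zero_coset M.l_neg)
    moreover have "H +>\<^bsub>M\<^esub> (\<ominus>\<^bsub>M\<^esub> x) \<in> carrier (quot_mod M H)"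
      using x by (auto simp: quot_mod_carrier)
    ultimately show "\<exists>y\<in>carrier (quot_mod M H). y \<oplus>\<^bsub>quot_mod M H\<^esub> X = \<zero>\<^bsub>quot_mod M H\<^esub>"
      by blast
  qed (auto simp: quot_mod_carrier quot_mod_add quot_mod_zero_coset M.a_ac)
qed (auto simp: quot_mod_carrier quot_mod_add quot_mod_smult M.smult_l_distr M.smult_r_distr
        M.smult_assoc1)

lemma lin_map_coset: "lin_map K M (quot_mod M H) (\<lambda>x. H +>\<^bsub>M\<^esub> x)"
  by (intro lin_mapI M module_quot_mod) (auto simp: quot_mod_carrier quot_mod_add quot_mod_smult)

end

text \<open>
  Two representatives of a coset of \<open>H\<close> differ by an element of \<open>H\<close>, so their images lie in the same
  coset of \<open>G\<close>, and the union that defines \<^const>\<open>induced\<close> is a union of equal cosets.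
\<close>

lemma induced_coset:
  assumes f: "lin_map K M N f" and H: "submodule H K M" and G: "submodule G K N"
    and sub: "\<And>x. x \<in> H \<Longrightarrow> f x \<in> G" and x: "x \<in> carrier M"
  shows "induced N G f (H +>\<^bsub>M\<^esub> x) = G +>\<^bsub>N\<^esub> f x"
proof -
  note F = lin_mapD[OF f]
  have "G +>\<^bsub>N\<^esub> f z = G +>\<^bsub>N\<^esub> f x" if "z \<in> H +>\<^bsub>M\<^esub> x" for z
  proof -
    note z = mem_coset[OF F(1) H x that]
    have "z \<ominus>\<^bsub>M\<^esub> x \<in> H" using z x coset_eq_iff[OF F(1) H] by simp
    then have "f z \<ominus>\<^bsub>N\<^esub> f x \<in> G" using sub lin_map_minus[OF f z(1) x] by metis
    then show ?thesis using z x F coset_eq_iff[OF F(2) G] by simp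
  qed
  then show ?thesis
    unfolding induced_def using mem_coset_self[OF F(1) H x] by blast
qed

lemma lin_map_induced:
  assumes f: "lin_map K M N f" and H: "submodule H K M" and G: "submodule G K N"
    and sub: "\<And>x. x \<in> H \<Longrightarrow> f x \<in> G"
  shows "lin_map K (quot_mod M H) (quot_mod N G) (induced N G f)"
proof -
  note F = lin_mapD[OF f]
  interpret M: module K M by (rule F)
  note ic = induced_coset[OF assms]
  show ?thesis
    by (intro lin_mapI module_quot_mod F H G)
      (auto simp: quot_mod_carrier[OF F(1) H] quot_mod_carrier[OF F(2) G] quot_mod_add[OF F(1) H]
        quot_mod_add[OF F(2) G] quot_mod_smult[OF F(1) H] quot_mod_smult[OF F(2) G] ic F)
qed

section \<open>Homology and long exact sequences\<close>

context abelian_group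
begin

lemma diff_eq_zero_iff: "x \<in> carrier G \<Longrightarrow> y \<in> carrier G \<Longrightarrow> x \<ominus> y = \<zero> \<longleftrightarrow> x = y"
  by (metis a_inv_closed add.inv_equality add.r_inv minus_minus a_minus_def)

lemma diff_eq_iff: "x \<in> carrier G \<Longrightarrow> y \<in> carrier G \<Longrightarrow> z \<in> carrier G \<Longrightarrow> x \<ominus> y = z \<longleftrightarrow> x = z \<oplus> y"
  by (metis a_minus_def add.inv_solve_right)

lemma diff_add_cancel: "x \<in> carrier G \<Longrightarrow> y \<in> carrier G \<Longrightarrow> (x \<ominus> y) \<oplus> y = x"
  by (metis diff_eq_iff minus_closed)

lemma add_diff_cancel: "x \<in> carrier G \<Longrightarrow> y \<in> carrier G \<Longrightarrow> (x \<oplus> y) \<ominus> y = x"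
  by (metis diff_eq_iff a_closed)

lemma add_diff_cancel_left: "x \<in> carrier G \<Longrightarrow> y \<in> carrier G \<Longrightarrow> (x \<oplus> y) \<ominus> x = y"
  by (metis a_comm add_diff_cancel)

lemma diff_zero: "x \<in> carrier G \<Longrightarrow> x \<ominus> \<zero> = x"
  by (simp add: a_minus_def)

end

locale chain_complex =
  fixes K :: "('k, 'i) ring_scheme" and M :: "int \<Rightarrow> ('k, 'm, 'j) module_scheme"
    and d :: "int \<Rightarrow> 'm \<Rightarrow> 'm"
  assumes d_lin: "lin_map K (M n) (M (n - 1)) (d n)"
    and d_d: "x \<in> carrier (M n) \<Longrightarrow> d (n - 1) (d n x) = \<zero>\<^bsub>M (n - 2)\<^esub>"
begin

definition cycles :: "int \<Rightarrow> 'm set"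
  where "cycles n = a_kernel (M n) (M (n - 1)) (d n)"

abbreviation hclass :: "int \<Rightarrow> 'm \<Rightarrow> 'm set"
  where "hclass n x \<equiv> boundaries M d n +>\<^bsub>M n\<^esub> x"

lemma module_chain: "module K (M n)"
  by (rule lin_mapD(1)[OF d_lin])

lemma abelian_group_chain: "abelian_group (M n)"
  by (rule lin_mapD(3)[OF d_lin])

lemma d_closed: "x \<in> carrier (M n) \<Longrightarrow> d n x \<in> carrier (M (n - 1))"
  by (rule lin_mapD(6)[OF d_lin])

lemma d_lin_up: "lin_map K (M (n + 1)) (M n) (d (n + 1))"
  using d_lin[of "n + 1"] by simp

lemma d_d_up: "x \<in> carrier (M (n + 1)) \<Longrightarrow> d n (d (n + 1) x) = \<zero>\<^bsub>M (n - 1)\<^esub>"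
  using d_d[of x "n + 1"] by simp

lemma cycles_iff: "x \<in> cycles n \<longleftrightarrow> x \<in> carrier (M n) \<and> d n x = \<zero>\<^bsub>M (n - 1)\<^esub>"
  by (simp add: cycles_def a_kernel_def')

lemma homology_eq: "homology M d n = quot_mod ((M n)\<lparr>carrier := cycles n\<rparr>) (boundaries M d n)"
  by (simp add: homology_def cycles_def)

lemma submodule_cycles: "submodule (cycles n) K (M n)"
  unfolding cycles_def by (rule submodule_kernel[OF d_lin])

lemma module_cycles: "module K ((M n)\<lparr>carrier := cycles n\<rparr>)"
  by (rule submodule.submodule_is_module[OF submodule_cycles module_chain])

lemma d_cycle: "x \<in> carrier (M (n + 1)) \<Longrightarrow> d (n + 1) x \<in> cycles n"
  using lin_mapD(6)[OF d_lin_up] by (auto simp: cycles_iff d_d_up)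

lemma submodule_boundaries_cycles: "submodule (boundaries M d n) K ((M n)\<lparr>carrier := cycles n\<rparr>)"
proof -
  have "lin_map K (M (n + 1)) ((M n)\<lparr>carrier := cycles n\<rparr>) (d (n + 1))"
    using lin_mapD(7,8)[OF d_lin_up]
    by (intro lin_mapI module_chain module_cycles) (auto simp: d_cycle)
  then show ?thesis unfolding boundaries_def by (rule submodule_image)
qed

lemma module_homology: "module K (homology M d n)"
  unfolding homology_eq by (rule module_quot_mod[OF module_cycles submodule_boundaries_cycles])

lemma homology_carrier: "carrier (homology M d n) = hclass n ` cycles n"
  unfolding homology_eq
  by (simp add: quot_mod_carrier[OF module_cycles submodule_boundaries_cycles])

lemma homology_zero: "\<zero>\<^bsub>homology M d n\<^esub> = boundaries M d n"
  by (simp add: homology_def quot_mod_def)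

lemma hclass_eq_iff:
  assumes "x \<in> cycles n" "y \<in> cycles n"
  shows "hclass n x = hclass n y \<longleftrightarrow> x \<ominus>\<^bsub>M n\<^esub> y \<in> boundaries M d n"
  using coset_eq_iff[OF module_cycles submodule_boundaries_cycles, of x n y] assms
  by (simp add: a_minus_carrier_update[OF module_chain submodule_cycles])

lemma hclass_zero_iff:
  assumes "x \<in> cycles n"
  shows "hclass n x = \<zero>\<^bsub>homology M d n\<^esub> \<longleftrightarrow> x \<in> boundaries M d n"
  using coset_eq_subgroup_iff[OF module_cycles submodule_boundaries_cycles, of x n] assms
  by (simp add: homology_zero)

lemma mem_hclass_iff:
  assumes "x \<in> cycles n"
  shows "y \<in> hclass n x \<longleftrightarrow> y \<in> cycles n \<and> y \<ominus>\<^bsub>M n\<^esub> x \<in> boundaries M d n"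
proof
  assume "y \<in> hclass n x"
  then show "y \<in> cycles n \<and> y \<ominus>\<^bsub>M n\<^esub> x \<in> boundaries M d n"
    using mem_coset[OF module_cycles submodule_boundaries_cycles, of x n y] assms hclass_eq_iff
    by simp
next
  assume "y \<in> cycles n \<and> y \<ominus>\<^bsub>M n\<^esub> x \<in> boundaries M d n"
  then show "y \<in> hclass n x"
    using hclass_eq_iff[of y n x] assms
      mem_coset_self[OF module_cycles submodule_boundaries_cycles, of y n] by simp
qed

end

lemma cycles_chain_map:
  assumes M: "chain_complex K M d" and N: "chain_complex K N e"
    and f: "lin_map K (M m) (N n) f"
    and cyc: "\<And>x. x \<in> carrier (M m) \<Longrightarrow> d m x = \<zero>\<^bsub>M (m - 1)\<^esub> \<Longrightarrow> e n (f x) = \<zero>\<^bsub>N (n - 1)\<^esub>"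
  shows "lin_map K ((M m)\<lparr>carrier := chain_complex.cycles M d m\<rparr>)
           ((N n)\<lparr>carrier := chain_complex.cycles N e n\<rparr>) f"
  using lin_mapD[OF f]
  by (intro lin_mapI chain_complex.module_cycles[OF M] chain_complex.module_cycles[OF N])
    (auto simp: chain_complex.cycles_iff[OF M] chain_complex.cycles_iff[OF N] cyc)

text \<open>
  Source and target may sit in different degrees \<open>m\<close> and \<open>n\<close>, since the truncation lowers the degree
  by two.
\<close>

lemma hmap_hclass:
  assumes M: "chain_complex K M d" and N: "chain_complex K N e"
    and f: "lin_map K (M m) (N n) f"
    and cyc: "\<And>x. x \<in> carrier (M m) \<Longrightarrow> d m x = \<zero>\<^bsub>M (m - 1)\<^esub> \<Longrightarrow> e n (f x) = \<zero>\<^bsub>N (n - 1)\<^esub>"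
    and bdy: "\<And>x. x \<in> carrier (M (m + 1)) \<Longrightarrow> f (d (m + 1) x) \<in> boundaries N e n"
  shows "lin_map K (homology M d m) (homology N e n) (hmap N e n f)"
    and "\<And>x. x \<in> chain_complex.cycles M d m \<Longrightarrow>
      hmap N e n f (boundaries M d m +>\<^bsub>M m\<^esub> x) = boundaries N e n +>\<^bsub>N n\<^esub> f x"
proof -
  note c = cycles_chain_map[OF M N f cyc]
    chain_complex.submodule_boundaries_cycles[OF M] chain_complex.submodule_boundaries_cycles[OF N]
  have b: "f x \<in> boundaries N e n" if "x \<in> boundaries M d m" for x
    using that bdy by (auto simp: boundaries_def)
  have h: "hmap N e n f = induced ((N n)\<lparr>carrier := chain_complex.cycles N e n\<rparr>)
      (boundaries N e n) f"
    by (intro ext) (simp add: hmap_def induced_def)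
  show "lin_map K (homology M d m) (homology N e n) (hmap N e n f)"
    unfolding chain_complex.homology_eq[OF M] chain_complex.homology_eq[OF N] h by (rule lin_map_induced) (use c b in auto)
  show "hmap N e n f (boundaries M d m +>\<^bsub>M m\<^esub> x) = boundaries N e n +>\<^bsub>N n\<^esub> f x"
    if "x \<in> chain_complex.cycles M d m" for x
    using induced_coset[OF c(1,2,3), of x] b that unfolding h by simp
qed

text \<open>
  A criterion for one degree: \<open>f\<close> is injective on homology if it reflects boundaries, and surjective
  if every cycle of the target is homologous to the image of a cycle.
\<close>

lemma lin_iso_hmapI:
  assumes M: "chain_complex K M d" and N: "chain_complex K N e"
    and f: "lin_map K (M m) (N n) f"
    and cyc: "\<And>x. x \<in> carrier (M m) \<Longrightarrow> d m x = \<zero>\<^bsub>M (m - 1)\<^esub> \<Longrightarrow> e n (f x) = \<zero>\<^bsub>N (n - 1)\<^esub>"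
    and bdy: "\<And>x. x \<in> carrier (M (m + 1)) \<Longrightarrow> f (d (m + 1) x) \<in> boundaries N e n"
    and inj: "\<And>x. x \<in> carrier (M m) \<Longrightarrow> d m x = \<zero>\<^bsub>M (m - 1)\<^esub> \<Longrightarrow> f x \<in> boundaries N e n \<Longrightarrow>
      x \<in> boundaries M d m"
    and surj: "\<And>y. y \<in> carrier (N n) \<Longrightarrow> e n y = \<zero>\<^bsub>N (n - 1)\<^esub> \<Longrightarrow>
      \<exists>x. x \<in> carrier (M m) \<and> d m x = \<zero>\<^bsub>M (m - 1)\<^esub> \<and> f x \<ominus>\<^bsub>N n\<^esub> y \<in> boundaries N e n"
  shows "lin_iso K (homology M d m) (homology N e n) (hmap N e n f)"
proof -
  interpret M: chain_complex K M d by fact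
  interpret N: chain_complex K N e by fact
  note h = hmap_hclass[OF M N f cyc bdy]
  have fc: "f x \<in> N.cycles n" if "x \<in> M.cycles m" for x
    using that cyc lin_mapD(6)[OF f] by (simp add: M.cycles_iff N.cycles_iff)
  have "inj_on (hmap N e n f) (carrier (homology M d m))"
  proof (rule inj_onI)
    fix X Y assume "X \<in> carrier (homology M d m)" "Y \<in> carrier (homology M d m)"
      and eq: "hmap N e n f X = hmap N e n f Y"
    then obtain x y where x: "x \<in> M.cycles m" "X = M.hclass m x" and y: "y \<in> M.cycles m" "Y = M.hclass m y"
      by (auto simp: M.homology_carrier)
    have "f x \<ominus>\<^bsub>N n\<^esub> f y \<in> boundaries N e n"
      using eq x y N.hclass_eq_iff[OF fc[OF x(1)] fc[OF y(1)]] by (simp add: h(2))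
    then have "f (x \<ominus>\<^bsub>M m\<^esub> y) \<in> boundaries N e n"
      using lin_map_minus[OF f] x y by (simp add: M.cycles_iff)
    moreover have "x \<ominus>\<^bsub>M m\<^esub> y \<in> M.cycles m"
      using submodule_minus[OF M.module_chain M.submodule_cycles x(1) y(1)] .
    ultimately have "x \<ominus>\<^bsub>M m\<^esub> y \<in> boundaries M d m" using inj by (simp add: M.cycles_iff)
    then show "X = Y" using x y M.hclass_eq_iff by simp
  qed
  moreover have "hmap N e n f ` carrier (homology M d m) = carrier (homology N e n)"
  proof
    show "hmap N e n f ` carrier (homology M d m) \<subseteq> carrier (homology N e n)"
      using lin_mapD(6)[OF h(1)] by auto
    show "carrier (homology N e n) \<subseteq> hmap N e n f ` carrier (homology M d m)"
    proof
      fix Y assume "Y \<in> carrier (homology N e n)"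
      then obtain y where y: "y \<in> N.cycles n" "Y = N.hclass n y" by (auto simp: N.homology_carrier)
      then obtain x where x: "x \<in> M.cycles m" "f x \<ominus>\<^bsub>N n\<^esub> y \<in> boundaries N e n"
        using surj[of y] by (auto simp: M.cycles_iff N.cycles_iff)
      have "Y = hmap N e n f (M.hclass m x)"
        using x y N.hclass_eq_iff[OF fc[OF x(1)] y(1)] by (simp add: h(2))
      then show "Y \<in> hmap N e n f ` carrier (homology M d m)" using x by (simp add: M.homology_carrier)
    qed
  qed
  ultimately show ?thesis using h(1) by (simp add: lin_iso_def bij_betw_def)
qed

text \<open>
  Degree shifts: the truncation is a chain map into the complex \<open>\<lambda>n. Tot (n - 2)\<close>, whose homology in
  degree \<open>n\<close> has to be read as the homology of \<open>Tot\<close> in degree \<open>n - 2\<close>.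
\<close>

lemma homology_shift:
  "homology (\<lambda>n. M (n - k)) (\<lambda>n. d (n - k)) n = homology M d (n - k)"
  "hmap (\<lambda>n. M (n - k)) (\<lambda>n. d (n - k)) n f = hmap M d (n - k) f"
  by (simp_all add: homology_def hmap_def boundaries_def algebra_simps)

lemma chain_complex_shift:
  assumes "chain_complex K M d"
  shows "chain_complex K (\<lambda>n. M (n - k)) (\<lambda>n. d (n - k))"
proof -
  interpret chain_complex K M d by fact
  show ?thesis
  proof
    fix n x
    show "lin_map K (M (n - k)) (M (n - 1 - k)) (d (n - k))"
      using d_lin[of "n - k"] by (simp add: algebra_simps)
    show "x \<in> carrier (M (n - k)) \<Longrightarrow> d (n - 1 - k) (d (n - k) x) = \<zero>\<^bsub>M (n - 2 - k)\<^esub>"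
      using d_d[of x "n - k"] by (simp add: algebra_simps)
  qed
qed

text \<open>
  A short exact sequence of complexes, given by its surjection \<open>p\<close>; the third term is the kernel,
  with the differential of \<open>M\<close>. Both the truncation and the projection onto the cyclic complex are
  instances.
\<close>

locale complex_surjection =
  M: chain_complex K M d + N: chain_complex K N e
  for K :: "('k, 'i) ring_scheme" and M :: "int \<Rightarrow> ('k, 'm, 'j) module_scheme"
    and d :: "int \<Rightarrow> 'm \<Rightarrow> 'm" and N :: "int \<Rightarrow> ('k, 'n, 'l) module_scheme"
    and e :: "int \<Rightarrow> 'n \<Rightarrow> 'n" +
  fixes p :: "int \<Rightarrow> 'm \<Rightarrow> 'n"
  assumes p_lin: "lin_map K (M n) (N n) (p n)"
    and p_surj: "p n ` carrier (M n) = carrier (N n)"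
    and p_d: "x \<in> carrier (M n) \<Longrightarrow> p (n - 1) (d n x) = e n (p n x)"
begin

definition ker :: "int \<Rightarrow> ('k, 'm, 'j) module_scheme"
  where "ker n = (M n)\<lparr>carrier := a_kernel (M n) (N n) (p n)\<rparr>"

definition connecting_map :: "int \<Rightarrow> 'n set \<Rightarrow> 'm set"
  where "connecting_map n X =
    (\<Union>x\<in>{x \<in> carrier (M n). p n x \<in> X}. boundaries ker d (n - 1) +>\<^bsub>ker (n - 1)\<^esub> d n x)"

lemma ker_simps [simp]:
  "zero (ker n) = zero (M n)" "add (ker n) = add (M n)" "smult (ker n) = smult (M n)"
  by (simp_all add: ker_def)

lemma ker_carrier: "x \<in> carrier (ker n) \<longleftrightarrow> x \<in> carrier (M n) \<and> p n x = \<zero>\<^bsub>N n\<^esub>"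
  by (simp add: ker_def a_kernel_def')

lemma p_closed: "x \<in> carrier (M n) \<Longrightarrow> p n x \<in> carrier (N n)"
  by (rule lin_mapD(6)[OF p_lin])

lemma p_d_up: "x \<in> carrier (M (n + 1)) \<Longrightarrow> p n (d (n + 1) x) = e (n + 1) (p (n + 1) x)"
  using p_d[of x "n + 1"] by simp

lemma lift:
  assumes "y \<in> carrier (N n)"
  obtains x where "x \<in> carrier (M n)" "p n x = y"
proof -
  have "y \<in> p n ` carrier (M n)" using assms p_surj[of n] by simp
  then show ?thesis using that by (elim imageE) simp
qed

lemma submodule_ker: "submodule (a_kernel (M n) (N n) (p n)) K (M n)"
  by (rule submodule_kernel[OF p_lin])

lemma module_ker: "module K (ker n)"
  unfolding ker_def by (rule submodule.submodule_is_module[OF submodule_ker M.module_chain])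

lemma ker_minus:
  "x \<in> carrier (ker n) \<Longrightarrow> y \<in> carrier (ker n) \<Longrightarrow> x \<ominus>\<^bsub>ker n\<^esub> y = x \<ominus>\<^bsub>M n\<^esub> y"
  unfolding ker_def by (rule a_minus_carrier_update[OF M.module_chain submodule_ker]) simp_all

lemma d_ker: "x \<in> carrier (ker n) \<Longrightarrow> d n x \<in> carrier (ker (n - 1))"
  by (auto simp: ker_carrier M.d_closed p_d lin_map_zero[OF N.d_lin])

lemma ker_complex: "chain_complex K ker d"
proof
  show "lin_map K (ker n) (ker (n - 1)) (d n)" for n
    using lin_mapD(7,8)[OF M.d_lin[of n]]
    by (intro lin_mapI module_ker) (auto simp: d_ker, auto simp: ker_carrier)
qed (simp add: ker_carrier M.d_d)

sublocale L: chain_complex K ker d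
  by (rule ker_complex)

lemma L_cycles: "x \<in> L.cycles n \<longleftrightarrow> x \<in> M.cycles n \<and> p n x = \<zero>\<^bsub>N n\<^esub>"
  by (auto simp: L.cycles_iff M.cycles_iff ker_carrier)

lemma incl_hmap:
  "lin_map K (homology ker d n) (homology M d n) (hmap M d n (\<lambda>x. x))"
  "x \<in> L.cycles n \<Longrightarrow> hmap M d n (\<lambda>x. x) (L.hclass n x) = M.hclass n x"
proof -
  have l: "lin_map K (ker n) (M n) (\<lambda>x. x)"
    by (intro lin_mapI module_ker M.module_chain) (auto simp: ker_carrier)
  have b: "d (n + 1) x \<in> boundaries M d n" if "x \<in> carrier (ker (n + 1))" for x
    using that by (auto simp: boundaries_def ker_carrier)
  note h = hmap_hclass[OF ker_complex M.chain_complex_axioms l _ b]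
  show "lin_map K (homology ker d n) (homology M d n) (hmap M d n (\<lambda>x. x))"
    by (rule h(1)) auto
  show "x \<in> L.cycles n \<Longrightarrow> hmap M d n (\<lambda>x. x) (L.hclass n x) = M.hclass n x"
    by (rule h(2)) auto
qed

lemma proj_hmap:
  "lin_map K (homology M d n) (homology N e n) (hmap N e n (p n))"
  "x \<in> M.cycles n \<Longrightarrow> hmap N e n (p n) (M.hclass n x) = N.hclass n (p n x)"
proof -
  have c: "e n (p n x) = \<zero>\<^bsub>N (n - 1)\<^esub>" if "x \<in> carrier (M n)" "d n x = \<zero>\<^bsub>M (n - 1)\<^esub>" for x
    using that p_d[of x n] lin_map_zero[OF p_lin] by simp
  have b: "p n (d (n + 1) x) \<in> boundaries N e n" if "x \<in> carrier (M (n + 1))" for x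
    using that p_closed by (auto simp: boundaries_def p_d_up)
  note h = hmap_hclass[OF M.chain_complex_axioms N.chain_complex_axioms p_lin c b]
  show "lin_map K (homology M d n) (homology N e n) (hmap N e n (p n))"
    by (rule h(1))
  show "x \<in> M.cycles n \<Longrightarrow> hmap N e n (p n) (M.hclass n x) = N.hclass n (p n x)"
    by (rule h(2))
qed

lemma p_cycle: "x \<in> M.cycles n \<Longrightarrow> p n x \<in> N.cycles n"
  using p_d[of x n] lin_map_zero[OF p_lin] by (auto simp: M.cycles_iff N.cycles_iff p_closed)

lemma d_lift_cycle:
  assumes "x \<in> carrier (M n)" "p n x \<in> N.cycles n"
  shows "d n x \<in> L.cycles (n - 1)"
  using assms M.d_d[of x n] p_d[of x n] by (auto simp: L_cycles M.cycles_iff N.cycles_iff M.d_closed)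

text \<open>
  The connecting homomorphism does not depend on the lift. If \<open>p x\<close> and \<open>p y\<close> are homologous cycles,
  write \<open>p y - p x = e (p w)\<close>; then \<open>y - x - d w\<close> lies in the kernel, and it has the same
  differential as \<open>y - x\<close>. So \<open>d x\<close> and \<open>d y\<close> differ by a boundary of the kernel.
\<close>

lemma connecting_map_hclass:
  assumes x: "x \<in> carrier (M n)" "p n x \<in> N.cycles n"
  shows "connecting_map n (N.hclass n (p n x)) = L.hclass (n - 1) (d n x)"
proof -
  interpret Mn: module K "M n" by (rule M.module_chain)
  interpret Nn: module K "N n" by (rule N.module_chain)
  have "L.hclass (n - 1) (d n y) = L.hclass (n - 1) (d n x)"
    if y: "y \<in> carrier (M n)" "p n y \<in> N.hclass n (p n x)" for y
  proof -
    have py: "p n y \<in> N.cycles n" "p n y \<ominus>\<^bsub>N n\<^esub> p n x \<in> boundaries N e n"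
      using y(2) N.mem_hclass_iff[OF x(2)] by auto
    then obtain z where z: "z \<in> carrier (N (n + 1))" "p n y \<ominus>\<^bsub>N n\<^esub> p n x = e (n + 1) z"
      by (auto simp: boundaries_def)
    obtain w where w: "w \<in> carrier (M (n + 1))" "p (n + 1) w = z" using lift[OF z(1)] .
    let ?dw = "d (n + 1) w"
    have dw: "?dw \<in> carrier (M n)" using lin_mapD(6)[OF M.d_lin_up w(1)] .
    have yx: "y \<ominus>\<^bsub>M n\<^esub> x \<in> carrier (M n)" using y x by simp
    let ?u = "(y \<ominus>\<^bsub>M n\<^esub> x) \<ominus>\<^bsub>M n\<^esub> ?dw"
    have "p n ?u = (p n y \<ominus>\<^bsub>N n\<^esub> p n x) \<ominus>\<^bsub>N n\<^esub> p n ?dw"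
      using lin_map_minus[OF p_lin] x y yx dw by simp
    also have "\<dots> = \<zero>\<^bsub>N n\<^esub>"
      using z(2) w p_d_up[OF w(1)] p_closed[OF dw]
      by (simp add: a_minus_def Nn.r_neg)
    finally have u: "?u \<in> carrier (ker n)" using yx dw by (simp add: ker_carrier)
    have "d n ?u = d n (y \<ominus>\<^bsub>M n\<^esub> x) \<ominus>\<^bsub>M (n - 1)\<^esub> d n ?dw"
      using lin_map_minus[OF M.d_lin yx dw] .
    also have "\<dots> = d n (y \<ominus>\<^bsub>M n\<^esub> x)"
      using M.d_d_up[OF w(1)] M.d_closed[OF yx] by (simp add: abelian_group.diff_zero[OF M.abelian_group_chain])
    also have "\<dots> = d n y \<ominus>\<^bsub>M (n - 1)\<^esub> d n x" using lin_map_minus[OF M.d_lin] x y by simp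
    also have "\<dots> = d n y \<ominus>\<^bsub>ker (n - 1)\<^esub> d n x"
      using d_lift_cycle[OF x] d_lift_cycle[OF y(1) py(1)] by (intro ker_minus[symmetric]) (auto simp: L.cycles_iff)
    finally have "d n y \<ominus>\<^bsub>ker (n - 1)\<^esub> d n x \<in> boundaries ker d (n - 1)"
      using u by (force simp: boundaries_def)
    then show ?thesis
      using L.hclass_eq_iff[OF d_lift_cycle[OF y(1) py(1)] d_lift_cycle[OF x]] by simp
  qed
  moreover have "p n x \<in> N.hclass n (p n x)"
    using x(2) N.mem_hclass_iff[OF x(2), of "p n x"]
      mem_coset_self[OF N.module_cycles N.submodule_boundaries_cycles, of "p n x" n] by simp
  ultimately show ?thesis unfolding connecting_map_def using x(1) by blast
qed

lemma N_class_lift: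
  assumes "Y \<in> carrier (homology N e n)"
  obtains x where "x \<in> carrier (M n)" "p n x \<in> N.cycles n" "Y = N.hclass n (p n x)"
proof -
  obtain y where y: "y \<in> N.cycles n" "Y = N.hclass n y"
    using assms by (auto simp: N.homology_carrier)
  obtain x where "x \<in> carrier (M n)" "p n x = y" using lift y(1) by (auto simp: N.cycles_iff)
  then show ?thesis using that y by blast
qed

lemma connecting_map_lin: "lin_map K (homology N e n) (homology ker d (n - 1)) (connecting_map n)"
proof (rule lin_mapI)
  interpret Mn: module K "M n" by (rule M.module_chain)
  note cN = quot_mod_add[OF N.module_cycles N.submodule_boundaries_cycles, of _ n]
    quot_mod_smult[OF N.module_cycles N.submodule_boundaries_cycles, of _ _ n]
  note cL = quot_mod_add[OF L.module_cycles L.submodule_boundaries_cycles, of _ "n - 1"]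
    quot_mod_smult[OF L.module_cycles L.submodule_boundaries_cycles, of _ _ "n - 1"]
  show "connecting_map n X \<in> carrier (homology ker d (n - 1))" if "X \<in> carrier (homology N e n)" for X
    using N_class_lift[OF that] d_lift_cycle connecting_map_hclass
    by (metis L.homology_carrier imageI)
  fix X assume "X \<in> carrier (homology N e n)"
  then obtain x where x: "x \<in> carrier (M n)" "p n x \<in> N.cycles n" "X = N.hclass n (p n x)"
    by (rule N_class_lift)
  note dx = d_lift_cycle[OF x(1,2)]
  {
    fix Y assume "Y \<in> carrier (homology N e n)"
    then obtain y where y: "y \<in> carrier (M n)" "p n y \<in> N.cycles n" "Y = N.hclass n (p n y)"
      by (rule N_class_lift)
    note dy = d_lift_cycle[OF y(1,2)]
    have xy: "p n (x \<oplus>\<^bsub>M n\<^esub> y) = p n x \<oplus>\<^bsub>N n\<^esub> p n y" using lin_mapD(7)[OF p_lin] x y by simp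
    have "p n (x \<oplus>\<^bsub>M n\<^esub> y) \<in> N.cycles n"
      unfolding xy using module.submoduleE(5)[OF N.module_chain N.submodule_cycles] x y by simp
    then have "connecting_map n (N.hclass n (p n x \<oplus>\<^bsub>N n\<^esub> p n y)) = L.hclass (n - 1) (d n (x \<oplus>\<^bsub>M n\<^esub> y))"
      using connecting_map_hclass[of "x \<oplus>\<^bsub>M n\<^esub> y" n] x y xy by simp
    also have "d n (x \<oplus>\<^bsub>M n\<^esub> y) = d n x \<oplus>\<^bsub>M (n - 1)\<^esub> d n y"
      using lin_mapD(7)[OF M.d_lin] x y by simp
    finally show "connecting_map n (X \<oplus>\<^bsub>homology N e n\<^esub> Y) =
        connecting_map n X \<oplus>\<^bsub>homology ker d (n - 1)\<^esub> connecting_map n Y"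
      using cN(1)[of "p n x" "p n y"] cL(1)[of "d n x" "d n y"] x y dx dy connecting_map_hclass
      by (simp add: L.homology_eq N.homology_eq)
  }
  fix c assume c: "c \<in> carrier K"
  have cx: "p n (c \<odot>\<^bsub>M n\<^esub> x) = c \<odot>\<^bsub>N n\<^esub> p n x" using lin_mapD(8)[OF p_lin] x c by simp
  have "p n (c \<odot>\<^bsub>M n\<^esub> x) \<in> N.cycles n"
    unfolding cx using module.submoduleE(4)[OF N.module_chain N.submodule_cycles] x c by simp
  then have "connecting_map n (N.hclass n (c \<odot>\<^bsub>N n\<^esub> p n x)) = L.hclass (n - 1) (d n (c \<odot>\<^bsub>M n\<^esub> x))"
    using connecting_map_hclass[of "c \<odot>\<^bsub>M n\<^esub> x" n] x c cx by simp
  also have "d n (c \<odot>\<^bsub>M n\<^esub> x) = c \<odot>\<^bsub>M (n - 1)\<^esub> d n x"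
    using lin_mapD(8)[OF M.d_lin] x c by simp
  finally show "connecting_map n (c \<odot>\<^bsub>homology N e n\<^esub> X) =
      c \<odot>\<^bsub>homology ker d (n - 1)\<^esub> connecting_map n X"
    using cN(2)[OF c, of "p n x"] cL(2)[OF c, of "d n x"] x dx connecting_map_hclass
    by (simp add: L.homology_eq N.homology_eq)
qed (rule N.module_homology L.module_homology)+

text \<open>
  If \<open>p x\<close> is the boundary of \<open>p w\<close>, then \<open>x - d w\<close> is a homologous cycle in the kernel.
\<close>

theorem exact_at_middle:
  "exact_at K (homology ker d n) (hmap M d n (\<lambda>x. x)) (homology M d n) (hmap N e n (p n)) (homology N e n)"
  unfolding exact_at_def
proof (intro conjI incl_hmap proj_hmap equalityI subsetI)
  fix X assume "X \<in> hmap M d n (\<lambda>x. x) ` carrier (homology ker d n)"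
  then obtain x where x: "x \<in> L.cycles n" "X = M.hclass n x"
    by (auto simp: L.homology_carrier incl_hmap)
  then have "x \<in> M.cycles n" "p n x = \<zero>\<^bsub>N n\<^esub>" by (auto simp: L_cycles)
  then show "X \<in> a_kernel (homology M d n) (homology N e n) (hmap N e n (p n))"
    using x N.hclass_zero_iff[of "p n x" n] p_cycle[of x n]
      subgroup.one_closed[OF submodule.axioms(1)[OF N.submodule_boundaries_cycles]]
    by (simp add: a_kernel_def' M.homology_carrier proj_hmap)
next
  interpret Mn: module K "M n" by (rule M.module_chain)
  interpret Nn: module K "N n" by (rule N.module_chain)
  fix X assume "X \<in> a_kernel (homology M d n) (homology N e n) (hmap N e n (p n))"
  then obtain x where x: "x \<in> M.cycles n" "X = M.hclass n x" "p n x \<in> boundaries N e n"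
    using N.hclass_zero_iff p_cycle by (auto simp: a_kernel_def' M.homology_carrier proj_hmap)
  then obtain z where z: "z \<in> carrier (N (n + 1))" "p n x = e (n + 1) z" by (auto simp: boundaries_def)
  obtain w where w: "w \<in> carrier (M (n + 1))" "p (n + 1) w = z" using lift[OF z(1)] .
  let ?dw = "d (n + 1) w"
  let ?u = "x \<ominus>\<^bsub>M n\<^esub> ?dw"
  have dw: "?dw \<in> M.cycles n" using M.d_cycle[OF w(1)] .
  have car: "?dw \<in> carrier (M n)" "x \<in> carrier (M n)" using dw x by (auto simp: M.cycles_iff)
  have uM: "?u \<in> M.cycles n" using submodule_minus[OF M.module_chain M.submodule_cycles x(1) dw] .
  have "p n ?u = p n x \<ominus>\<^bsub>N n\<^esub> p n ?dw" using lin_map_minus[OF p_lin] car by simp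
  also have "\<dots> = \<zero>\<^bsub>N n\<^esub>" using z w p_d_up[OF w(1)] p_closed[OF car(1)] by (simp add: a_minus_def Nn.r_neg)
  finally have u: "?u \<in> L.cycles n" using uM by (simp add: L_cycles)
  have "x \<ominus>\<^bsub>M n\<^esub> ?u = ?dw"
    using car Mn.diff_eq_iff[of x ?u ?dw] Mn.diff_add_cancel[of x ?dw] by (simp add: Mn.a_comm)
  then have "M.hclass n x = M.hclass n ?u"
    using M.hclass_eq_iff[OF x(1) uM] w(1) by (simp add: boundaries_def)
  then have "X = hmap M d n (\<lambda>x. x) (L.hclass n ?u)" using incl_hmap(2)[OF u] x by simp
  then show "X \<in> hmap M d n (\<lambda>x. x) ` carrier (homology ker d n)"
    using u by (simp add: L.homology_carrier)
qed

text \<open>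
  If \<open>d x = d z\<close> for some \<open>z\<close> in the kernel, then \<open>x - z\<close> is a cycle with the same image as \<open>x\<close>.
\<close>

theorem exact_at_quotient:
  "exact_at K (homology M d n) (hmap N e n (p n)) (homology N e n) (connecting_map n) (homology ker d (n - 1))"
  unfolding exact_at_def
proof (intro conjI connecting_map_lin proj_hmap equalityI subsetI)
  fix X assume "X \<in> hmap N e n (p n) ` carrier (homology M d n)"
  then obtain x where x: "x \<in> M.cycles n" "X = N.hclass n (p n x)"
    by (auto simp: M.homology_carrier proj_hmap)
  have "connecting_map n X = L.hclass (n - 1) (\<zero>\<^bsub>ker (n - 1)\<^esub>)"
    using x connecting_map_hclass[of x n] p_cycle[of x n] by (simp add: M.cycles_iff)
  also have "\<dots> = \<zero>\<^bsub>homology ker d (n - 1)\<^esub>"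
    using quot_mod_zero_coset[OF L.module_cycles L.submodule_boundaries_cycles, of "n - 1"]
    by (simp add: L.homology_eq)
  finally show "X \<in> a_kernel (homology N e n) (homology ker d (n - 1)) (connecting_map n)"
    using x p_cycle by (simp add: a_kernel_def' N.homology_carrier)
next
  interpret Mn: module K "M n" by (rule M.module_chain)
  interpret Nn: module K "N n" by (rule N.module_chain)
  interpret Mn1: module K "M (n - 1)" by (rule M.module_chain)
  fix X assume X: "X \<in> a_kernel (homology N e n) (homology ker d (n - 1)) (connecting_map n)"
  then obtain x where x: "x \<in> carrier (M n)" "p n x \<in> N.cycles n" "X = N.hclass n (p n x)"
    using N_class_lift by (auto simp: a_kernel_def')
  then have "d n x \<in> boundaries ker d (n - 1)"
    using X connecting_map_hclass[OF x(1,2)] L.hclass_zero_iff[OF d_lift_cycle[OF x(1,2)]]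
    by (simp add: a_kernel_def')
  then obtain z where z: "z \<in> carrier (M n)" "p n z = \<zero>\<^bsub>N n\<^esub>" "d n x = d n z"
    by (auto simp: boundaries_def ker_carrier)
  let ?u = "x \<ominus>\<^bsub>M n\<^esub> z"
  have "d n ?u = \<zero>\<^bsub>M (n - 1)\<^esub>"
    using lin_map_minus[OF M.d_lin x(1) z(1)] z(3) M.d_closed[OF z(1)] by (simp add: a_minus_def Mn1.r_neg)
  then have u: "?u \<in> M.cycles n" using x z by (simp add: M.cycles_iff)
  have "p n ?u = p n x"
    using lin_map_minus[OF p_lin x(1) z(1)] z(2) p_closed[OF x(1)] by (simp add: Nn.diff_zero)
  then have "X = hmap N e n (p n) (M.hclass n ?u)" using proj_hmap(2)[OF u] x by simp
  then show "X \<in> hmap N e n (p n) ` carrier (homology M d n)"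
    using u by (simp add: M.homology_carrier)
qed

text \<open>
  A cycle of the kernel that becomes a boundary \<open>d x\<close> in \<open>M\<close> is the image of the class of \<open>p x\<close>, by the
  definition of the connecting map.
\<close>

theorem exact_at_kernel:
  "exact_at K (homology N e n) (connecting_map n) (homology ker d (n - 1)) (hmap M d (n - 1) (\<lambda>x. x))
     (homology M d (n - 1))"
  unfolding exact_at_def
proof (intro conjI connecting_map_lin incl_hmap equalityI subsetI)
  fix X assume "X \<in> connecting_map n ` carrier (homology N e n)"
  then obtain Y where Y: "Y \<in> carrier (homology N e n)" "X = connecting_map n Y" by (rule imageE)
  obtain x where x: "x \<in> carrier (M n)" "p n x \<in> N.cycles n" "Y = N.hclass n (p n x)"
    using N_class_lift[OF Y(1)] .
  have X: "X = L.hclass (n - 1) (d n x)" using Y(2) x connecting_map_hclass by simp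
  have "d n x \<in> boundaries M d (n - 1)" using x by (simp add: boundaries_def)
  then show "X \<in> a_kernel (homology ker d (n - 1)) (homology M d (n - 1)) (hmap M d (n - 1) (\<lambda>x. x))"
    using d_lift_cycle[OF x(1,2)] X incl_hmap(2) M.hclass_zero_iff[of "d n x" "n - 1"]
    by (simp add: a_kernel_def' L.homology_carrier L_cycles)
next
  fix X assume X: "X \<in> a_kernel (homology ker d (n - 1)) (homology M d (n - 1)) (hmap M d (n - 1) (\<lambda>x. x))"
  then obtain y where y: "y \<in> L.cycles (n - 1)" "X = L.hclass (n - 1) y"
    by (auto simp: a_kernel_def' L.homology_carrier)
  then have "y \<in> boundaries M d (n - 1)"
    using X incl_hmap(2)[OF y(1)] M.hclass_zero_iff[of y "n - 1"]
    by (simp add: a_kernel_def' L_cycles)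
  then obtain x where x: "x \<in> carrier (M n)" "y = d n x" by (auto simp: boundaries_def)
  have "p n x \<in> N.cycles n"
    using x y p_d[OF x(1)] p_closed[OF x(1)] by (simp add: N.cycles_iff L_cycles)
  then show "X \<in> connecting_map n ` carrier (homology N e n)"
    using x y connecting_map_hclass[OF x(1)] by (auto simp: N.homology_carrier intro!: image_eqI)
qed

text \<open>
  The homology of \<open>M\<close> and that of \<open>N\<close> are neighbours in the exact sequence, between two terms that
  vanish when the kernel is acyclic.
\<close>

theorem proj_iso_if_acyclic:
  assumes acyclic: "\<And>n x. x \<in> carrier (ker n) \<Longrightarrow> d n x = \<zero>\<^bsub>M (n - 1)\<^esub> \<Longrightarrow> x \<in> boundaries ker d n"
  shows "lin_iso K (homology M d n) (homology N e n) (hmap N e n (p n))"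
proof -
  have trivial: "carrier (homology ker d n) = {\<zero>\<^bsub>homology ker d n\<^esub>}" for n
  proof -
    interpret H: module K "homology ker d n" by (rule L.module_homology)
    have "X = \<zero>\<^bsub>homology ker d n\<^esub>" if X: "X \<in> carrier (homology ker d n)" for X
    proof -
      obtain x where x: "x \<in> L.cycles n" "X = L.hclass n x"
        using X by (auto simp: L.homology_carrier)
      then show ?thesis using L.hclass_zero_iff[OF x(1)] acyclic[of x n] by (simp add: L.cycles_iff)
    qed
    then show ?thesis using H.zero_closed by blast
  qed
  let ?p = "hmap N e n (p n)"
  interpret HM: module K "homology M d n" by (rule M.module_homology)
  interpret HN: module K "homology N e n" by (rule N.module_homology)
  have "a_kernel (homology M d n) (homology N e n) ?p = {\<zero>\<^bsub>homology M d n\<^esub>}"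
    using exact_at_middle[of n] lin_map_zero[OF incl_hmap(1)] by (simp add: exact_at_def trivial)
  then have ker0: "X = \<zero>\<^bsub>homology M d n\<^esub>"
    if "X \<in> carrier (homology M d n)" "?p X = \<zero>\<^bsub>homology N e n\<^esub>" for X
    using that by (auto simp: a_kernel_def')
  have "inj_on ?p (carrier (homology M d n))"
  proof (rule inj_onI)
    fix X Y assume XY: "X \<in> carrier (homology M d n)" "Y \<in> carrier (homology M d n)" "?p X = ?p Y"
    then have "?p (X \<ominus>\<^bsub>homology M d n\<^esub> Y) = \<zero>\<^bsub>homology N e n\<^esub>"
      using lin_map_minus[OF proj_hmap(1) XY(1,2)] lin_mapD(6)[OF proj_hmap(1) XY(2)]
      by (simp add: HN.diff_eq_zero_iff)
    then have "X \<ominus>\<^bsub>homology M d n\<^esub> Y = \<zero>\<^bsub>homology M d n\<^esub>"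
      using XY by (intro ker0) simp_all
    then show "X = Y" using XY by (simp add: HM.diff_eq_zero_iff)
  qed
  moreover have "?p ` carrier (homology M d n) = carrier (homology N e n)"
  proof -
    have "?p ` carrier (homology M d n) = a_kernel (homology N e n) (homology ker d (n - 1)) (connecting_map n)"
      using exact_at_quotient[of n] by (simp add: exact_at_def)
    then show ?thesis
      using lin_mapD(6)[OF connecting_map_lin[of n]] trivial[of "n - 1"] by (auto simp: a_kernel_def')
  qed
  ultimately show ?thesis using proj_hmap(1) by (simp add: lin_iso_def bij_betw_def)
qed

end

lemma lin_iso_inv_into:
  assumes "lin_iso K M N f"
  shows "lin_iso K N M (inv_into (carrier M) f)"
proof -
  have f: "lin_map K M N f" and b: "bij_betw f (carrier M) (carrier N)"
    using assms by (auto simp: lin_iso_def)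
  note F = lin_mapD[OF f]
  interpret M: module K M by (rule F)
  interpret N: module K N by (rule F)
  let ?g = "inv_into (carrier M) f"
  have g: "?g y \<in> carrier M" "f (?g y) = y" if "y \<in> carrier N" for y
    using that b by (auto simp: bij_betw_def inv_into_into f_inv_into_f)
  have eq: "?g y = x" if "x \<in> carrier M" "f x = y" for x y
    using that b by (auto simp: bij_betw_def)
  have "lin_map K N M ?g"
    by (intro lin_mapI F) (auto simp: g F intro!: eq)
  then show ?thesis using bij_betw_inv_into[OF b] by (simp add: lin_iso_def)
qed

text \<open>
  A map that is conjugate to a linear map under isomorphisms is linear. This supplies the linearity
  of \<open>I\<close>, \<open>S\<close> and \<open>B\<close>, which are defined by such conjugations.
\<close>

lemma lin_map_transfer:
  assumes f: "lin_map K L M f" and a: "lin_iso K L L' \<alpha>" and b: "lin_iso K M M' \<beta>"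
    and f': "\<And>x. x \<in> carrier L \<Longrightarrow> f' (\<alpha> x) = \<beta> (f x)"
  shows "lin_map K L' M' f'"
proof (rule lin_map_cong[of K L' M' "\<lambda>y. \<beta> (f (inv_into (carrier L) \<alpha> y))"])
  show "lin_map K L' M' (\<lambda>y. \<beta> (f (inv_into (carrier L) \<alpha> y)))"
    using lin_map_compose[OF lin_map_compose[OF _ f]] lin_iso_inv_into[OF a] b
    unfolding lin_iso_def by blast
  fix y assume "y \<in> carrier L'"
  then show "f' y = \<beta> (f (inv_into (carrier L) \<alpha> y))"
    using f'[of "inv_into (carrier L) \<alpha> y"] a
    by (simp add: lin_iso_def bij_betw_def f_inv_into_f inv_into_into)
qed

lemma exact_at_transfer:
  assumes ex: "exact_at K L f M g N"
    and a: "lin_iso K L L' \<alpha>" and b: "lin_iso K M M' \<beta>" and c: "lin_iso K N N' \<gamma>"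
    and f': "\<And>x. x \<in> carrier L \<Longrightarrow> f' (\<alpha> x) = \<beta> (f x)"
    and g': "\<And>x. x \<in> carrier M \<Longrightarrow> g' (\<beta> x) = \<gamma> (g x)"
  shows "exact_at K L' f' M' g' N'"
proof -
  have f: "lin_map K L M f" and g: "lin_map K M N g" and fg: "f ` carrier L = a_kernel M N g"
    using ex by (auto simp: exact_at_def)
  have bijs: "\<alpha> ` carrier L = carrier L'" "\<beta> ` carrier M = carrier M'" "inj_on \<gamma> (carrier N)"
    using a b c by (auto simp: lin_iso_def bij_betw_def)
  have z: "\<gamma> (g x) = \<zero>\<^bsub>N'\<^esub> \<longleftrightarrow> g x = \<zero>\<^bsub>N\<^esub>" if "x \<in> carrier M" for x
  proof -
    have c': "lin_map K N N' \<gamma>" using c by (simp add: lin_iso_def)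
    interpret N: module K N by (rule lin_mapD[OF c'])
    show ?thesis using lin_map_zero[OF c'] bijs(3) lin_mapD(6)[OF g that] by (metis N.zero_closed inj_onD)
  qed
  have "f' ` carrier L' = \<beta> ` f ` carrier L"
    unfolding bijs(1)[symmetric] image_image by (rule image_cong) (auto simp: f')
  also have "\<dots> = \<beta> ` {x \<in> carrier M. g x = \<zero>\<^bsub>N\<^esub>}" by (simp add: fg a_kernel_def')
  also have "\<dots> = {y \<in> carrier M'. g' y = \<zero>\<^bsub>N'\<^esub>}"
    unfolding bijs(2)[symmetric] using lin_map_zero[of K N N' \<gamma>] c by (auto simp: g' z lin_iso_def)
  finally show ?thesis
    using lin_map_transfer[OF f a b f'] lin_map_transfer[OF g b c g'] by (simp add: exact_at_def a_kernel_def')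
qed

section \<open>Free modules\<close>

lemma free_mod_simps [simp]:
  "\<zero>\<^bsub>free_mod K X\<^esub> = (\<lambda>z. \<zero>\<^bsub>K\<^esub>)"
  "f \<oplus>\<^bsub>free_mod K X\<^esub> g = (\<lambda>z. f z \<oplus>\<^bsub>K\<^esub> g z)"
  "c \<odot>\<^bsub>free_mod K X\<^esub> f = (\<lambda>z. c \<otimes>\<^bsub>K\<^esub> f z)"
  by (simp_all add: free_mod_def)

lemma free_mod_carrier:
  "f \<in> carrier (free_mod K X) \<longleftrightarrow>
    (\<forall>z. f z \<in> carrier K) \<and> (\<forall>z. z \<notin> X \<longrightarrow> f z = \<zero>\<^bsub>K\<^esub>) \<and> finite {z. f z \<noteq> \<zero>\<^bsub>K\<^esub>}"
  by (simp add: free_mod_def)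

context cring
begin

lemma free_mod_add_closed:
  assumes "f \<in> carrier (free_mod R X)" "g \<in> carrier (free_mod R X)"
  shows "(\<lambda>z. f z \<oplus> g z) \<in> carrier (free_mod R X)"
proof -
  have "{z. f z \<oplus> g z \<noteq> \<zero>} \<subseteq> {z. f z \<noteq> \<zero>} \<union> {z. g z \<noteq> \<zero>}" by auto
  then have "finite {z. f z \<oplus> g z \<noteq> \<zero>}"
    by (rule finite_subset) (use assms in \<open>simp add: free_mod_carrier\<close>)
  then show ?thesis using assms by (simp add: free_mod_carrier)
qed

lemma free_mod_smult_closed:
  assumes "c \<in> carrier R" "f \<in> carrier (free_mod R X)"
  shows "(\<lambda>z. c \<otimes> f z) \<in> carrier (free_mod R X)"
proof -
  have "{z. c \<otimes> f z \<noteq> \<zero>} \<subseteq> {z. f z \<noteq> \<zero>}" using assms by auto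
  then have "finite {z. c \<otimes> f z \<noteq> \<zero>}"
    by (rule finite_subset) (use assms in \<open>simp add: free_mod_carrier\<close>)
  then show ?thesis using assms by (simp add: free_mod_carrier)
qed

lemma module_free_mod: "module R (free_mod R X)"
proof (rule moduleI)
  show "abelian_group (free_mod R X)"
  proof (rule abelian_groupI)
    fix f assume f: "f \<in> carrier (free_mod R X)"
    have "(\<lambda>z. \<ominus> \<one> \<otimes> f z) \<in> carrier (free_mod R X)"
      using f by (intro free_mod_smult_closed) auto
    moreover have "(\<lambda>z. \<ominus> \<one> \<otimes> f z) \<oplus>\<^bsub>free_mod R X\<^esub> f = \<zero>\<^bsub>free_mod R X\<^esub>"
      using f by (auto simp: free_mod_carrier l_minus l_neg)
    ultimately show "\<exists>g\<in>carrier (free_mod R X). g \<oplus>\<^bsub>free_mod R X\<^esub> f = \<zero>\<^bsub>free_mod R X\<^esub>" by blast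
  qed (auto simp: free_mod_add_closed, auto simp: free_mod_carrier a_ac)
qed (auto simp: is_cring free_mod_smult_closed, auto simp: free_mod_carrier l_distr r_distr m_assoc)

lemma gen_closed: "x \<in> X \<Longrightarrow> gen R x \<in> carrier (free_mod R X)"
  by (auto simp: free_mod_carrier gen_def)

text \<open>
  Induction on the support: splitting off the value at one point subtracts a multiple of a generator.
\<close>

lemma free_mod_span:
  fixes X :: "'x set"
  assumes H: "submodule H R (free_mod R X)" and gens: "\<And>x. x \<in> X \<Longrightarrow> gen R x \<in> H"
    and f: "f \<in> carrier (free_mod R X)"
  shows "f \<in> H"
proof -
  note E = module.submoduleE[OF module_free_mod H]
  have "\<forall>f. f \<in> carrier (free_mod R X) \<longrightarrow> {z. f z \<noteq> \<zero>} \<subseteq> S \<longrightarrow> f \<in> H" if "finite S" for S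
    using that
  proof (induction S rule: finite_induct)
    case empty
    show ?case
    proof (intro allI impI)
      fix f :: "'x \<Rightarrow> 'a" assume "{z. f z \<noteq> \<zero>} \<subseteq> {}"
      then have "f = \<zero>\<^bsub>free_mod R X\<^esub>" by auto
      then show "f \<in> H"
        using subgroup.one_closed[OF submodule.axioms(1)[OF H]] by simp
    qed
  next
    case (insert s S)
    show ?case
    proof (intro allI impI)
      fix f assume f: "f \<in> carrier (free_mod R X)" "{z. f z \<noteq> \<zero>} \<subseteq> insert s S"
      let ?g = "\<lambda>z. if z = s then \<zero> else f z"
      have "{z. ?g z \<noteq> \<zero>} \<subseteq> {z. f z \<noteq> \<zero>}" by auto
      then have "finite {z. ?g z \<noteq> \<zero>}"
        by (rule finite_subset) (use f in \<open>simp add: free_mod_carrier\<close>)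
      then have "?g \<in> carrier (free_mod R X)"
        using f by (simp add: free_mod_carrier)
      moreover have "{z. ?g z \<noteq> \<zero>} \<subseteq> S" using f by auto
      ultimately have g: "?g \<in> H" using insert.IH by blast
      show "f \<in> H"
      proof (cases "s \<in> X")
        case True
        have "f = (f s \<odot>\<^bsub>free_mod R X\<^esub> gen R s) \<oplus>\<^bsub>free_mod R X\<^esub> ?g"
          using f by (auto simp: free_mod_carrier gen_def)
        moreover have "f s \<in> carrier R" using f by (simp add: free_mod_carrier)
        ultimately show ?thesis using E(4,5) gens[OF True] g by metis
      next
        case False
        then have "f = ?g" using f by (auto simp: free_mod_carrier)
        then show ?thesis using g by simp
      qed
    qed
  qed
  then show ?thesis using f by (auto simp: free_mod_carrier)
qed

text \<open>
  In \<^const>\<open>push\<close> the index set depends on the support of the function. A common finite index set is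
  needed to add two such sums.
\<close>

lemma push_superset:
  assumes "f \<in> carrier (free_mod R X)" "finite S" "{z. f z \<noteq> \<zero>} \<subseteq> S"
  shows "push R \<phi> f y = (\<Oplus>x\<in>{x \<in> S. \<phi> x = y}. f x)"
  unfolding push_def using assms
  by (intro add.finprod_mono_neutral_cong_left) (auto simp: free_mod_carrier)

lemma lin_map_push:
  assumes \<phi>: "\<phi> \<in> X \<rightarrow> Y"
  shows "lin_map R (free_mod R X) (free_mod R Y) (push R \<phi>)"
proof (intro lin_mapI module_free_mod)
  fix f assume f: "f \<in> carrier (free_mod R X)"
  have 1: "push R \<phi> f y \<in> carrier R" for y
    unfolding push_def using f by (intro finsum_closed) (auto simp: free_mod_carrier)
  have 2: "push R \<phi> f y = \<zero>" if "y \<notin> \<phi> ` {x. f x \<noteq> \<zero>}" for y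
  proof -
    have e: "{x. f x \<noteq> \<zero> \<and> \<phi> x = y} = {}" using that by auto
    show ?thesis unfolding push_def e by simp
  qed
  have 3: "\<phi> ` {x. f x \<noteq> \<zero>} \<subseteq> Y" using \<phi> f by (auto simp: free_mod_carrier)
  have "{y. push R \<phi> f y \<noteq> \<zero>} \<subseteq> \<phi> ` {x. f x \<noteq> \<zero>}" using 2 by blast
  then have 4: "finite {y. push R \<phi> f y \<noteq> \<zero>}"
    by (rule finite_subset) (use f in \<open>simp add: free_mod_carrier\<close>)
  show "push R \<phi> f \<in> carrier (free_mod R Y)"
    unfolding free_mod_carrier using 1 2 3 4 by (meson subsetD)
  {
    fix g assume g: "g \<in> carrier (free_mod R X)"
    let ?S = "{x. f x \<noteq> \<zero>} \<union> {x. g x \<noteq> \<zero>}"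
    have S: "finite ?S" using f g by (simp add: free_mod_carrier)
    have fg: "f x \<in> carrier R" "g x \<in> carrier R" for x using f g by (auto simp: free_mod_carrier)
    have "push R \<phi> (\<lambda>z. f z \<oplus> g z) y = push R \<phi> f y \<oplus> push R \<phi> g y" for y
    proof -
      have "push R \<phi> (\<lambda>z. f z \<oplus> g z) y = (\<Oplus>x\<in>{x \<in> ?S. \<phi> x = y}. f x \<oplus> g x)"
        by (rule push_superset[OF free_mod_add_closed[OF f g] S]) auto
      also have "\<dots> = (\<Oplus>x\<in>{x \<in> ?S. \<phi> x = y}. f x) \<oplus> (\<Oplus>x\<in>{x \<in> ?S. \<phi> x = y}. g x)"
        using fg by (intro finsum_addf) auto
      also have "(\<Oplus>x\<in>{x \<in> ?S. \<phi> x = y}. f x) = push R \<phi> f y"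
        by (rule push_superset[OF f S, symmetric]) auto
      also have "(\<Oplus>x\<in>{x \<in> ?S. \<phi> x = y}. g x) = push R \<phi> g y"
        by (rule push_superset[OF g S, symmetric]) auto
      finally show ?thesis .
    qed
    then show "push R \<phi> (f \<oplus>\<^bsub>free_mod R X\<^esub> g) = push R \<phi> f \<oplus>\<^bsub>free_mod R Y\<^esub> push R \<phi> g" by auto
  }
  fix c assume c: "c \<in> carrier R"
  let ?S = "{x. f x \<noteq> \<zero>}"
  have S: "finite ?S" "\<And>x. f x \<in> carrier R" using f by (auto simp: free_mod_carrier)
  have "push R \<phi> (\<lambda>z. c \<otimes> f z) y = c \<otimes> push R \<phi> f y" for y
  proof -
    have "push R \<phi> (\<lambda>z. c \<otimes> f z) y = (\<Oplus>x\<in>{x \<in> ?S. \<phi> x = y}. c \<otimes> f x)"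
      using c by (intro push_superset[OF free_mod_smult_closed[OF c f] S(1)]) auto
    also have "\<dots> = c \<otimes> (\<Oplus>x\<in>{x \<in> ?S. \<phi> x = y}. f x)"
      using c S by (intro finsum_rdistr[symmetric]) auto
    also have "(\<Oplus>x\<in>{x \<in> ?S. \<phi> x = y}. f x) = push R \<phi> f y"
      by (rule push_superset[OF f S(1), symmetric]) auto
    finally show ?thesis .
  qed
  then show "push R \<phi> (c \<odot>\<^bsub>free_mod R X\<^esub> f) = c \<odot>\<^bsub>free_mod R Y\<^esub> push R \<phi> f" by auto
qed

end

lemma (in domain) push_gen: "push R \<phi> (gen R x) = gen R (\<phi> x)"
proof
  fix y
  have "{z. gen R x z \<noteq> \<zero> \<and> \<phi> z = y} = (if \<phi> x = y then {x} else {})" by (auto simp: gen_def)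
  then show "push R \<phi> (gen R x) y = gen R (\<phi> x) y"
    unfolding push_def by (simp add: gen_def)
qed

section \<open>Chains and simple tensors\<close>

lemma submodule_Inter:
  assumes "module K M" "S \<noteq> {}" "\<And>H. H \<in> S \<Longrightarrow> submodule H K M"
  shows "submodule (\<Inter>S) K M"
proof -
  note E = module.submoduleE[OF assms(1) assms(3)]
  have "\<zero>\<^bsub>M\<^esub> \<in> H" if "H \<in> S" for H
    using subgroup.one_closed[OF submodule.axioms(1)[OF assms(3)[OF that]]] by simp
  moreover have "\<Inter>S \<subseteq> carrier M" using assms(2) E(1) by fast
  ultimately show ?thesis
    by (intro module.submoduleI[OF assms(1)]) (simp_all add: E)
qed

context secondary_triple
begin

lemma domain_K: "domain K"
  using K_field by (rule field.axioms)

sublocale K: cring K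
  using domain_K by (rule domain.axioms)

sublocale A: ring A
  by (rule A_ring)

sublocale AM: module K A
  by (rule A_module)

sublocale B: algebra K B
  by (rule B_algebra)

lemma module_B: "module K B"
  by (rule B.module)

lemma eps_hom:
  "x \<in> carrier B \<Longrightarrow> \<epsilon> x \<in> carrier A"
  "x \<in> carrier B \<Longrightarrow> y \<in> carrier B \<Longrightarrow> \<epsilon> (x \<otimes>\<^bsub>B\<^esub> y) = \<epsilon> x \<otimes>\<^bsub>A\<^esub> \<epsilon> y"
  "x \<in> carrier B \<Longrightarrow> y \<in> carrier B \<Longrightarrow> \<epsilon> (x \<oplus>\<^bsub>B\<^esub> y) = \<epsilon> x \<oplus>\<^bsub>A\<^esub> \<epsilon> y"
  "\<epsilon> \<one>\<^bsub>B\<^esub> = \<one>\<^bsub>A\<^esub>"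
  using eps_ring_hom by (auto simp: ring_hom_def)

text \<open>
  The simple tensor displayed by an array.
\<close>

definition simple :: "int \<Rightarrow> ('a, 'b) array \<Rightarrow> (('a, 'b) array \<Rightarrow> 'k) set"
  where "simple n s = tensor_rels n +>\<^bsub>free_chain n\<^esub> gen K s"

lemma module_free_chain: "module K (free_chain n)"
  by (rule K.module_free_mod)

lemma arrays_iff:
  "(a, b) \<in> arrays n \<longleftrightarrow> 0 \<le> n \<and> a \<in> {0..n} \<rightarrow>\<^sub>E carrier A \<and> b \<in> pairs n \<rightarrow>\<^sub>E carrier B"
  by (simp add: arrays_def)

lemma arrays_upd:
  "(a, b) \<in> arrays n \<Longrightarrow> l \<in> {0..n} \<Longrightarrow> x \<in> carrier A \<Longrightarrow> (a(l := x), b) \<in> arrays n"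
  "(a, b) \<in> arrays n \<Longrightarrow> e \<in> pairs n \<Longrightarrow> y \<in> carrier B \<Longrightarrow> (a, b(e := y)) \<in> arrays n"
  by (auto simp: arrays_iff PiE_iff extensional_def)

lemma multilinear_rels_carrier: "multilinear_rels n \<subseteq> carrier (free_chain n)"
proof -
  interpret F: module K "free_chain n" by (rule module_free_chain)
  show ?thesis
    unfolding multilinear_rels_def
    by (auto simp del: free_mod_simps
        intro!: F.minus_closed F.a_closed F.smult_closed K.gen_closed arrays_upd)
qed

lemma submodule_tensor_rels: "submodule (tensor_rels n) K (free_chain n)"
  unfolding tensor_rels_def hull_def
  by (rule submodule_Inter[OF module_free_chain])
    (use multilinear_rels_carrier module.carrier_is_submodule[OF module_free_chain] in auto)

lemma module_chain: "module K (chain n)"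
  unfolding chain_def by (rule module_quot_mod[OF module_free_chain submodule_tensor_rels])

lemma lin_map_to_chain: "lin_map K (free_chain n) (chain n) (\<lambda>f. tensor_rels n +>\<^bsub>free_chain n\<^esub> f)"
  unfolding chain_def by (rule lin_map_coset[OF module_free_chain submodule_tensor_rels])

lemma chain_carrier: "carrier (chain n) = (\<lambda>f. tensor_rels n +>\<^bsub>free_chain n\<^esub> f) ` carrier (free_chain n)"
  unfolding chain_def by (rule quot_mod_carrier[OF module_free_chain submodule_tensor_rels])

lemma simple_closed: "s \<in> arrays n \<Longrightarrow> simple n s \<in> carrier (chain n)"
  unfolding simple_def chain_carrier by (intro imageI K.gen_closed)

text \<open>
  The kernel of the difference of the two maps, pulled back to the free module, contains all
  generators. Every identity between operators on chains below is reduced to arrays in this way.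
\<close>

lemma lin_map_eq_on_simple:
  assumes f: "lin_map K (chain n) M f" and g: "lin_map K (chain n) M g"
    and eq: "\<And>s. s \<in> arrays n \<Longrightarrow> f (simple n s) = g (simple n s)"
    and x: "x \<in> carrier (chain n)"
  shows "f x = g x"
proof -
  interpret M: module K M by (rule lin_mapD[OF f])
  let ?c = "\<lambda>z. tensor_rels n +>\<^bsub>free_chain n\<^esub> z"
  let ?h = "\<lambda>x. f x \<ominus>\<^bsub>M\<^esub> g x"
  have h: "lin_map K (free_chain n) M (\<lambda>z. ?h (?c z))"
    by (rule lin_map_compose[OF lin_map_to_chain lin_map_diff[OF f g]])
  obtain z where z: "z \<in> carrier (free_chain n)" "x = ?c z" using x by (auto simp: chain_carrier)
  have "z \<in> a_kernel (free_chain n) M (\<lambda>z. ?h (?c z))"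
  proof (rule K.free_mod_span[OF submodule_kernel[OF h] _ z(1)])
    fix s assume s: "s \<in> arrays n"
    have "?h (simple n s) = \<zero>\<^bsub>M\<^esub>"
      using eq[OF s] lin_mapD(6)[OF g simple_closed[OF s]] by (simp add: M.diff_eq_zero_iff)
    then show "gen K s \<in> a_kernel (free_chain n) M (\<lambda>z. ?h (?c z))"
      using K.gen_closed[OF s] by (simp add: a_kernel_def' simple_def)
  qed
  then have "?h x = \<zero>\<^bsub>M\<^esub>" using z by (simp add: a_kernel_def')
  then show ?thesis using M.diff_eq_zero_iff lin_mapD(6)[OF f x] lin_mapD(6)[OF g x] by simp
qed

lemma chain_relI:
  assumes "f \<in> carrier (free_chain n)" "g \<in> carrier (free_chain n)"
    and "f \<ominus>\<^bsub>free_chain n\<^esub> g \<in> multilinear_rels n"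
  shows "tensor_rels n +>\<^bsub>free_chain n\<^esub> f = tensor_rels n +>\<^bsub>free_chain n\<^esub> g"
  using coset_eq_iff[OF module_free_chain submodule_tensor_rels assms(1,2)] assms(3) hull_subset
  unfolding tensor_rels_def by fast

lemma multilinear_relsI:
  assumes "(a, b) \<in> arrays n"
  shows "l \<in> {0..n} \<Longrightarrow> x \<in> carrier A \<Longrightarrow> y \<in> carrier A \<Longrightarrow>
      gen K (a(l := x \<oplus>\<^bsub>A\<^esub> y), b) \<ominus>\<^bsub>free_chain n\<^esub>
        (gen K (a(l := x), b) \<oplus>\<^bsub>free_chain n\<^esub> gen K (a(l := y), b)) \<in> multilinear_rels n"
    and "l \<in> {0..n} \<Longrightarrow> c \<in> carrier K \<Longrightarrow> x \<in> carrier A \<Longrightarrow>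
      gen K (a(l := c \<odot>\<^bsub>A\<^esub> x), b) \<ominus>\<^bsub>free_chain n\<^esub>
        (c \<odot>\<^bsub>free_chain n\<^esub> gen K (a(l := x), b)) \<in> multilinear_rels n"
    and "e \<in> pairs n \<Longrightarrow> u \<in> carrier B \<Longrightarrow> v \<in> carrier B \<Longrightarrow>
      gen K (a, b(e := u \<oplus>\<^bsub>B\<^esub> v)) \<ominus>\<^bsub>free_chain n\<^esub>
        (gen K (a, b(e := u)) \<oplus>\<^bsub>free_chain n\<^esub> gen K (a, b(e := v))) \<in> multilinear_rels n"
    and "e \<in> pairs n \<Longrightarrow> c \<in> carrier K \<Longrightarrow> u \<in> carrier B \<Longrightarrow>
      gen K (a, b(e := c \<odot>\<^bsub>B\<^esub> u)) \<ominus>\<^bsub>free_chain n\<^esub>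
        (c \<odot>\<^bsub>free_chain n\<^esub> gen K (a, b(e := u))) \<in> multilinear_rels n"
  unfolding multilinear_rels_def using assms by blast+

lemma simple_linear_A:
  assumes s: "(a, b) \<in> arrays n" and l: "l \<in> {0..n}"
  shows "lin_map K A (chain n) (\<lambda>x. simple n (a(l := x), b))"
proof (intro lin_mapI A_module module_chain)
  interpret F: module K "free_chain n" by (rule module_free_chain)
  note c = lin_mapD(7,8)[OF lin_map_to_chain, symmetric]
  note g = K.gen_closed[OF arrays_upd(1)[OF s l]]
  fix x assume x: "x \<in> carrier A"
  show "simple n (a(l := x), b) \<in> carrier (chain n)"
    using x by (intro simple_closed arrays_upd s l)
  show "simple n (a(l := x \<oplus>\<^bsub>A\<^esub> y), b) = simple n (a(l := x), b) \<oplus>\<^bsub>chain n\<^esub> simple n (a(l := y), b)"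
    if y: "y \<in> carrier A" for y
    unfolding simple_def c(1)[OF g[OF x] g[OF y]]
    by (intro chain_relI multilinear_relsI F.a_closed g A.a_closed s l x y)
  show "simple n (a(l := c \<odot>\<^bsub>A\<^esub> x), b) = c \<odot>\<^bsub>chain n\<^esub> simple n (a(l := x), b)"
    if d: "c \<in> carrier K" for c
    unfolding simple_def c(2)[OF d g[OF x]]
    by (intro chain_relI multilinear_relsI F.smult_closed g AM.smult_closed s l x d)
qed

lemma simple_linear_B:
  assumes s: "(a, b) \<in> arrays n" and e: "e \<in> pairs n"
  shows "lin_map K B (chain n) (\<lambda>x. simple n (a, b(e := x)))"
proof (intro lin_mapI module_B module_chain)
  interpret F: module K "free_chain n" by (rule module_free_chain)
  note c = lin_mapD(7,8)[OF lin_map_to_chain, symmetric]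
  note g = K.gen_closed[OF arrays_upd(2)[OF s e]]
  fix x assume x: "x \<in> carrier B"
  show "simple n (a, b(e := x)) \<in> carrier (chain n)"
    using x by (intro simple_closed arrays_upd s e)
  show "simple n (a, b(e := x \<oplus>\<^bsub>B\<^esub> y)) = simple n (a, b(e := x)) \<oplus>\<^bsub>chain n\<^esub> simple n (a, b(e := y))"
    if y: "y \<in> carrier B" for y
    unfolding simple_def c(1)[OF g[OF x] g[OF y]]
    by (intro chain_relI multilinear_relsI F.a_closed g B.a_closed s e x y)
  show "simple n (a, b(e := c \<odot>\<^bsub>B\<^esub> x)) = c \<odot>\<^bsub>chain n\<^esub> simple n (a, b(e := x))"
    if d: "c \<in> carrier K" for c
    unfolding simple_def c(2)[OF d g[OF x]]
    by (intro chain_relI multilinear_relsI F.smult_closed g B.smult_closed s e x d)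
qed

text \<open>
  Linearity in each entry is required of the resulting simple tensors, not of the arrays: merging
  moves the entry \<open>b\<^sub>i\<^sub>,\<^sub>i\<^sub>+\<^sub>1\<close> from the \<open>B\<close>-part of the array to the diagonal. In this form
  multilinear maps are closed under composition.
\<close>

definition multilinear :: "int \<Rightarrow> int \<Rightarrow> (('a, 'b) array \<Rightarrow> ('a, 'b) array) \<Rightarrow> bool"
  where "multilinear n m \<phi> \<longleftrightarrow> \<phi> \<in> arrays n \<rightarrow> arrays m \<and>
    (\<forall>a b. (a, b) \<in> arrays n \<longrightarrow>
      (\<forall>l\<in>{0..n}. lin_map K A (chain m) (\<lambda>x. simple m (\<phi> (a(l := x), b)))) \<and>
      (\<forall>e\<in>pairs n. lin_map K B (chain m) (\<lambda>x. simple m (\<phi> (a, b(e := x))))))"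

text \<open>
  Applied to a relation of multilinearity in one entry, the linear extension of \<open>\<phi>\<close> gives a difference
  of two elements whose classes agree, by the multilinearity of \<open>\<phi>\<close>.
\<close>

lemma push_multilinear_rels:
  assumes \<phi>: "multilinear n m \<phi>" and r: "r \<in> multilinear_rels n"
  shows "push K \<phi> r \<in> tensor_rels m"
proof -
  interpret D: domain K by (rule domain_K)
  interpret F: module K "free_chain n" by (rule module_free_chain)
  interpret G: module K "free_chain m" by (rule module_free_chain)
  have \<phi>_map: "\<phi> \<in> arrays n \<rightarrow> arrays m" using \<phi> by (simp add: multilinear_def)
  note p = K.lin_map_push[OF \<phi>_map]
  note P = lin_map_minus[OF p] lin_mapD(7,8)[OF p] D.push_gen
  note c = lin_mapD(7,8)[OF lin_map_to_chain[of m]]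
  have g: "gen K s \<in> carrier (free_chain n)" "gen K (\<phi> s) \<in> carrier (free_chain m)"
    if "s \<in> arrays n" for s
    using that \<phi>_map by (auto intro!: K.gen_closed)
  have iff: "f \<ominus>\<^bsub>free_chain m\<^esub> h \<in> tensor_rels m \<longleftrightarrow>
      tensor_rels m +>\<^bsub>free_chain m\<^esub> f = tensor_rels m +>\<^bsub>free_chain m\<^esub> h"
    if "f \<in> carrier (free_chain m)" "h \<in> carrier (free_chain m)" for f h
    using coset_eq_iff[OF module_free_chain submodule_tensor_rels that] by simp
  from r show ?thesis
    unfolding multilinear_rels_def
  proof (elim UnE; clarsimp simp del: free_mod_simps atLeastAtMost_iff)
    fix a b l x y assume s: "(a, b) \<in> arrays n" "l \<in> {0..n}" and x: "x \<in> carrier A" "y \<in> carrier A"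
    have "lin_map K A (chain m) (\<lambda>x. simple m (\<phi> (a(l := x), b)))"
      using \<phi> s by (auto simp: multilinear_def simp del: atLeastAtMost_iff)
    from lin_mapD(7)[OF this x]
    show "push K \<phi> (gen K (a(l := x \<oplus>\<^bsub>A\<^esub> y), b) \<ominus>\<^bsub>free_chain n\<^esub>
        (gen K (a(l := x), b) \<oplus>\<^bsub>free_chain n\<^esub> gen K (a(l := y), b))) \<in> tensor_rels m"
      using g[OF arrays_upd(1)[OF s]] x
      by (simp add: P iff c simple_def del: free_mod_simps)
  next
    fix a b l d x assume s: "(a, b) \<in> arrays n" "l \<in> {0..n}" and x: "d \<in> carrier K" "x \<in> carrier A"
    have "lin_map K A (chain m) (\<lambda>x. simple m (\<phi> (a(l := x), b)))"
      using \<phi> s by (auto simp: multilinear_def simp del: atLeastAtMost_iff)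
    from lin_mapD(8)[OF this x]
    show "push K \<phi> (gen K (a(l := d \<odot>\<^bsub>A\<^esub> x), b) \<ominus>\<^bsub>free_chain n\<^esub>
        (d \<odot>\<^bsub>free_chain n\<^esub> gen K (a(l := x), b))) \<in> tensor_rels m"
      using g[OF arrays_upd(1)[OF s]] x
      by (simp add: P iff c simple_def del: free_mod_simps)
  next
    fix a b u v x y assume s: "(a, b) \<in> arrays n" "(u, v) \<in> pairs n"
      and x: "x \<in> carrier B" "y \<in> carrier B"
    have "lin_map K B (chain m) (\<lambda>x. simple m (\<phi> (a, b((u, v) := x))))"
      using \<phi> s by (auto simp: multilinear_def)
    from lin_mapD(7)[OF this x]
    show "push K \<phi> (gen K (a, b((u, v) := x \<oplus>\<^bsub>B\<^esub> y)) \<ominus>\<^bsub>free_chain n\<^esub>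
        (gen K (a, b((u, v) := x)) \<oplus>\<^bsub>free_chain n\<^esub> gen K (a, b((u, v) := y)))) \<in> tensor_rels m"
      using g[OF arrays_upd(2)[OF s]] x
      by (simp add: P iff c simple_def del: free_mod_simps)
  next
    fix a b u v d x assume s: "(a, b) \<in> arrays n" "(u, v) \<in> pairs n"
      and x: "d \<in> carrier K" "x \<in> carrier B"
    have "lin_map K B (chain m) (\<lambda>x. simple m (\<phi> (a, b((u, v) := x))))"
      using \<phi> s by (auto simp: multilinear_def)
    from lin_mapD(8)[OF this x]
    show "push K \<phi> (gen K (a, b((u, v) := d \<odot>\<^bsub>B\<^esub> x)) \<ominus>\<^bsub>free_chain n\<^esub>
        (d \<odot>\<^bsub>free_chain n\<^esub> gen K (a, b((u, v) := x)))) \<in> tensor_rels m"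
      using g[OF arrays_upd(2)[OF s]] x
      by (simp add: P iff c simple_def del: free_mod_simps)
  qed
qed

lemma on_simple_linear:
  assumes \<phi>: "multilinear n m \<phi>"
  shows "lin_map K (chain n) (chain m) (on_simple m \<phi>)"
    and "s \<in> arrays n \<Longrightarrow> on_simple m \<phi> (simple n s) = simple m (\<phi> s)"
proof -
  interpret D: domain K by (rule domain_K)
  have \<phi>_map: "\<phi> \<in> arrays n \<rightarrow> arrays m" using \<phi> by (simp add: multilinear_def)
  note p = K.lin_map_push[OF \<phi>_map]
  have "tensor_rels n \<subseteq> {f \<in> carrier (free_chain n). push K \<phi> f \<in> tensor_rels m}"
    unfolding tensor_rels_def[of n]
    using push_multilinear_rels[OF \<phi>] multilinear_rels_carrier
    by (intro hull_minimal submodule_vimage[OF p submodule_tensor_rels]) auto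
  then have sub: "push K \<phi> f \<in> tensor_rels m" if "f \<in> tensor_rels n" for f using that by auto
  show "lin_map K (chain n) (chain m) (on_simple m \<phi>)"
    unfolding chain_def on_simple_def
    by (rule lin_map_induced[OF p submodule_tensor_rels submodule_tensor_rels sub])
  show "on_simple m \<phi> (simple n s) = simple m (\<phi> s)" if "s \<in> arrays n"
    using induced_coset[OF p submodule_tensor_rels submodule_tensor_rels sub K.gen_closed[OF that]]
    by (simp add: on_simple_def simple_def D.push_gen)
qed

lemma multilinear_compose:
  assumes \<phi>: "multilinear n m \<phi>" and \<psi>: "multilinear m l \<psi>"
  shows "multilinear n l (\<lambda>s. \<psi> (\<phi> s))"
proof -
  have \<phi>_map: "\<phi> \<in> arrays n \<rightarrow> arrays m" and \<psi>_map: "\<psi> \<in> arrays m \<rightarrow> arrays l"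
    using \<phi> \<psi> by (auto simp: multilinear_def)
  have *: "lin_map K R (chain l) (\<lambda>x. simple l (\<psi> (f x)))"
    if "lin_map K R (chain m) (\<lambda>x. simple m (f x))" "\<And>x. x \<in> carrier R \<Longrightarrow> f x \<in> arrays m"
    for f and R :: "('k, 'x, 'y) module_scheme"
    by (rule lin_map_cong[OF lin_map_compose[OF that(1) on_simple_linear(1)[OF \<psi>]]])
      (simp add: on_simple_linear(2)[OF \<psi>] that(2))
  show ?thesis
    unfolding multilinear_def
    using \<phi>_map \<psi>_map \<phi> arrays_upd
    by (auto simp: multilinear_def simp del: atLeastAtMost_iff intro!: *)
qed

text \<open>
  The only way in which multilinearity arises here: an entry of the argument enters a single entry
  of the result, linearly, and all other entries of the result stay fixed.
\<close>

abbreviation linear_in_A_slot ::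
    "int \<Rightarrow> ('k, 'x, 'y) module_scheme \<Rightarrow> ('x \<Rightarrow> ('a, 'b) array) \<Rightarrow> bool"
  where "linear_in_A_slot m R f \<equiv>
    \<exists>a b l g. (a, b) \<in> arrays m \<and> l \<in> {0..m} \<and> lin_map K R A g \<and>
      (\<forall>x\<in>carrier R. f x = (a(l := g x), b))"

abbreviation linear_in_B_slot ::
    "int \<Rightarrow> ('k, 'x, 'y) module_scheme \<Rightarrow> ('x \<Rightarrow> ('a, 'b) array) \<Rightarrow> bool"
  where "linear_in_B_slot m R f \<equiv>
    \<exists>a b e g. (a, b) \<in> arrays m \<and> e \<in> pairs m \<and> lin_map K R B g \<and>
      (\<forall>x\<in>carrier R. f x = (a, b(e := g x)))"

lemma multilinearI:
  assumes map: "\<And>a b. (a, b) \<in> arrays n \<Longrightarrow> \<phi> (a, b) \<in> arrays m"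
    and A: "\<And>a b l. (a, b) \<in> arrays n \<Longrightarrow> l \<in> {0..n} \<Longrightarrow>
      linear_in_A_slot m A (\<lambda>x. \<phi> (a(l := x), b))"
    and B: "\<And>a b e. (a, b) \<in> arrays n \<Longrightarrow> e \<in> pairs n \<Longrightarrow>
      linear_in_A_slot m B (\<lambda>x. \<phi> (a, b(e := x))) \<or> linear_in_B_slot m B (\<lambda>x. \<phi> (a, b(e := x)))"
  shows "multilinear n m \<phi>"
  unfolding multilinear_def
proof (intro conjI allI impI ballI)
  show "\<phi> \<in> arrays n \<rightarrow> arrays m" using map by auto
  fix a b assume s: "(a, b) \<in> arrays n"
  show "lin_map K A (chain m) (\<lambda>x. simple m (\<phi> (a(l := x), b)))" if "l \<in> {0..n}" for l
  proof -
    from A[OF s that] obtain a' b' l' g where g: "(a', b') \<in> arrays m" "l' \<in> {0..m}"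
      "lin_map K A A g" "\<forall>x\<in>carrier A. \<phi> (a(l := x), b) = (a'(l' := g x), b')" by auto
    show ?thesis
      by (rule lin_map_cong[OF lin_map_compose[OF g(3) simple_linear_A[OF g(1,2)]]]) (use g(4) in simp)
  qed
  show "lin_map K B (chain m) (\<lambda>x. simple m (\<phi> (a, b(e := x))))" if "e \<in> pairs n" for e
    using B[OF s that]
  proof (elim disjE exE conjE)
    fix a' b' l' g assume g: "(a', b') \<in> arrays m" "l' \<in> {0..m}"
      "lin_map K B A g" "\<forall>x\<in>carrier B. \<phi> (a, b(e := x)) = (a'(l' := g x), b')"
    show ?thesis
      by (rule lin_map_cong[OF lin_map_compose[OF g(3) simple_linear_A[OF g(1,2)]]]) (use g(4) in simp)
  next
    fix a' b' e' g assume g: "(a', b') \<in> arrays m" "e' \<in> pairs m"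
      "lin_map K B B g" "\<forall>x\<in>carrier B. \<phi> (a, b(e := x)) = (a', b'(e' := g x))"
    show ?thesis
      by (rule lin_map_cong[OF lin_map_compose[OF g(3) simple_linear_B[OF g(1,2)]]]) (use g(4) in simp)
  qed
qed

end

section \<open>Identities between operations on arrays\<close>

context secondary_triple
begin

lemma pairs_iff: "(p, q) \<in> pairs n \<longleftrightarrow> 0 \<le> p \<and> p < q \<and> q \<le> n"
  by (simp add: pairs_def)

lemma entry_A: "(a, b) \<in> arrays n \<Longrightarrow> 0 \<le> l \<Longrightarrow> l \<le> n \<Longrightarrow> a l \<in> carrier A"
  by (auto simp: arrays_iff)

lemma entry_B: "(a, b) \<in> arrays n \<Longrightarrow> 0 \<le> p \<Longrightarrow> p < q \<Longrightarrow> q \<le> n \<Longrightarrow> b (p, q) \<in> carrier B"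
  by (auto simp: arrays_iff pairs_def)

lemma arrays_nonneg: "s \<in> arrays n \<Longrightarrow> 0 \<le> n"
  by (auto simp: arrays_def)

lemma arraysI:
  assumes "0 \<le> m" "\<And>l. 0 \<le> l \<Longrightarrow> l \<le> m \<Longrightarrow> f l \<in> carrier A"
    and "\<And>u v. 0 \<le> u \<Longrightarrow> u < v \<Longrightarrow> v \<le> m \<Longrightarrow> g u v \<in> carrier B"
  shows "(\<lambda>l\<in>{0..m}. f l, \<lambda>(u, v)\<in>pairs m. g u v) \<in> arrays m"
  using assms by (auto simp: arrays_iff pairs_def)

lemma arrays_restrict:
  assumes "(a, b) \<in> arrays n"
  shows "a = (\<lambda>l\<in>{0..n}. a l)" "b = (\<lambda>(u, v)\<in>pairs n. b (u, v))"
  using assms by (auto simp: arrays_iff PiE_iff extensional_def fun_eq_iff restrict_def)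

lemma table_eqI:
  assumes "\<And>l. 0 \<le> l \<Longrightarrow> l \<le> m \<Longrightarrow> f l = f' l"
    and "\<And>u v. 0 \<le> u \<Longrightarrow> u < v \<Longrightarrow> v \<le> m \<Longrightarrow> g u v = g' u v"
  shows "(\<lambda>l\<in>{0..m}. f l, \<lambda>(u, v)\<in>pairs m. g u v) = (\<lambda>l\<in>{0..m}. f' l, \<lambda>(u, v)\<in>pairs m. g' u v)"
  using assms by (auto simp: fun_eq_iff restrict_def pairs_def)

text \<open>
  The entries of a merged array in closed form. The fibres of \<^const>\<open>merge_ix\<close> have one or two elements,
  and two different fibres are never both of size two, so the products in \<^const>\<open>merge\<close> have at most two
  factors.
\<close>

definition merged_A :: "int \<Rightarrow> (int \<Rightarrow> 'a) \<Rightarrow> (int \<times> int \<Rightarrow> 'b) \<Rightarrow> int \<Rightarrow> 'a"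
  where "merged_A i a b l = (if l < i then a l
    else if l = i then a i \<otimes>\<^bsub>A\<^esub> a (i + 1) \<otimes>\<^bsub>A\<^esub> \<epsilon> (b (i, i + 1)) else a (l + 1))"

definition merged_B :: "int \<Rightarrow> (int \<times> int \<Rightarrow> 'b) \<Rightarrow> int \<Rightarrow> int \<Rightarrow> 'b"
  where "merged_B i b u v = (if v < i then b (u, v)
    else if v = i then b (u, i) \<otimes>\<^bsub>B\<^esub> b (u, i + 1)
    else if u < i then b (u, v + 1)
    else if u = i then b (i, v + 1) \<otimes>\<^bsub>B\<^esub> b (i + 1, v + 1)
    else b (u + 1, v + 1))"

lemma merge_ix_fibre:
  assumes "0 \<le> i" "i < n" "0 \<le> u" "u \<le> n - 1"
  shows "{p \<in> {0..n}. merge_ix i p = u} = (if u < i then {u} else if u = i then {i, i + 1} else {u + 1})"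
  using assms by (auto simp: merge_ix_def split: if_splits)

lemma merge_eq:
  assumes s: "(a, b) \<in> arrays n" and i: "0 \<le> i" "i < n"
  shows "merge n i (a, b) = (\<lambda>l\<in>{0..n - 1}. merged_A i a b l, \<lambda>(u, v)\<in>pairs (n - 1). merged_B i b u v)"
proof -
  note c = entry_B[OF s]
  have "(\<Otimes>\<^bsub>B\<^esub>e\<in>{p \<in> {0..n}. merge_ix i p = u} \<times> {q \<in> {0..n}. merge_ix i q = v}. b e) = merged_B i b u v"
    if "0 \<le> u" "u < v" "v \<le> n - 1" for u v
  proof -
    have uv: "u \<le> n - 1" "0 \<le> v" using that by auto
    consider "v < i" | "v = i" | "u < i" "v > i" | "u = i" | "u > i" by linarith
    then show ?thesis
    proof cases
      case 2
      have "{u} \<times> {i, i + 1} = {(u, i), (u, i + 1)}" by auto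
      then show ?thesis
        unfolding merge_ix_fibre[OF i that(1) uv(1)] merge_ix_fibre[OF i uv(2) that(3)]
        using 2 that i c by (simp add: merged_B_def)
    next
      case 4
      have "{i, i + 1} \<times> {v + 1} = {(i, v + 1), (i + 1, v + 1)}" by auto
      then show ?thesis
        unfolding merge_ix_fibre[OF i that(1) uv(1)] merge_ix_fibre[OF i uv(2) that(3)]
        using 4 that i c by (simp add: merged_B_def)
    qed (unfold merge_ix_fibre[OF i that(1) uv(1)] merge_ix_fibre[OF i uv(2) that(3)],
        use that i c in \<open>simp_all add: merged_B_def\<close>)
  qed
  then show ?thesis
    unfolding merge_def merged_A_def[abs_def] by (auto simp: fun_eq_iff restrict_def pairs_def)
qed

lemma wrap_eq: "wrap n (a, b) =
    (\<lambda>l\<in>{0..n - 1}. if l = 0 then a n \<otimes>\<^bsub>A\<^esub> a 0 \<otimes>\<^bsub>A\<^esub> \<epsilon> (b (0, n)) else a l,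
     \<lambda>(u, v)\<in>pairs (n - 1). if u = 0 then b (v, n) \<otimes>\<^bsub>B\<^esub> b (0, v) else b (u, v))"
  by (simp add: wrap_def)

lemma rotate_eq: "rotate n (a, b) = (\<lambda>l\<in>{0..n}. if l = 0 then a n else a (l - 1),
     \<lambda>(u, v)\<in>pairs n. if u = 0 then b (v - 1, n) else b (u - 1, v - 1))"
  by (simp add: rotate_def)

text \<open>
  The extra degeneracy: a new index in front of all others, with unit entries in its row.
\<close>

definition unit_row :: "int \<Rightarrow> ('a, 'b) array \<Rightarrow> ('a, 'b) array"
  where "unit_row n = (\<lambda>(a, b).
    (\<lambda>l\<in>{0..n + 1}. if l = 0 then \<one>\<^bsub>A\<^esub> else a (l - 1),
     \<lambda>(u, v)\<in>pairs (n + 1). if u = 0 then \<one>\<^bsub>B\<^esub> else b (u - 1, v - 1)))"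

lemma unit_row_eq: "unit_row n (a, b) =
    (\<lambda>l\<in>{0..n + 1}. if l = 0 then \<one>\<^bsub>A\<^esub> else a (l - 1),
     \<lambda>(u, v)\<in>pairs (n + 1). if u = 0 then \<one>\<^bsub>B\<^esub> else b (u - 1, v - 1))"
  by (simp add: unit_row_def)

lemma merged_A_closed:
  "(a, b) \<in> arrays n \<Longrightarrow> 0 \<le> i \<Longrightarrow> i < n \<Longrightarrow> 0 \<le> l \<Longrightarrow> l \<le> n - 1 \<Longrightarrow> merged_A i a b l \<in> carrier A"
  by (auto simp: merged_A_def entry_A eps_hom entry_B)

lemma merged_B_closed:
  "(a, b) \<in> arrays n \<Longrightarrow> 0 \<le> i \<Longrightarrow> i < n \<Longrightarrow> 0 \<le> u \<Longrightarrow> u < v \<Longrightarrow> v \<le> n - 1 \<Longrightarrow> merged_B i b u v \<in> carrier B"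
  by (auto simp: merged_B_def entry_B)

lemma merge_arrays: "s \<in> arrays n \<Longrightarrow> 0 \<le> i \<Longrightarrow> i < n \<Longrightarrow> merge n i s \<in> arrays (n - 1)"
  by (cases s) (auto simp: merge_eq intro!: arraysI merged_A_closed merged_B_closed)

lemma wrap_arrays: "s \<in> arrays n \<Longrightarrow> 1 \<le> n \<Longrightarrow> wrap n s \<in> arrays (n - 1)"
  by (cases s) (auto simp: wrap_eq entry_A entry_B eps_hom intro!: arraysI)

lemma rotate_arrays: "s \<in> arrays n \<Longrightarrow> rotate n s \<in> arrays n"
  using arrays_nonneg[of s n] by (cases s) (auto simp: rotate_eq entry_A entry_B intro!: arraysI)

lemma unit_row_arrays: "s \<in> arrays n \<Longrightarrow> unit_row n s \<in> arrays (n + 1)"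
  using arrays_nonneg[of s n] by (cases s) (auto simp: unit_row_eq entry_A entry_B intro!: arraysI)

text \<open>
  Rotation turns the indices \<open>i - 1, i\<close> into \<open>i, i + 1\<close>. The next two lemmas extend this around the
  circle: \<^const>\<open>wrap\<close> merges the indices \<open>n\<close> and \<open>0\<close>, which rotation makes adjacent.
\<close>

lemma merge_rotate:
  assumes s: "s \<in> arrays n" and i: "1 \<le> i" "i < n"
  shows "merge n i (rotate n s) = rotate (n - 1) (merge n (i - 1) s)"
proof -
  obtain a b where ab: "s = (a, b)" by (cases s)
  have s': "(a, b) \<in> arrays n" using s ab by simp
  note r = rotate_arrays[OF s', unfolded rotate_eq]
  have e: "merge n (i - 1) (a, b) = (\<lambda>l\<in>{0..n - 1}. merged_A (i - 1) a b l, \<lambda>(u, v)\<in>pairs (n - 1). merged_B (i - 1) b u v)"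
    using i by (intro merge_eq[OF s']) auto
  show ?thesis
    unfolding ab rotate_eq e
    using i
    by (subst merge_eq[OF r], simp, simp, intro table_eqI)
      (auto simp: merged_A_def merged_B_def pairs_iff)
qed

lemma merge_zero_rotate:
  assumes s: "s \<in> arrays n" and n: "1 \<le> n"
  shows "merge n 0 (rotate n s) = wrap n s"
proof -
  obtain a b where ab: "s = (a, b)" by (cases s)
  have s': "(a, b) \<in> arrays n" using s ab by simp
  note r = rotate_arrays[OF s', unfolded rotate_eq]
  show ?thesis
    unfolding ab rotate_eq wrap_eq
    using n
    by (subst merge_eq[OF r], simp, simp, intro table_eqI)
      (auto simp: merged_A_def merged_B_def pairs_iff)
qed

lemma wrap_rotate:
  assumes s: "s \<in> arrays n" and n: "1 \<le> n"
  shows "wrap n (rotate n s) = rotate (n - 1) (merge n (n - 1) s)"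
proof -
  obtain a b where ab: "s = (a, b)" by (cases s)
  have s': "(a, b) \<in> arrays n" using s ab by simp
  have e: "merge n (n - 1) (a, b) = (\<lambda>l\<in>{0..n - 1}. merged_A (n - 1) a b l, \<lambda>(u, v)\<in>pairs (n - 1). merged_B (n - 1) b u v)"
    using n by (intro merge_eq[OF s']) auto
  show ?thesis
    unfolding ab e rotate_eq wrap_eq
    using n
    by (intro table_eqI) (auto simp: merged_A_def merged_B_def pairs_iff)
qed

lemma merge_unit_row:
  assumes s: "s \<in> arrays n" and i: "1 \<le> i" "i \<le> n"
  shows "merge (n + 1) i (unit_row n s) = unit_row (n - 1) (merge n (i - 1) s)"
proof -
  obtain a b where ab: "s = (a, b)" by (cases s)
  have s': "(a, b) \<in> arrays n" using s ab by simp
  note r = unit_row_arrays[OF s', unfolded unit_row_eq]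
  have e: "merge n (i - 1) (a, b) = (\<lambda>l\<in>{0..n - 1}. merged_A (i - 1) a b l, \<lambda>(u, v)\<in>pairs (n - 1). merged_B (i - 1) b u v)"
    using i by (intro merge_eq[OF s']) auto
  show ?thesis
    unfolding ab unit_row_eq e
    using i
    by (subst merge_eq[OF r], simp, simp, simp only: diff_add_cancel add_diff_cancel_right', intro table_eqI)
      (auto simp: merged_A_def merged_B_def pairs_iff)
qed

lemma merge_zero_unit_row:
  assumes s: "s \<in> arrays n"
  shows "merge (n + 1) 0 (unit_row n s) = s"
proof -
  obtain a b where ab: "s = (a, b)" by (cases s)
  have s': "(a, b) \<in> arrays n" using s ab by simp
  note r = unit_row_arrays[OF s', unfolded unit_row_eq]
  have n: "0 \<le> n" using arrays_nonneg[OF s] .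
  have "merge (n + 1) 0 (unit_row n s) = (\<lambda>l\<in>{0..n}. a l, \<lambda>(u, v)\<in>pairs n. b (u, v))"
    unfolding ab unit_row_eq using n entry_A[OF s'] entry_B[OF s']
    by (subst merge_eq[OF r], simp, simp, simp only: add_diff_cancel_right', intro table_eqI)
      (auto simp: merged_A_def merged_B_def pairs_iff eps_hom)
  then show ?thesis unfolding ab using arrays_restrict[OF s'] by (metis (no_types))
qed

text \<open>
  The simplicial relation with the face of index zero on the outside. For \<open>j = 1\<close> both sides merge
  the indices \<open>0, 1, 2\<close>; this is where associativity in \<open>A\<close> and the centrality of the image of \<open>\<epsilon>\<close>
  enter. For \<open>j > 1\<close> disjoint pairs of indices are merged, and commutativity of \<open>B\<close> is used where the
  two merged rows and columns meet.
\<close>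

lemma merge_zero_merge:
  assumes s: "s \<in> arrays n" and j: "1 \<le> j" "j < n"
  shows "merge (n - 1) 0 (merge n j s) = merge (n - 1) (j - 1) (merge n 0 s)"
proof -
  obtain a b where ab: "s = (a, b)" by (cases s)
  have s': "(a, b) \<in> arrays n" using s ab by simp
  have m: "merge n i (a, b) = (\<lambda>l\<in>{0..n - 1}. merged_A i a b l, \<lambda>(u, v)\<in>pairs (n - 1). merged_B i b u v)"
    if "0 \<le> i" "i < n" for i using merge_eq[OF s' that] .
  have ma: "(\<lambda>l\<in>{0..n - 1}. merged_A i a b l, \<lambda>(u, v)\<in>pairs (n - 1). merged_B i b u v) \<in> arrays (n - 1)"
    if "0 \<le> i" "i < n" for i using merge_arrays[OF s' that] m[OF that] by simp
  have mj: "merge n j (a, b) = (\<lambda>l\<in>{0..n - 1}. merged_A j a b l, \<lambda>(u, v)\<in>pairs (n - 1). merged_B j b u v)"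
    and m0: "merge n 0 (a, b) = (\<lambda>l\<in>{0..n - 1}. merged_A 0 a b l, \<lambda>(u, v)\<in>pairs (n - 1). merged_B 0 b u v)"
    using m[of j] m[of 0] j by auto
  note A = entry_A[OF s'] and B = entry_B[OF s']
  have L: "merge (n - 1) 0 (merge n j (a, b)) =
      (\<lambda>l\<in>{0..n - 1 - 1}. merged_A 0 (\<lambda>l\<in>{0..n - 1}. merged_A j a b l) (\<lambda>(u, v)\<in>pairs (n - 1). merged_B j b u v) l,
       \<lambda>(u, v)\<in>pairs (n - 1 - 1). merged_B 0 (\<lambda>(u, v)\<in>pairs (n - 1). merged_B j b u v) u v)"
    unfolding mj using j by (intro merge_eq ma) auto
  have R: "merge (n - 1) (j - 1) (merge n 0 (a, b)) =
      (\<lambda>l\<in>{0..n - 1 - 1}. merged_A (j - 1) (\<lambda>l\<in>{0..n - 1}. merged_A 0 a b l) (\<lambda>(u, v)\<in>pairs (n - 1). merged_B 0 b u v) l,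
       \<lambda>(u, v)\<in>pairs (n - 1 - 1). merged_B (j - 1) (\<lambda>(u, v)\<in>pairs (n - 1). merged_B 0 b u v) u v)"
    unfolding m0 using j by (intro merge_eq ma) auto
  have *: "a 0 \<otimes>\<^bsub>A\<^esub> (a 1 \<otimes>\<^bsub>A\<^esub> a 2 \<otimes>\<^bsub>A\<^esub> \<epsilon> (b (1, 2))) \<otimes>\<^bsub>A\<^esub> \<epsilon> (b (0, 1) \<otimes>\<^bsub>B\<^esub> b (0, 2)) =
      a 0 \<otimes>\<^bsub>A\<^esub> a 1 \<otimes>\<^bsub>A\<^esub> \<epsilon> (b (0, 1)) \<otimes>\<^bsub>A\<^esub> a 2 \<otimes>\<^bsub>A\<^esub> \<epsilon> (b (0, 2) \<otimes>\<^bsub>B\<^esub> b (1, 2))"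
    if "j = 1"
  proof -
    have c: "a 0 \<in> carrier A" "a 1 \<in> carrier A" "a 2 \<in> carrier A"
      "b (0, 1) \<in> carrier B" "b (0, 2) \<in> carrier B" "b (1, 2) \<in> carrier B"
      using A B j that by auto
    have e: "\<epsilon> (b (0, 1)) \<in> carrier A" "\<epsilon> (b (0, 2)) \<in> carrier A" "\<epsilon> (b (1, 2)) \<in> carrier A"
      using c eps_hom by auto
    note com = eps_central[OF c(4)]
    have 1: "\<epsilon> (b (1, 2)) \<otimes>\<^bsub>A\<^esub> (\<epsilon> (b (0, 1)) \<otimes>\<^bsub>A\<^esub> \<epsilon> (b (0, 2))) =
        \<epsilon> (b (0, 1)) \<otimes>\<^bsub>A\<^esub> (\<epsilon> (b (0, 2)) \<otimes>\<^bsub>A\<^esub> \<epsilon> (b (1, 2)))"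
    proof -
      have "b (1, 2) \<otimes>\<^bsub>B\<^esub> (b (0, 1) \<otimes>\<^bsub>B\<^esub> b (0, 2)) = b (0, 1) \<otimes>\<^bsub>B\<^esub> (b (0, 2) \<otimes>\<^bsub>B\<^esub> b (1, 2))"
        using c by (simp add: B.m_ac)
      then have "\<epsilon> (b (1, 2) \<otimes>\<^bsub>B\<^esub> (b (0, 1) \<otimes>\<^bsub>B\<^esub> b (0, 2))) = \<epsilon> (b (0, 1) \<otimes>\<^bsub>B\<^esub> (b (0, 2) \<otimes>\<^bsub>B\<^esub> b (1, 2)))"
        by (rule arg_cong)
      then show ?thesis using c by (simp add: eps_hom)
    qed
    have 2: "\<epsilon> (b (0, 1)) \<otimes>\<^bsub>A\<^esub> (a 2 \<otimes>\<^bsub>A\<^esub> z) = a 2 \<otimes>\<^bsub>A\<^esub> (\<epsilon> (b (0, 1)) \<otimes>\<^bsub>A\<^esub> z)"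
      if "z \<in> carrier A" for z
      using c e that com[OF c(3)] by (simp flip: A.m_assoc)
    show ?thesis using c e by (simp add: A.m_assoc eps_hom 1 2)
  qed
  show ?thesis
    unfolding ab L R
  proof (rule table_eqI)
    fix l assume l: "0 \<le> l" "l \<le> n - 1 - 1"
    show "merged_A 0 (\<lambda>l\<in>{0..n - 1}. merged_A j a b l) (\<lambda>(u, v)\<in>pairs (n - 1). merged_B j b u v) l =
        merged_A (j - 1) (\<lambda>l\<in>{0..n - 1}. merged_A 0 a b l) (\<lambda>(u, v)\<in>pairs (n - 1). merged_B 0 b u v) l"
    proof (cases "j = 1")
      case True
      then show ?thesis
        using j l * by (auto simp: merged_A_def merged_B_def pairs_iff)
    next
      case False
      then show ?thesis
        using j l by (auto simp: merged_A_def merged_B_def pairs_iff)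
    qed
  next
    fix u v assume uv: "0 \<le> u" "u < v" "v \<le> n - 1 - 1"
    show "merged_B 0 (\<lambda>(u, v)\<in>pairs (n - 1). merged_B j b u v) u v =
        merged_B (j - 1) (\<lambda>(u, v)\<in>pairs (n - 1). merged_B 0 b u v) u v"
    proof (cases "u = 0")
      case True
      then show ?thesis
        using j uv B by (auto simp: merged_B_def pairs_iff B.m_ac)
    next
      case False
      then show ?thesis
        using j uv B by (auto simp: merged_B_def pairs_iff B.m_ac)
    qed
  qed
qed

text \<open>
  After \<open>k\<close> rotations the last \<open>k\<close> indices have come to the front. A pair of which only the larger
  index has wrapped around changes its order; this is the middle case. At \<open>k = n + 1\<close> all indices
  are back in place.
\<close>

lemma rotate_power:
  assumes s: "(a, b) \<in> arrays n" and k: "int k \<le> n + 1"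
  shows "(rotate n ^^ k) (a, b) =
    (\<lambda>l\<in>{0..n}. if l < int k then a (l + n + 1 - int k) else a (l - int k),
     \<lambda>(u, v)\<in>pairs n. if v < int k then b (u + n + 1 - int k, v + n + 1 - int k)
        else if u < int k then b (v - int k, u + n + 1 - int k) else b (u - int k, v - int k))"
  using k
proof (induction k)
  case 0
  have "(a, b) = (\<lambda>l\<in>{0..n}. a l, \<lambda>(u, v)\<in>pairs n. b (u, v))"
    by (rule arg_cong2[of _ _ _ _ Pair, OF arrays_restrict[OF s]])
  then show ?case
    unfolding funpow.simps id_apply by (rule trans) (intro table_eqI; simp)
next
  case (Suc k)
  show ?case
    using Suc.prems arrays_nonneg[OF s]
    by (simp add: Suc.IH rotate_eq del: of_nat_Suc, intro conjI ext)
      (auto simp: restrict_def pairs_iff algebra_simps)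
qed

lemma rotate_order:
  assumes s: "s \<in> arrays n"
  shows "(rotate n ^^ nat (n + 1)) s = s"
proof -
  obtain a b where ab: "s = (a, b)" by (cases s)
  have s': "(a, b) \<in> arrays n" using s ab by simp
  have n: "int (nat (n + 1)) = n + 1" using arrays_nonneg[OF s] by simp
  have "(rotate n ^^ nat (n + 1)) (a, b) = (\<lambda>l\<in>{0..n}. a l, \<lambda>(u, v)\<in>pairs n. b (u, v))"
    unfolding rotate_power[OF s', of "nat (n + 1)", unfolded n, OF order_refl]
    by (intro table_eqI) auto
  then show ?thesis unfolding ab using arrays_restrict[OF s'] by (metis (no_types))
qed

section \<open>Multilinearity of the array operations\<close>

lemma lin_map_mult_A:
  assumes "x \<in> carrier A"
  shows "lin_map K A A (\<lambda>y. y \<otimes>\<^bsub>A\<^esub> x)" "lin_map K A A (\<lambda>y. x \<otimes>\<^bsub>A\<^esub> y)"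
  using assms
  by (auto intro!: lin_mapI A_module simp: A.l_distr A.r_distr A_smult_mult_left A_smult_mult_right)

lemma lin_map_mult_B:
  assumes "x \<in> carrier B"
  shows "lin_map K B B (\<lambda>y. y \<otimes>\<^bsub>B\<^esub> x)" "lin_map K B B (\<lambda>y. x \<otimes>\<^bsub>B\<^esub> y)"
proof -
  show "lin_map K B B (\<lambda>y. y \<otimes>\<^bsub>B\<^esub> x)"
    using assms by (auto intro!: lin_mapI module_B simp: B.l_distr B.smult_assoc2)
  then show "lin_map K B B (\<lambda>y. x \<otimes>\<^bsub>B\<^esub> y)"
    using assms by (elim lin_map_cong) (simp add: B.m_comm)
qed

lemma lin_map_eps: "lin_map K B A \<epsilon>"
  by (auto intro!: lin_mapI module_B A_module simp: eps_hom eps_smult)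

text \<open>
  The entry with index \<open>(i, i + 1)\<close> moves to the diagonal through \<open>\<epsilon>\<close>. Every other entry keeps its
  kind and is multiplied by at most two fixed entries.
\<close>

lemma multilinear_merge:
  assumes i: "0 \<le> i" "i < n"
  shows "multilinear n (n - 1) (merge n i)"
proof (rule multilinearI)
  fix a b assume s: "(a, b) \<in> arrays n"
  note cA = entry_A[OF s] and cB = entry_B[OF s]
  show "merge n i (a, b) \<in> arrays (n - 1)" by (rule merge_arrays[OF s i])
  note T = merge_arrays[OF s i, unfolded merge_eq[OF s i]]
  show "linear_in_A_slot (n - 1) A (\<lambda>x. merge n i (a(l := x), b))" if l: "l \<in> {0..n}" for l
  proof -
    define g where "g = (\<lambda>x. if l = i then x \<otimes>\<^bsub>A\<^esub> (a (i + 1) \<otimes>\<^bsub>A\<^esub> \<epsilon> (b (i, i + 1)))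
      else if l = i + 1 then a i \<otimes>\<^bsub>A\<^esub> (x \<otimes>\<^bsub>A\<^esub> \<epsilon> (b (i, i + 1))) else x)"
    have g: "lin_map K A A g"
      using i cA cB eps_hom unfolding g_def
      by (cases "l = i"; cases "l = i + 1")
        (auto intro!: lin_map_mult_A lin_map_id A_module lin_map_compose[OF lin_map_mult_A(1) lin_map_mult_A(2)])
    have "merge n i (a(l := x), b) = ((\<lambda>l\<in>{0..n - 1}. merged_A i a b l)(merge_ix i l := g x),
        \<lambda>(u, v)\<in>pairs (n - 1). merged_B i b u v)" if x: "x \<in> carrier A" for x
      unfolding merge_eq[OF arrays_upd(1)[OF s l x] i]
      using i l x cA[of i] cA[of "i + 1"] eps_hom(1)[OF cB[of i "i + 1"]]
      by (auto simp: fun_eq_iff restrict_def merged_A_def g_def merge_ix_def A.m_assoc)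
    moreover have "merge_ix i l \<in> {0..n - 1}" using i l by (auto simp: merge_ix_def)
    ultimately show ?thesis using T g by blast
  qed
  show "linear_in_A_slot (n - 1) B (\<lambda>x. merge n i (a, b(e := x))) \<or> linear_in_B_slot (n - 1) B (\<lambda>x. merge n i (a, b(e := x)))" if e: "e \<in> pairs n" for e
  proof (cases "e = (i, i + 1)")
    case True
    have g: "lin_map K B A (\<lambda>x. a i \<otimes>\<^bsub>A\<^esub> a (i + 1) \<otimes>\<^bsub>A\<^esub> \<epsilon> x)"
      using i cA by (intro lin_map_compose[OF lin_map_eps] lin_map_mult_A) auto
    have "merge n i (a, b(e := x)) = ((\<lambda>l\<in>{0..n - 1}. merged_A i a b l)(i := a i \<otimes>\<^bsub>A\<^esub> a (i + 1) \<otimes>\<^bsub>A\<^esub> \<epsilon> x),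
        \<lambda>(u, v)\<in>pairs (n - 1). merged_B i b u v)" if x: "x \<in> carrier B" for x
      unfolding merge_eq[OF arrays_upd(2)[OF s e x] i]
      using i True by (auto simp: fun_eq_iff restrict_def merged_A_def merged_B_def pairs_iff)
    then show ?thesis using T g i by (intro disjI1) (force intro!: exI)
  next
    case False
    obtain p q where pq: "e = (p, q)" "0 \<le> p" "p < q" "q \<le> n" using e by (cases e) (auto simp: pairs_iff)
    define g where "g = (\<lambda>x. if q = i then x \<otimes>\<^bsub>B\<^esub> b (p, i + 1)
      else if q = i + 1 then b (p, i) \<otimes>\<^bsub>B\<^esub> x
      else if p = i then x \<otimes>\<^bsub>B\<^esub> b (i + 1, q)
      else if p = i + 1 then b (i, q) \<otimes>\<^bsub>B\<^esub> x else x)"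
    have g: "lin_map K B B g"
      using i cB pq False unfolding g_def
      by (cases "q = i"; cases "q = i + 1"; cases "p = i"; cases "p = i + 1") (auto intro!: lin_map_mult_B lin_map_id module_B)
    have "merge n i (a, b(e := x)) = (\<lambda>l\<in>{0..n - 1}. merged_A i a b l,
        (\<lambda>(u, v)\<in>pairs (n - 1). merged_B i b u v)((merge_ix i p, merge_ix i q) := g x))"
      if x: "x \<in> carrier B" for x
      unfolding merge_eq[OF arrays_upd(2)[OF s e x] i]
      using i pq False
      by (auto simp: fun_eq_iff restrict_def merged_A_def merged_B_def g_def merge_ix_def pairs_iff)
    moreover have "(merge_ix i p, merge_ix i q) \<in> pairs (n - 1)"
      using i pq False by (auto simp: merge_ix_def pairs_iff)
    ultimately show ?thesis using T g by blast
  qed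
qed

lemma multilinear_rotate: "multilinear n n (rotate n)"
proof (rule multilinearI)
  fix a b assume s: "(a, b) \<in> arrays n"
  have n: "0 \<le> n" using arrays_nonneg[OF s] .
  show "rotate n (a, b) \<in> arrays n" by (rule rotate_arrays[OF s])
  note T = rotate_arrays[OF s, unfolded rotate_eq]
  show "linear_in_A_slot n A (\<lambda>x. rotate n (a(l := x), b))" if l: "l \<in> {0..n}" for l
  proof -
    have "rotate n (a(l := x), b) = ((\<lambda>l\<in>{0..n}. if l = 0 then a n else a (l - 1))
          ((if l = n then 0 else l + 1) := x),
        \<lambda>(u, v)\<in>pairs n. if u = 0 then b (v - 1, n) else b (u - 1, v - 1))" for x
      using l by (auto simp: rotate_eq fun_eq_iff restrict_def)
    moreover have "(if l = n then 0 else l + 1) \<in> {0..n}" using l by auto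
    ultimately show ?thesis using T lin_map_id[OF A_module] by blast
  qed
  show "linear_in_A_slot n B (\<lambda>x. rotate n (a, b(e := x))) \<or> linear_in_B_slot n B (\<lambda>x. rotate n (a, b(e := x)))" if e: "e \<in> pairs n" for e
  proof -
    obtain p q where pq: "e = (p, q)" "0 \<le> p" "p < q" "q \<le> n" using e by (cases e) (auto simp: pairs_iff)
    let ?e = "if q = n then (0, p + 1) else (p + 1, q + 1)"
    have "rotate n (a, b(e := x)) = (\<lambda>l\<in>{0..n}. if l = 0 then a n else a (l - 1),
        (\<lambda>(u, v)\<in>pairs n. if u = 0 then b (v - 1, n) else b (u - 1, v - 1))(?e := x))" for x
      using pq by (auto simp: rotate_eq fun_eq_iff restrict_def pairs_iff)
    moreover have "?e \<in> pairs n" using pq by (auto simp: pairs_iff)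
    ultimately show ?thesis using T lin_map_id[OF module_B] by blast
  qed
qed

lemma multilinear_unit_row: "multilinear n (n + 1) (unit_row n)"
proof (rule multilinearI)
  fix a b assume s: "(a, b) \<in> arrays n"
  have n: "0 \<le> n" using arrays_nonneg[OF s] .
  show "unit_row n (a, b) \<in> arrays (n + 1)" by (rule unit_row_arrays[OF s])
  note T = unit_row_arrays[OF s, unfolded unit_row_eq]
  show "linear_in_A_slot (n + 1) A (\<lambda>x. unit_row n (a(l := x), b))" if l: "l \<in> {0..n}" for l
  proof -
    have "unit_row n (a(l := x), b) = ((\<lambda>l\<in>{0..n + 1}. if l = 0 then \<one>\<^bsub>A\<^esub> else a (l - 1))(l + 1 := x),
        \<lambda>(u, v)\<in>pairs (n + 1). if u = 0 then \<one>\<^bsub>B\<^esub> else b (u - 1, v - 1))" for x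
      using l by (auto simp: unit_row_eq fun_eq_iff restrict_def)
    moreover have "l + 1 \<in> {0..n + 1}" using l by auto
    ultimately show ?thesis using T lin_map_id[OF A_module] by blast
  qed
  show "linear_in_A_slot (n + 1) B (\<lambda>x. unit_row n (a, b(e := x))) \<or> linear_in_B_slot (n + 1) B (\<lambda>x. unit_row n (a, b(e := x)))" if e: "e \<in> pairs n" for e
  proof -
    obtain p q where pq: "e = (p, q)" "0 \<le> p" "p < q" "q \<le> n" using e by (cases e) (auto simp: pairs_iff)
    have "unit_row n (a, b(e := x)) = (\<lambda>l\<in>{0..n + 1}. if l = 0 then \<one>\<^bsub>A\<^esub> else a (l - 1),
        (\<lambda>(u, v)\<in>pairs (n + 1). if u = 0 then \<one>\<^bsub>B\<^esub> else b (u - 1, v - 1))((p + 1, q + 1) := x))" for x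
      using pq by (auto simp: unit_row_eq fun_eq_iff restrict_def pairs_iff)
    moreover have "(p + 1, q + 1) \<in> pairs (n + 1)" using pq by (auto simp: pairs_iff)
    ultimately show ?thesis using T lin_map_id[OF module_B] by blast
  qed
qed

lemma multilinear_cong:
  assumes "multilinear n m \<phi>" "\<And>s. s \<in> arrays n \<Longrightarrow> \<psi> s = \<phi> s"
  shows "multilinear n m \<psi>"
  unfolding multilinear_def
proof (intro conjI allI impI ballI)
  show "\<psi> \<in> arrays n \<rightarrow> arrays m" using assms by (auto simp: multilinear_def)
  fix a b assume s: "(a, b) \<in> arrays n"
  show "lin_map K A (chain m) (\<lambda>x. simple m (\<psi> (a(l := x), b)))" if l: "l \<in> {0..n}" for l
  proof (rule lin_map_cong)
    show "lin_map K A (chain m) (\<lambda>x. simple m (\<phi> (a(l := x), b)))"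
      using assms(1) s l by (auto simp: multilinear_def simp del: atLeastAtMost_iff)
  qed (simp add: assms(2) arrays_upd(1)[OF s l])
  show "lin_map K B (chain m) (\<lambda>x. simple m (\<psi> (a, b(e := x))))" if e: "e \<in> pairs n" for e
  proof (rule lin_map_cong)
    show "lin_map K B (chain m) (\<lambda>x. simple m (\<phi> (a, b(e := x))))"
      using assms(1) s e by (auto simp: multilinear_def)
  qed (simp add: assms(2) arrays_upd(2)[OF s e])
qed

lemma multilinear_wrap:
  assumes "1 \<le> n"
  shows "multilinear n (n - 1) (wrap n)"
  by (rule multilinear_cong[OF multilinear_compose[OF multilinear_rotate multilinear_merge[of 0 n]]])
    (use assms in \<open>simp_all add: merge_zero_rotate\<close>)

end

section \<open>The two differentials, the cyclic operator and the norm\<close>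

lemma lin_map_alt:
  assumes "lin_map K M N f"
  shows "lin_map K M N (\<lambda>x. alt N i (f x))"
  using lin_map_uminus[OF assms] assms by (cases "even i") (simp_all add: alt_def)

context module
begin

lemma alt_closed [simp]: "x \<in> carrier M \<Longrightarrow> alt M i x \<in> carrier M"
  by (simp add: alt_def)

lemma alt_alt: "x \<in> carrier M \<Longrightarrow> alt M i (alt M j x) = alt M (i + j) x"
  by (auto simp: alt_def)

lemma alt_plus_one: "x \<in> carrier M \<Longrightarrow> alt M (i + 1) x = \<ominus>\<^bsub>M\<^esub> alt M i x"
  by (auto simp: alt_def)

end

lemma (in abelian_monoid) finsum_lessThan_Suc:
  "(\<And>i. i < Suc k \<Longrightarrow> f i \<in> carrier G) \<Longrightarrow> (\<Oplus>i\<in>{..<Suc k}. f i) = f k \<oplus> (\<Oplus>i\<in>{..<k}. f i)"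
  by (simp add: lessThan_Suc finsum_insert Pi_iff)

lemma lin_map_comm_alt:
  assumes "lin_map K M N f" "x \<in> carrier M"
  shows "f (alt M i x) = alt N i (f x)"
  using assms by (simp add: alt_def lin_map_neg)

context secondary_triple
begin

interpretation C: module K "chain n" for n
  by (rule module_chain)

text \<open>
  There are no simple tensors in negative degrees. The lemma settles the degenerate cases of all the
  statements for an integer \<open>n\<close>.
\<close>

lemma chain_negative:
  assumes "n < 0" "x \<in> carrier (chain n)"
  shows "x = \<zero>\<^bsub>chain n\<^esub>"
proof (rule lin_map_eq_on_simple[OF lin_map_id lin_map_const_zero])
  fix s assume "s \<in> arrays n"
  then show "simple n s = \<zero>\<^bsub>chain n\<^esub>" using assms arrays_nonneg[of s n] by simp
qed (use assms module_chain in auto)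

text \<open>
  The operators \<open>D\<^sub>i = (-1)^i \<delta>\<^sub>i\<close>. With the sign included, \<open>\<lambda>\<close> conjugates them into each other without
  further signs.
\<close>

definition signed_face :: "int \<Rightarrow> int \<Rightarrow> (('a, 'b) array \<Rightarrow> 'k) set \<Rightarrow> (('a, 'b) array \<Rightarrow> 'k) set"
  where "signed_face n i x = alt (chain (n - 1)) i (face n i x)"

definition add_unit_row :: "int \<Rightarrow> (('a, 'b) array \<Rightarrow> 'k) set \<Rightarrow> (('a, 'b) array \<Rightarrow> 'k) set"
  where "add_unit_row n = on_simple (n + 1) (unit_row n)"

definition face_array :: "int \<Rightarrow> int \<Rightarrow> ('a, 'b) array \<Rightarrow> ('a, 'b) array"
  where "face_array n i = (if i < n then merge n i else wrap n)"

lemma face_array_multilinear: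
  "1 \<le> n \<Longrightarrow> 0 \<le> i \<Longrightarrow> i \<le> n \<Longrightarrow> multilinear n (n - 1) (face_array n i)"
  by (simp add: face_array_def multilinear_merge multilinear_wrap)

lemma face_array_closed:
  "1 \<le> n \<Longrightarrow> 0 \<le> i \<Longrightarrow> i \<le> n \<Longrightarrow> s \<in> arrays n \<Longrightarrow> face_array n i s \<in> arrays (n - 1)"
  by (simp add: face_array_def merge_arrays wrap_arrays)

lemma face_simple:
  "1 \<le> n \<Longrightarrow> 0 \<le> i \<Longrightarrow> i \<le> n \<Longrightarrow> s \<in> arrays n \<Longrightarrow> face n i (simple n s) = simple (n - 1) (face_array n i s)"
  unfolding face_def face_array_def[symmetric] by (rule on_simple_linear(2)[OF face_array_multilinear])

lemma face_lin: "1 \<le> n \<Longrightarrow> 0 \<le> i \<Longrightarrow> i \<le> n \<Longrightarrow> lin_map K (chain n) (chain (n - 1)) (face n i)"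
  unfolding face_def face_array_def[symmetric] by (rule on_simple_linear(1)[OF face_array_multilinear])

lemma signed_face_lin:
  "1 \<le> n \<Longrightarrow> 0 \<le> i \<Longrightarrow> i \<le> n \<Longrightarrow> lin_map K (chain n) (chain (n - 1)) (signed_face n i)"
  unfolding signed_face_def[abs_def] by (rule lin_map_alt[OF face_lin])

lemmas signed_face_closed = lin_mapD(6)[OF signed_face_lin]

lemma rot_simple: "s \<in> arrays n \<Longrightarrow> on_simple n (rotate n) (simple n s) = simple n (rotate n s)"
  by (rule on_simple_linear(2)[OF multilinear_rotate])

lemma rot_lin: "lin_map K (chain n) (chain n) (on_simple n (rotate n))"
  by (rule on_simple_linear(1)[OF multilinear_rotate])

lemma lam_lin: "lin_map K (chain n) (chain n) (lam n)"
  unfolding lam_def[abs_def] by (rule lin_map_alt[OF rot_lin])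

lemmas lam_closed [simp] = lin_mapD(6)[OF lam_lin]

lemma add_unit_row_lin: "lin_map K (chain n) (chain (n + 1)) (add_unit_row n)"
  unfolding add_unit_row_def by (rule on_simple_linear(1)[OF multilinear_unit_row])

lemma add_unit_row_simple: "s \<in> arrays n \<Longrightarrow> add_unit_row n (simple n s) = simple (n + 1) (unit_row n s)"
  unfolding add_unit_row_def by (rule on_simple_linear(2)[OF multilinear_unit_row])

lemmas add_unit_row_closed = lin_mapD(6)[OF add_unit_row_lin]

lemma face_array_rotate:
  assumes s: "s \<in> arrays n" and i: "1 \<le> i" "i \<le> n"
  shows "face_array n i (rotate n s) = rotate (n - 1) (face_array n (i - 1) s)"
  using merge_rotate[OF s] wrap_rotate[OF s] i by (auto simp: face_array_def)

lemma face_array_zero_rotate: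
  assumes s: "s \<in> arrays n" and n: "1 \<le> n"
  shows "face_array n 0 (rotate n s) = face_array n n s"
  using merge_zero_rotate[OF assms] n by (auto simp: face_array_def)

text \<open>
  For \<open>j = n\<close> the last face is the face of index zero after a rotation, which reduces the relation to
  the case \<open>j = 1\<close>.
\<close>

lemma face_array_zero_face_array:
  assumes s: "s \<in> arrays n" and n: "2 \<le> n" and j: "1 \<le> j" "j \<le> n"
  shows "face_array (n - 1) 0 (face_array n j s) = face_array (n - 1) (j - 1) (face_array n 0 s)"
proof (cases "j = n")
  case False
  then show ?thesis using merge_zero_merge[OF s j(1)] j n by (simp add: face_array_def)
next
  case True
  have r: "rotate n s \<in> arrays n" by (rule rotate_arrays[OF s])
  have m: "merge n 0 s \<in> arrays (n - 1)" using merge_arrays[OF s] n by simp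
  have "merge (n - 1) 0 (wrap n s) = merge (n - 1) 0 (merge n 0 (rotate n s))"
    using merge_zero_rotate[OF s] n by simp
  also have "\<dots> = merge (n - 1) 0 (merge n 1 (rotate n s))"
    using merge_zero_merge[OF r, of 1] n by simp
  also have "\<dots> = merge (n - 1) 0 (rotate (n - 1) (merge n 0 s))"
    using merge_rotate[OF s, of 1] n by simp
  also have "\<dots> = wrap (n - 1) (merge n 0 s)"
    using merge_zero_rotate[OF m] n by simp
  finally show ?thesis using True n by (simp add: face_array_def)
qed

text \<open>
  The signs agree because \<open>(-1)^n (-1)^i = (-1)^(n-1) (-1)^(i-1)\<close>.
\<close>

lemma signed_face_lam:
  assumes i: "1 \<le> i" "i \<le> n" and x: "x \<in> carrier (chain n)"
  shows "signed_face n i (lam n x) = lam (n - 1) (signed_face n (i - 1) x)"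
proof -
  have n: "1 \<le> n" using i by simp
  have c: "face n (i - 1) y \<in> carrier (chain (n - 1))" if "y \<in> carrier (chain n)" for y
    using lin_mapD(6)[OF face_lin that] i n by simp
  have "face n i (on_simple n (rotate n) x) = on_simple (n - 1) (rotate (n - 1)) (face n (i - 1) x)"
  proof (rule lin_map_eq_on_simple[OF _ _ _ x])
    show "lin_map K (chain n) (chain (n - 1)) (\<lambda>x. face n i (on_simple n (rotate n) x))"
      using i n by (intro lin_map_compose[OF rot_lin face_lin]) auto
    show "lin_map K (chain n) (chain (n - 1)) (\<lambda>x. on_simple (n - 1) (rotate (n - 1)) (face n (i - 1) x))"
      using i n by (intro lin_map_compose[OF face_lin rot_lin]) auto
    fix s assume s: "s \<in> arrays n"
    show "face n i (on_simple n (rotate n) (simple n s)) =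
        on_simple (n - 1) (rotate (n - 1)) (face n (i - 1) (simple n s))"
      using s i n face_array_rotate[OF s]
      by (simp add: rot_simple face_simple rotate_arrays face_array_closed)
  qed
  moreover have "face n i (alt (chain n) n y) = alt (chain (n - 1)) n (face n i y)"
    if "y \<in> carrier (chain n)" for y
    using i n that by (intro lin_map_comm_alt[OF face_lin]) auto
  moreover have "on_simple (n - 1) (rotate (n - 1)) (alt (chain (n - 1)) (i - 1) y) =
      alt (chain (n - 1)) (i - 1) (on_simple (n - 1) (rotate (n - 1)) y)"
    if "y \<in> carrier (chain (n - 1))" for y
    using that by (intro lin_map_comm_alt[OF rot_lin]) auto
  ultimately show ?thesis
    using x c lin_mapD(6)[OF rot_lin]
    by (simp add: signed_face_def lam_def C.alt_alt) (simp add: alt_def)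
qed

lemma signed_face_zero_lam:
  assumes n: "1 \<le> n" and x: "x \<in> carrier (chain n)"
  shows "signed_face n 0 (lam n x) = signed_face n n x"
proof -
  have "face n 0 (on_simple n (rotate n) x) = face n n x"
  proof (rule lin_map_eq_on_simple[OF _ _ _ x])
    show "lin_map K (chain n) (chain (n - 1)) (\<lambda>x. face n 0 (on_simple n (rotate n) x))"
      using n by (intro lin_map_compose[OF rot_lin face_lin]) auto
    show "lin_map K (chain n) (chain (n - 1)) (face n n)"
      using n by (intro face_lin) auto
    fix s assume s: "s \<in> arrays n"
    show "face n 0 (on_simple n (rotate n) (simple n s)) = face n n (simple n s)"
      using s n face_array_zero_rotate[OF s]
      by (simp add: rot_simple face_simple rotate_arrays)
  qed
  moreover have "face n 0 (alt (chain n) n y) = alt (chain (n - 1)) n (face n 0 y)"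
    if "y \<in> carrier (chain n)" for y
    using n that by (intro lin_map_comm_alt[OF face_lin]) auto
  ultimately show ?thesis
    using x lin_mapD(6)[OF rot_lin] by (simp add: signed_face_def lam_def) (simp add: alt_def)
qed

lemma lam_power_lin: "lin_map K (chain n) (chain n) (lam n ^^ k)"
proof (induction k)
  case 0
  show ?case using lin_map_id[OF module_chain] by (simp add: id_def)
next
  case (Suc k)
  show ?case using lin_map_compose[OF Suc lam_lin] by (simp add: comp_def)
qed

lemmas lam_power_closed [simp] = lin_mapD(6)[OF lam_power_lin]

lemma lam_power_simple:
  assumes s: "s \<in> arrays n"
  shows "(lam n ^^ k) (simple n s) = alt (chain n) (int k * n) (simple n ((rotate n ^^ k) s))"
    and "(rotate n ^^ k) s \<in> arrays n"
proof (induction k)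
  case 0
  show "(lam n ^^ 0) (simple n s) = alt (chain n) (int 0 * n) (simple n ((rotate n ^^ 0) s))"
    by (simp add: alt_def)
  show "(rotate n ^^ 0) s \<in> arrays n" using s by simp
next
  case (Suc k)
  have c: "simple n ((rotate n ^^ k) s) \<in> carrier (chain n)" by (rule simple_closed[OF Suc(2)])
  have "(lam n ^^ Suc k) (simple n s) = lam n (alt (chain n) (int k * n) (simple n ((rotate n ^^ k) s)))"
    by (simp add: Suc)
  also have "\<dots> = alt (chain n) (int k * n) (lam n (simple n ((rotate n ^^ k) s)))"
    by (rule lin_map_comm_alt[OF lam_lin c])
  also have "lam n (simple n ((rotate n ^^ k) s)) = alt (chain n) n (simple n ((rotate n ^^ Suc k) s))"
    by (simp add: lam_def rot_simple[OF Suc(2)])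
  also have "alt (chain n) (int k * n) \<dots> = alt (chain n) (int (Suc k) * n) (simple n ((rotate n ^^ Suc k) s))"
    using simple_closed[OF rotate_arrays[OF Suc(2)]] by (simp add: C.alt_alt algebra_simps)
  finally show "(lam n ^^ Suc k) (simple n s) = alt (chain n) (int (Suc k) * n) (simple n ((rotate n ^^ Suc k) s))" .
  show "(rotate n ^^ Suc k) s \<in> arrays n" using rotate_arrays[OF Suc(2)] by simp
qed

text \<open>
  The \<open>n + 1\<close> factors \<open>(-1)^n\<close> have product \<open>(-1)^(n (n + 1)) = 1\<close>.
\<close>

lemma lam_order:
  assumes n: "0 \<le> n" and x: "x \<in> carrier (chain n)"
  shows "(lam n ^^ Suc (nat n)) x = x"
proof (rule lin_map_eq_on_simple[OF lam_power_lin lin_map_id[OF module_chain] _ x])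
  fix s assume s: "s \<in> arrays n"
  have k: "Suc (nat n) = nat (n + 1)" using n by simp
  have "even (int (nat (n + 1)) * n)" using n by simp
  then show "(lam n ^^ Suc (nat n)) (simple n s) = simple n s"
    unfolding lam_power_simple(1)[OF s] k rotate_order[OF s] by (simp add: alt_def)
qed

lemma signed_face_lam_power:
  assumes n: "1 \<le> n" and i: "int i \<le> n" and x: "x \<in> carrier (chain n)"
  shows "signed_face n (int i) ((lam n ^^ i) x) = (lam (n - 1) ^^ i) (signed_face n 0 x)"
  using i
proof (induction i)
  case (Suc i)
  have "signed_face n (int (Suc i)) (lam n ((lam n ^^ i) x)) = lam (n - 1) (signed_face n (int i) ((lam n ^^ i) x))"
    using Suc.prems signed_face_lam[of "int (Suc i)" n "(lam n ^^ i) x"] x by simp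
  then show ?case using Suc by simp
qed simp

text \<open>
  The formula \<open>D\<^sub>i = \<lambda>^i D\<^sub>0 \<lambda>^(-i)\<close>, in which \<open>\<lambda>^(-i)\<close> is expressed as \<open>\<lambda>^(n+1-i)\<close>.
\<close>

lemma signed_face_conj:
  assumes n: "1 \<le> n" and i: "int i \<le> n" and x: "x \<in> carrier (chain n)"
  shows "signed_face n (int i) x = (lam (n - 1) ^^ i) (signed_face n 0 ((lam n ^^ (Suc (nat n) - i)) x))"
proof -
  have "i \<le> Suc (nat n)" using i by simp
  then have "(lam n ^^ i) ((lam n ^^ (Suc (nat n) - i)) x) = (lam n ^^ Suc (nat n)) x"
    by (simp only: funpow_add[symmetric, THEN fun_cong, unfolded comp_def] le_add_diff_inverse)
  then have "x = (lam n ^^ i) ((lam n ^^ (Suc (nat n) - i)) x)" using lam_order[OF _ x] n by simp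
  then show ?thesis using signed_face_lam_power[OF n i, of "(lam n ^^ (Suc (nat n) - i)) x"] x by simp
qed

lemma signed_face_zero_signed_face:
  assumes n: "2 \<le> n" and j: "1 \<le> j" "j \<le> n" and x: "x \<in> carrier (chain n)"
  shows "signed_face (n - 1) 0 (signed_face n j x) = \<ominus>\<^bsub>chain (n - 2)\<^esub> signed_face (n - 1) (j - 1) (signed_face n 0 x)"
proof -
  have c: "face n i y \<in> carrier (chain (n - 1))" if "y \<in> carrier (chain n)" "0 \<le> i" "i \<le> n" for i y
    using lin_mapD(6)[OF face_lin that(1)] that n by simp
  have c': "face (n - 1) i y \<in> carrier (chain (n - 2))" if "y \<in> carrier (chain (n - 1))" "0 \<le> i" "i \<le> n - 1" for i y
    using lin_mapD(6)[OF face_lin that(1)] that n by simp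
  have l: "lin_map K (chain (n - 1)) (chain (n - 2)) (face (n - 1) i)" if "0 \<le> i" "i \<le> n - 1" for i
    using face_lin[of "n - 1" i] that n by simp
  have "face (n - 1) 0 (face n j x) = face (n - 1) (j - 1) (face n 0 x)"
  proof (rule lin_map_eq_on_simple[OF _ _ _ x])
    show "lin_map K (chain n) (chain (n - 2)) (\<lambda>x. face (n - 1) 0 (face n j x))"
      using n j by (intro lin_map_compose[OF face_lin l]) auto
    show "lin_map K (chain n) (chain (n - 2)) (\<lambda>x. face (n - 1) (j - 1) (face n 0 x))"
      using n j by (intro lin_map_compose[OF face_lin l]) auto
    fix s assume s: "s \<in> arrays n"
    show "face (n - 1) 0 (face n j (simple n s)) = face (n - 1) (j - 1) (face n 0 (simple n s))"
      using s n j face_array_zero_face_array[OF s n j]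
      by (simp add: face_simple face_array_closed)
  qed
  moreover have "face (n - 1) 0 (alt (chain (n - 1)) j y) = alt (chain (n - 2)) j (face (n - 1) 0 y)"
    if "y \<in> carrier (chain (n - 1))" for y
    using n that by (intro lin_map_comm_alt[OF l]) auto
  moreover have "alt (chain (n - 2)) j y = \<ominus>\<^bsub>chain (n - 2)\<^esub> alt (chain (n - 2)) (j - 1) y"
    if "y \<in> carrier (chain (n - 2))" for y
    using C.alt_plus_one[OF that, of "j - 1"] by simp
  ultimately show ?thesis
    using x c c' n j by (simp add: signed_face_def) (simp add: alt_def)
qed

text \<open>
  Conjugation by \<open>\<lambda>\<close> lowers both indices by one, until \<open>i = 0\<close>.
\<close>

lemma signed_face_signed_face:
  assumes n: "2 \<le> n" and ij: "i < j" "int j \<le> n" and x: "x \<in> carrier (chain n)"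
  shows "signed_face (n - 1) (int i) (signed_face n (int j) x) =
      \<ominus>\<^bsub>chain (n - 2)\<^esub> signed_face (n - 1) (int (j - 1)) (signed_face n (int i) x)"
  using ij x
proof (induction i arbitrary: j x)
  case 0
  then show ?case using signed_face_zero_signed_face[OF n, of "int j" x] by (simp add: of_nat_diff)
next
  case (Suc i)
  \<comment> \<open>\<open>\<lambda>\<close> is surjective, since it has finite order\<close>
  obtain y where y: "y \<in> carrier (chain n)" "x = lam n y"
  proof
    show "(lam n ^^ nat n) x \<in> carrier (chain n)" using Suc.prems by simp
    show "x = lam n ((lam n ^^ nat n) x)" using lam_order[of n x] n Suc.prems by simp
  qed
  obtain k where k: "j = Suc k" "i < k" using Suc.prems(1) by (cases j) auto
  have sc: "signed_face n (int l) y \<in> carrier (chain (n - 1))" if "int l \<le> n" for l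
    using signed_face_closed[OF _ _ _ y(1)] that n by simp
  have sc': "signed_face (n - 1) (int l) z \<in> carrier (chain (n - 2))"
    if "int l \<le> n - 1" "z \<in> carrier (chain (n - 1))" for l z
    using signed_face_closed[OF _ _ _ that(2)] that n by simp
  have m: "signed_face n (int (Suc l)) (lam n y) = lam (n - 1) (signed_face n (int l) y)"
    if "int (Suc l) \<le> n" for l
    using signed_face_lam[of "int (Suc l)" n y] that y by simp
  have m': "signed_face (n - 1) (int (Suc l)) (lam (n - 1) z) = lam (n - 2) (signed_face (n - 1) (int l) z)"
    if "int (Suc l) \<le> n - 1" "z \<in> carrier (chain (n - 1))" for l z
    using signed_face_lam[of "int (Suc l)" "n - 1" z] that by simp
  obtain k' where k': "k = Suc k'" using k(2) by (cases k) auto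
  have "signed_face (n - 1) (int (Suc i)) (signed_face n (int j) x) =
      lam (n - 2) (signed_face (n - 1) (int i) (signed_face n (int k) y))"
    unfolding y(2) k(1) using Suc.prems k by (subst m, simp, subst m') (auto intro!: sc)
  also have "\<dots> = lam (n - 2) (\<ominus>\<^bsub>chain (n - 2)\<^esub> signed_face (n - 1) (int k') (signed_face n (int i) y))"
    using Suc.IH[of k y] Suc.prems k k' y by simp
  also have "\<dots> = \<ominus>\<^bsub>chain (n - 2)\<^esub> lam (n - 2) (signed_face (n - 1) (int k') (signed_face n (int i) y))"
    using Suc.prems k k' by (intro lin_map_neg[OF lam_lin] sc' sc) auto
  also have "lam (n - 2) (signed_face (n - 1) (int k') (signed_face n (int i) y)) =
      signed_face (n - 1) (int (j - 1)) (signed_face n (int (Suc i)) x)"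
    unfolding y(2) k(1) k' using Suc.prems k k'
    by (subst m, simp, simp only: diff_Suc_1, subst m') (auto intro!: sc)
  finally show ?case .
qed

lemma signed_face_zero_add_unit_row:
  assumes n: "0 \<le> n" and x: "x \<in> carrier (chain n)"
  shows "signed_face (n + 1) 0 (add_unit_row n x) = x"
proof -
  have l: "lin_map K (chain (n + 1)) (chain n) (face (n + 1) 0)" using face_lin[of "n + 1" 0] n by simp
  have "face (n + 1) 0 (add_unit_row n x) = x"
  proof (rule lin_map_eq_on_simple[OF lin_map_compose[OF add_unit_row_lin l] lin_map_id[OF module_chain] _ x])
    fix s assume s: "s \<in> arrays n"
    show "face (n + 1) 0 (add_unit_row n (simple n s)) = simple n s"
      using face_simple[of "n + 1" 0 "unit_row n s"] merge_zero_unit_row[OF s] n s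
      by (simp add: add_unit_row_simple unit_row_arrays face_array_def)
  qed
  then show ?thesis by (simp add: signed_face_def alt_def)
qed

lemma signed_face_add_unit_row:
  assumes i: "1 \<le> i" "i \<le> n" and x: "x \<in> carrier (chain n)"
  shows "signed_face (n + 1) i (add_unit_row n x) = \<ominus>\<^bsub>chain n\<^esub> add_unit_row (n - 1) (signed_face n (i - 1) x)"
proof -
  have n: "1 \<le> n" using i by simp
  have l: "lin_map K (chain (n + 1)) (chain n) (face (n + 1) i)" using face_lin[of "n + 1" i] i by simp
  have u: "lin_map K (chain (n - 1)) (chain n) (add_unit_row (n - 1))" using add_unit_row_lin[of "n - 1"] by simp
  have f: "lin_map K (chain n) (chain (n - 1)) (face n (i - 1))" using i n by (intro face_lin) auto
  have "face (n + 1) i (add_unit_row n x) = add_unit_row (n - 1) (face n (i - 1) x)"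
  proof (rule lin_map_eq_on_simple[OF lin_map_compose[OF add_unit_row_lin l] lin_map_compose[OF f u] _ x])
    fix s assume s: "s \<in> arrays n"
    show "face (n + 1) i (add_unit_row n (simple n s)) = add_unit_row (n - 1) (face n (i - 1) (simple n s))"
      using face_simple[of "n + 1" i "unit_row n s"] merge_unit_row[OF s i] n s i
        face_simple[of n "i - 1" s] add_unit_row_simple[of "merge n (i - 1) s" "n - 1"] merge_arrays[OF s, of "i - 1"]
      by (simp add: add_unit_row_simple unit_row_arrays face_array_def)
  qed
  moreover have "add_unit_row (n - 1) (alt (chain (n - 1)) (i - 1) y) = alt (chain n) (i - 1) (add_unit_row (n - 1) y)"
    if "y \<in> carrier (chain (n - 1))" for y
    using that by (rule lin_map_comm_alt[OF u])
  ultimately show ?thesis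
    using C.alt_plus_one[of "add_unit_row (n - 1) (face n (i - 1) x)" n "i - 1"]
      lin_mapD(6)[OF f x] lin_mapD(6)[OF u]
    by (simp add: signed_face_def)
qed

text \<open>
  The sum of the first \<open>k\<close> signed faces: \<open>b'\<close> for \<open>k = n\<close> and \<open>b\<close> for \<open>k = n + 1\<close>. Arbitrary \<open>k\<close>
  allows \<open>b b = 0\<close> and \<open>b' b' = 0\<close> to be proved by one induction.
\<close>

definition partial_b :: "int \<Rightarrow> nat \<Rightarrow> (('a, 'b) array \<Rightarrow> 'k) set \<Rightarrow> (('a, 'b) array \<Rightarrow> 'k) set"
  where "partial_b n k x = (\<Oplus>\<^bsub>chain (n - 1)\<^esub>i\<in>{..<k}. signed_face n (int i) x)"

lemma finsum_int_interval:
  assumes k: "int k = m + 1" and f: "\<And>i. 0 \<le> i \<Longrightarrow> i \<le> m \<Longrightarrow> f i \<in> carrier (chain l)"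
  shows "(\<Oplus>\<^bsub>chain l\<^esub>i\<in>{0..m}. f i) = (\<Oplus>\<^bsub>chain l\<^esub>i\<in>{..<k}. f (int i))"
proof -
  have e: "{0..m} = int ` {..<k}"
  proof (intro equalityI subsetI)
    fix i assume "i \<in> {0..m}"
    then show "i \<in> int ` {..<k}" using k by (intro image_eqI[of _ _ "nat i"]) auto
  qed (use k in auto)
  show ?thesis unfolding e
    by (rule C.finsum_reindex) (use k f in auto)
qed

lemma hoch_b_eq:
  assumes "1 \<le> n" "x \<in> carrier (chain n)"
  shows "hoch_b n x = partial_b n (Suc (nat n)) x"
  unfolding hoch_b_def partial_b_def signed_face_def[symmetric]
  using assms signed_face_closed[OF assms(1) _ _ assms(2)]
  by (simp add: finsum_int_interval[of "Suc (nat n)"])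

lemma hoch_b'_eq:
  assumes "1 \<le> n" "x \<in> carrier (chain n)"
  shows "hoch_b' n x = partial_b n (nat n) x"
  unfolding hoch_b'_def partial_b_def signed_face_def[symmetric]
  using assms signed_face_closed[OF assms(1) _ _ assms(2)]
  by (simp add: finsum_int_interval[of "nat n"])

lemma hoch_trivial: "n \<le> 0 \<Longrightarrow> hoch_b n x = \<zero>\<^bsub>chain (n - 1)\<^esub>" "n \<le> 0 \<Longrightarrow> hoch_b' n x = \<zero>\<^bsub>chain (n - 1)\<^esub>"
  by (simp_all add: hoch_b_def hoch_b'_def)

lemma partial_b_lin:
  assumes "1 \<le> n" "int k \<le> n + 1"
  shows "lin_map K (chain n) (chain (n - 1)) (partial_b n k)"
  unfolding partial_b_def[abs_def]
  using assms by (intro lin_map_finsum_maps module_chain signed_face_lin) auto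

lemma hoch_b_lin: "lin_map K (chain n) (chain (n - 1)) (hoch_b n)"
proof (cases "1 \<le> n")
  case True
  show ?thesis
    by (rule lin_map_cong[OF partial_b_lin[OF True, of "Suc (nat n)"]]) (use True in \<open>auto simp: hoch_b_eq\<close>)
next
  case False
  then show ?thesis
    by (intro lin_map_cong[OF lin_map_const_zero[OF module_chain module_chain]]) (simp add: hoch_trivial)
qed

lemma hoch_b'_lin: "lin_map K (chain n) (chain (n - 1)) (hoch_b' n)"
proof (cases "1 \<le> n")
  case True
  show ?thesis
    by (rule lin_map_cong[OF partial_b_lin[OF True, of "nat n"]]) (use True in \<open>auto simp: hoch_b'_eq\<close>)
next
  case False
  then show ?thesis
    by (intro lin_map_cong[OF lin_map_const_zero[OF module_chain module_chain]]) (simp add: hoch_trivial)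
qed

lemmas hoch_b_closed [simp] = lin_mapD(6)[OF hoch_b_lin]
lemmas hoch_b'_closed [simp] = lin_mapD(6)[OF hoch_b'_lin]

lemma partial_b_Suc:
  assumes "1 \<le> n" "int k \<le> n" "x \<in> carrier (chain n)"
  shows "partial_b n (Suc k) x = signed_face n (int k) x \<oplus>\<^bsub>chain (n - 1)\<^esub> partial_b n k x"
  unfolding partial_b_def
  using signed_face_closed[OF assms(1) _ _ assms(3)] assms(2) by (intro C.finsum_lessThan_Suc) auto

text \<open>
  Write \<open>P\<^sub>k\<close> for the sum of the first \<open>k\<close> signed faces. In the step,
  \<open>P\<^sub>k\<^sub>+\<^sub>1 P\<^sub>k\<^sub>+\<^sub>2 = P\<^sub>k\<^sub>+\<^sub>1 D\<^sub>k\<^sub>+\<^sub>1 + D\<^sub>k P\<^sub>k\<^sub>+\<^sub>1 + P\<^sub>k P\<^sub>k\<^sub>+\<^sub>1\<close>. The last summand vanishes by induction, and the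
  simplicial relation turns the first one into \<open>- D\<^sub>k P\<^sub>k\<^sub>+\<^sub>1\<close>.
\<close>

lemma partial_b_partial_b:
  assumes n: "2 \<le> n" and k: "int k \<le> n" and x: "x \<in> carrier (chain n)"
  shows "partial_b (n - 1) k (partial_b n (Suc k) x) = \<zero>\<^bsub>chain (n - 2)\<^esub>"
  using k
proof (induction k)
  case 0
  show ?case by (simp add: partial_b_def)
next
  case (Suc k)
  have n1: "1 \<le> n" "1 \<le> n - 1" using n by auto
  let ?P = "partial_b n (Suc k) x" and ?D = "signed_face n (int (Suc k)) x"
  have D: "signed_face n (int i) x \<in> carrier (chain (n - 1))" if "int i \<le> n" for i
    using signed_face_closed[OF n1(1) _ _ x] that by simp
  have P: "?P \<in> carrier (chain (n - 1))"
    using Suc.prems by (intro lin_mapD(6)[OF partial_b_lin[OF n1(1)]] x) simp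
  have lP: "lin_map K (chain (n - 1)) (chain (n - 2)) (partial_b (n - 1) (Suc k))"
    using partial_b_lin[OF n1(2), of "Suc k"] Suc.prems by simp
  have lD: "lin_map K (chain (n - 1)) (chain (n - 2)) (signed_face (n - 1) (int i))" if "int i \<le> n - 1" for i
    using signed_face_lin[OF n1(2), of "int i"] that by simp
  have "partial_b (n - 1) (Suc k) ?D = (\<Oplus>\<^bsub>chain (n - 2)\<^esub>i\<in>{..<Suc k}. signed_face (n - 1) (int i) ?D)"
    by (simp add: partial_b_def)
  also have "\<dots> = (\<Oplus>\<^bsub>chain (n - 2)\<^esub>i\<in>{..<Suc k}. \<ominus>\<^bsub>chain (n - 2)\<^esub> signed_face (n - 1) (int k) (signed_face n (int i) x))"
    using Suc.prems signed_face_signed_face[OF n _ _ x, of _ "Suc k"] lin_mapD(6)[OF lD] D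
    by (intro C.finsum_cong') auto
  also have "\<dots> = \<ominus>\<^bsub>chain (n - 2)\<^esub> signed_face (n - 1) (int k) ?P"
  proof -
    have "lin_map K (chain (n - 1)) (chain (n - 2)) (\<lambda>z. \<ominus>\<^bsub>chain (n - 2)\<^esub> signed_face (n - 1) (int k) z)"
      using Suc.prems by (intro lin_map_uminus lD) simp
    from lin_map_finsum[OF this, of "{..<Suc k}" "\<lambda>i. signed_face n (int i) x"]
    show ?thesis using D Suc.prems by (simp add: partial_b_def)
  qed
  finally have 1: "partial_b (n - 1) (Suc k) ?D = \<ominus>\<^bsub>chain (n - 2)\<^esub> signed_face (n - 1) (int k) ?P" .
  have "partial_b (n - 1) (Suc k) ?P = signed_face (n - 1) (int k) ?P \<oplus>\<^bsub>chain (n - 2)\<^esub> partial_b (n - 1) k ?P"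
    using partial_b_Suc[OF n1(2) _ P, of k] Suc.prems by simp
  also have "partial_b (n - 1) k ?P = \<zero>\<^bsub>chain (n - 2)\<^esub>" using Suc by simp
  finally have 2: "partial_b (n - 1) (Suc k) ?P = signed_face (n - 1) (int k) ?P"
    using lin_mapD(6)[OF lD P] Suc.prems by simp
  have "partial_b (n - 1) (Suc k) (partial_b n (Suc (Suc k)) x) =
      partial_b (n - 1) (Suc k) (?D \<oplus>\<^bsub>chain (n - 1)\<^esub> ?P)"
    using partial_b_Suc[OF n1(1) _ x, of "Suc k"] Suc.prems by simp
  also have "\<dots> = partial_b (n - 1) (Suc k) ?D \<oplus>\<^bsub>chain (n - 2)\<^esub> partial_b (n - 1) (Suc k) ?P"
    by (rule lin_mapD(7)[OF lP D P]) (use Suc.prems in simp)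
  also have "\<dots> = \<zero>\<^bsub>chain (n - 2)\<^esub>"
    unfolding 1 2 using lin_mapD(6)[OF lD P] Suc.prems by (simp add: C.l_neg)
  finally show ?case .
qed

lemma hoch_b_hoch_b:
  assumes x: "x \<in> carrier (chain n)"
  shows "hoch_b (n - 1) (hoch_b n x) = \<zero>\<^bsub>chain (n - 2)\<^esub>"
proof (cases "2 \<le> n")
  case True
  have "Suc (nat (n - 1)) = nat n" using True by simp
  then show ?thesis
    using True partial_b_partial_b[OF True _ x, of "nat n"] hoch_b_eq[OF _ x]
      hoch_b_eq[OF _ hoch_b_closed[OF x]] by simp
qed (simp add: hoch_trivial)

lemma hoch_b'_hoch_b':
  assumes x: "x \<in> carrier (chain n)"
  shows "hoch_b' (n - 1) (hoch_b' n x) = \<zero>\<^bsub>chain (n - 2)\<^esub>"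
proof (cases "2 \<le> n")
  case True
  have "Suc (nat (n - 1)) = nat n" using True by simp
  then show ?thesis
    using True partial_b_partial_b[OF True _ x, of "nat (n - 1)"] hoch_b'_eq[OF _ x]
      hoch_b'_eq[OF _ hoch_b'_closed[OF x]] by simp
qed (simp add: hoch_trivial)

end

section \<open>The norm and the rows of the bicomplex\<close>

context secondary_triple
begin

interpretation C: module K "chain n" for n
  by (rule module_chain)

lemma norm_op_eq:
  assumes "0 \<le> n"
  shows "norm_op n x = (\<Oplus>\<^bsub>chain n\<^esub>j\<in>{..<Suc (nat n)}. (lam n ^^ j) x)"
proof -
  have "{j. int j \<le> n} = {..<Suc (nat n)}" using assms by auto
  then show ?thesis by (simp add: norm_op_def)
qed

lemma norm_op_lin: "lin_map K (chain n) (chain n) (norm_op n)"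
proof -
  have "finite {j. int j \<le> n}" by (rule finite_subset[of _ "{..nat n}"]) auto
  then show ?thesis
    unfolding norm_op_def[abs_def]
    by (intro lin_map_finsum_maps module_chain lam_power_lin) auto
qed

lemmas norm_op_closed [simp] = lin_mapD(6)[OF norm_op_lin]

lemma one_minus_lam_lin: "lin_map K (chain n) (chain n) (one_minus_lam n)"
  unfolding one_minus_lam_def[abs_def] by (rule lin_map_diff[OF lin_map_id[OF module_chain] lam_lin])

lemmas one_minus_lam_closed [simp] = lin_mapD(6)[OF one_minus_lam_lin]

text \<open>
  Applying \<open>\<lambda>\<close> shifts the sum \<open>1 + \<lambda> + \<dots> + \<lambda>^n\<close> by one power, and \<open>\<lambda>^(n+1) = 1\<close> closes it up.
\<close>

lemma lam_norm_op:
  assumes x: "x \<in> carrier (chain n)"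
  shows "lam n (norm_op n x) = norm_op n x"
proof (cases "0 \<le> n")
  case True
  let ?f = "\<lambda>j. (lam n ^^ j) x"
  let ?k = "nat n"
  have "?f 0 \<oplus>\<^bsub>chain n\<^esub> (\<Oplus>\<^bsub>chain n\<^esub>j\<in>{..?k}. ?f (Suc j)) = (\<Oplus>\<^bsub>chain n\<^esub>j\<in>{..Suc ?k}. ?f j)"
    using x by (subst C.finsum_Suc2) (auto simp: C.a_comm)
  also have "\<dots> = ?f (Suc ?k) \<oplus>\<^bsub>chain n\<^esub> (\<Oplus>\<^bsub>chain n\<^esub>j\<in>{..?k}. ?f j)"
    using x by (intro C.finsum_Suc) auto
  also have "?f (Suc ?k) = ?f 0" using lam_order[OF True x] by simp
  finally have "(\<Oplus>\<^bsub>chain n\<^esub>j\<in>{..?k}. ?f (Suc j)) = (\<Oplus>\<^bsub>chain n\<^esub>j\<in>{..?k}. ?f j)"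
    using x by (simp add: Pi_iff)
  moreover have "lam n (\<Oplus>\<^bsub>chain n\<^esub>j\<in>{..?k}. ?f j) = (\<Oplus>\<^bsub>chain n\<^esub>j\<in>{..?k}. ?f (Suc j))"
    using lin_map_finsum[OF lam_lin, of "{..?k}" ?f] x by (simp add: Pi_iff)
  ultimately show ?thesis using True by (simp add: norm_op_eq lessThan_Suc_atMost)
next
  case False
  then show ?thesis using x chain_negative[of n] by (metis lam_closed not_le norm_op_closed)
qed

lemma lam_power_norm_op:
  assumes "x \<in> carrier (chain n)"
  shows "(lam n ^^ k) (norm_op n x) = norm_op n x"
  by (induction k) (simp_all add: lam_norm_op assms)

lemma norm_op_lam:
  assumes x: "x \<in> carrier (chain n)"
  shows "norm_op n (lam n x) = norm_op n x"
proof (cases "0 \<le> n")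
  case True
  have "norm_op n (lam n x) = lam n (norm_op n x)"
    using lin_map_finsum[OF lam_lin, of "{..<Suc (nat n)}" "\<lambda>j. (lam n ^^ j) x"] x
    by (simp add: norm_op_eq[OF True] Pi_iff funpow_swap1)
  then show ?thesis using lam_norm_op[OF x] by simp
next
  case False
  then show ?thesis using x chain_negative[of n] by (metis lam_closed not_le norm_op_closed)
qed

lemma norm_op_lam_power:
  assumes "x \<in> carrier (chain n)"
  shows "norm_op n ((lam n ^^ k) x) = norm_op n x"
  by (induction k) (simp_all add: norm_op_lam assms)

lemma one_minus_lam_norm_op:
  assumes "x \<in> carrier (chain n)"
  shows "one_minus_lam n (norm_op n x) = \<zero>\<^bsub>chain n\<^esub>"
  using assms by (simp add: one_minus_lam_def lam_norm_op a_minus_def C.r_neg)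

lemma norm_op_one_minus_lam:
  assumes "x \<in> carrier (chain n)"
  shows "norm_op n (one_minus_lam n x) = \<zero>\<^bsub>chain n\<^esub>"
  using assms lin_map_minus[OF norm_op_lin]
  by (simp add: one_minus_lam_def norm_op_lam) (simp add: a_minus_def C.r_neg)

text \<open>
  Moving \<open>\<lambda>\<close> to the left in \<open>b \<lambda>\<close> shifts the faces: \<open>D\<^sub>0 \<lambda> = D\<^sub>n\<close>, and \<open>D\<^sub>1 \<lambda>, \<dots>, D\<^sub>n \<lambda>\<close> add up to \<open>\<lambda> b'\<close>.
  So \<open>b \<lambda> = D\<^sub>n + \<lambda> b'\<close>, while \<open>b = D\<^sub>n + b'\<close>.
\<close>

lemma hoch_b_one_minus_lam:
  assumes x: "x \<in> carrier (chain n)"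
  shows "hoch_b n (one_minus_lam n x) = one_minus_lam (n - 1) (hoch_b' n x)"
proof (cases "1 \<le> n")
  case True
  let ?k = "nat n"
  let ?D = "\<lambda>i x. signed_face n (int i) x"
  have D: "?D i y \<in> carrier (chain (n - 1))" if "i \<le> ?k" "y \<in> carrier (chain n)" for i y
    using that True by (intro signed_face_closed[OF True _ _ that(2)]) auto
  have b: "hoch_b n x = ?D ?k x \<oplus>\<^bsub>chain (n - 1)\<^esub> hoch_b' n x"
    using True x partial_b_Suc[of n ?k x] by (simp add: hoch_b_eq hoch_b'_eq)
  obtain m where m: "?k = Suc m" using True by (cases ?k) auto
  have "hoch_b n (lam n x) = (\<Oplus>\<^bsub>chain (n - 1)\<^esub>i\<in>{..Suc m}. ?D i (lam n x))"
    using True x by (simp add: hoch_b_eq partial_b_def lessThan_Suc_atMost m)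
  also have "\<dots> = (\<Oplus>\<^bsub>chain (n - 1)\<^esub>i\<in>{..m}. ?D (Suc i) (lam n x)) \<oplus>\<^bsub>chain (n - 1)\<^esub> ?D 0 (lam n x)"
    using x m by (intro C.finsum_Suc2) (auto intro!: D simp del: of_nat_Suc)
  also have "?D 0 (lam n x) = ?D ?k x" using signed_face_zero_lam[OF True x] True by simp
  also have "(\<Oplus>\<^bsub>chain (n - 1)\<^esub>i\<in>{..m}. ?D (Suc i) (lam n x)) =
      (\<Oplus>\<^bsub>chain (n - 1)\<^esub>i\<in>{..m}. lam (n - 1) (?D i x))"
  proof (intro C.finsum_cong')
    fix i assume i: "i \<in> {..m}"
    then have "int i + 1 \<le> n" using m by auto
    then show "?D (Suc i) (lam n x) = lam (n - 1) (?D i x)"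
      using signed_face_lam[OF _ _ x, of "int (Suc i)"] by simp
  qed (use m D[OF _ x] in auto)
  also have "\<dots> = lam (n - 1) (hoch_b' n x)"
    using lin_map_finsum[OF lam_lin, of "{..m}" "\<lambda>i. ?D i x" "n - 1"] x m D True
    by (simp add: hoch_b'_eq partial_b_def lessThan_Suc_atMost Pi_iff)
  finally have bl: "hoch_b n (lam n x) = lam (n - 1) (hoch_b' n x) \<oplus>\<^bsub>chain (n - 1)\<^esub> ?D ?k x" .
  have "hoch_b n (one_minus_lam n x) = hoch_b n x \<ominus>\<^bsub>chain (n - 1)\<^esub> hoch_b n (lam n x)"
    unfolding one_minus_lam_def using lin_map_minus[OF hoch_b_lin] x by simp
  also have "\<dots> = hoch_b' n x \<ominus>\<^bsub>chain (n - 1)\<^esub> lam (n - 1) (hoch_b' n x)"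
    unfolding b bl using x D[of ?k x]
    by (simp add: a_minus_def C.minus_add C.a_ac C.r_neg2 C.r_neg1)
  finally show ?thesis by (simp add: one_minus_lam_def)
next
  case False
  then show ?thesis using x lin_map_zero[OF one_minus_lam_lin, of "n - 1"] by (simp add: hoch_trivial)
qed

text \<open>
  Both sides of \<open>b' N = N b\<close> are equal to \<open>N D\<^sub>0 N\<close>. On \<open>N x\<close>, which \<open>\<lambda>\<close> fixes, \<open>D\<^sub>i = \<lambda>^i D\<^sub>0 \<lambda>^(-i)\<close> is
  \<open>\<lambda>^i D\<^sub>0\<close>, and the powers \<open>\<lambda>^i\<close> for \<open>0 \<le> i \<le> n - 1\<close> add up to the norm in degree \<open>n - 1\<close>.
\<close>

lemma hoch_b'_norm_op_eq:
  assumes n: "1 \<le> n" and x: "x \<in> carrier (chain n)"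
  shows "hoch_b' n (norm_op n x) = norm_op (n - 1) (signed_face n 0 (norm_op n x))"
proof -
  let ?N = "norm_op n x"
  have N: "?N \<in> carrier (chain n)" using x by simp
  have D0: "signed_face n 0 ?N \<in> carrier (chain (n - 1))" using signed_face_closed[OF n _ _ N] n by simp
  have "hoch_b' n ?N = (\<Oplus>\<^bsub>chain (n - 1)\<^esub>i\<in>{..<nat n}. signed_face n (int i) ?N)"
    using n N by (simp add: hoch_b'_eq partial_b_def)
  also have "\<dots> = (\<Oplus>\<^bsub>chain (n - 1)\<^esub>i\<in>{..<nat n}. (lam (n - 1) ^^ i) (signed_face n 0 ?N))"
    using signed_face_lam_power[OF n _ N] D0 lam_power_norm_op[OF x]
    by (intro C.finsum_cong') auto
  also have "\<dots> = norm_op (n - 1) (signed_face n 0 ?N)"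
    using n norm_op_eq[of "n - 1" "signed_face n 0 ?N"] by (simp add: nat_diff_distrib Suc_diff_Suc)
  finally show ?thesis .
qed

text \<open>
  Here \<open>N\<close> absorbs the power \<open>\<lambda>^i\<close> on the left of \<open>D\<^sub>0\<close>, and the powers \<open>\<lambda>^(n+1-i)\<close> on its right, for
  \<open>0 \<le> i \<le> n\<close>, add up to \<open>\<lambda> N = N\<close>.
\<close>

lemma norm_op_hoch_b_eq:
  assumes n: "1 \<le> n" and x: "x \<in> carrier (chain n)"
  shows "norm_op (n - 1) (hoch_b n x) = norm_op (n - 1) (signed_face n 0 (norm_op n x))"
proof -
  let ?k = "nat n"
  let ?F = "\<lambda>z. norm_op (n - 1) (signed_face n 0 z)"
  have F: "lin_map K (chain n) (chain (n - 1)) ?F"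
    using n by (intro lin_map_compose[OF signed_face_lin norm_op_lin]) auto
  have D: "signed_face n (int i) x \<in> carrier (chain (n - 1))" if "i < Suc ?k" for i
    using signed_face_closed[OF n _ _ x] that n by simp
  have "norm_op (n - 1) (hoch_b n x) = (\<Oplus>\<^bsub>chain (n - 1)\<^esub>i\<in>{..<Suc ?k}. norm_op (n - 1) (signed_face n (int i) x))"
    using lin_map_finsum[OF norm_op_lin, of "{..<Suc ?k}" "\<lambda>i. signed_face n (int i) x" "n - 1"] D n x
    by (simp add: hoch_b_eq partial_b_def Pi_iff)
  also have "\<dots> = (\<Oplus>\<^bsub>chain (n - 1)\<^esub>i\<in>{..<Suc ?k}. ?F ((lam n ^^ (Suc ?k - i)) x))"
  proof (intro C.finsum_cong')
    fix i assume i: "i \<in> {..<Suc ?k}"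
    have "signed_face n 0 ((lam n ^^ (Suc ?k - i)) x) \<in> carrier (chain (n - 1))"
      using signed_face_closed[OF n] n x by simp
    moreover have "int i \<le> n" using i n by auto
    ultimately show "norm_op (n - 1) (signed_face n (int i) x) = ?F ((lam n ^^ (Suc ?k - i)) x)"
      using signed_face_conj[OF n _ x, of i] by (simp add: norm_op_lam_power)
  qed (use x lin_mapD(6)[OF F] in auto)
  also have "\<dots> = ?F (\<Oplus>\<^bsub>chain n\<^esub>i\<in>{..<Suc ?k}. (lam n ^^ (Suc ?k - i)) x)"
    using lin_map_finsum[OF F, of "{..<Suc ?k}" "\<lambda>i. (lam n ^^ (Suc ?k - i)) x"] x by simp
  also have "(\<Oplus>\<^bsub>chain n\<^esub>i\<in>{..<Suc ?k}. (lam n ^^ (Suc ?k - i)) x) = norm_op n x"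
  proof -
    let ?r = "\<lambda>i. ?k - i"
    have r: "{..<Suc ?k} = ?r ` {..<Suc ?k}"
    proof (intro equalityI subsetI)
      fix i assume "i \<in> {..<Suc ?k}"
      then show "i \<in> ?r ` {..<Suc ?k}" by (intro image_eqI[of _ _ "?k - i"]) auto
    qed auto
    have "(\<Oplus>\<^bsub>chain n\<^esub>i\<in>{..<Suc ?k}. (lam n ^^ (Suc ?k - i)) x) = (\<Oplus>\<^bsub>chain n\<^esub>i\<in>{..<Suc ?k}. (lam n ^^ Suc (?r i)) x)"
      using x by (intro C.finsum_cong') (auto simp: Suc_diff_le simp del: funpow.simps)
    also have "\<dots> = (\<Oplus>\<^bsub>chain n\<^esub>i\<in>?r ` {..<Suc ?k}. (lam n ^^ Suc i) x)"
      using x by (intro C.finsum_reindex[symmetric]) (auto simp: inj_on_def simp del: funpow.simps)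
    also have "\<dots> = (\<Oplus>\<^bsub>chain n\<^esub>i\<in>{..<Suc ?k}. lam n ((lam n ^^ i) x))"
      unfolding r[symmetric] by simp
    also have "\<dots> = lam n (norm_op n x)"
      using lin_map_finsum[OF lam_lin, of "{..<Suc ?k}" "\<lambda>i. (lam n ^^ i) x"] x n by (simp add: norm_op_eq)
    finally show ?thesis using lam_norm_op[OF x] by simp
  qed
  finally show ?thesis .
qed

lemma norm_op_hoch_b:
  assumes x: "x \<in> carrier (chain n)"
  shows "norm_op (n - 1) (hoch_b n x) = hoch_b' n (norm_op n x)"
proof (cases "1 \<le> n")
  case True
  then show ?thesis using hoch_b'_norm_op_eq[OF True x] norm_op_hoch_b_eq[OF True x] by simp
next
  case False
  then show ?thesis using lin_map_zero[OF norm_op_lin, of "n - 1"] by (simp add: hoch_trivial)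
qed

text \<open>
  In \<open>b'\<close> applied to an array with a new unit row, the face of index zero removes the row again, and
  each of the others commutes with the insertion of the row, up to a shift of its index that changes
  the sign.
\<close>

lemma hoch_b'_contraction:
  assumes x: "x \<in> carrier (chain n)"
  shows "hoch_b' (n + 1) (add_unit_row n x) \<oplus>\<^bsub>chain n\<^esub> add_unit_row (n - 1) (hoch_b' n x) = x"
proof (cases "0 \<le> n")
  case True
  let ?k = "nat n"
  let ?u = "add_unit_row n x"
  have u: "?u \<in> carrier (chain (n + 1))" by (rule add_unit_row_closed[OF x])
  have nl: "lin_map K (chain (n - 1)) (chain n) (add_unit_row (n - 1))" using add_unit_row_lin[of "n - 1"] by simp
  have D: "signed_face (n + 1) (int i) ?u \<in> carrier (chain n)" if "i \<le> ?k" for i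
    using signed_face_closed[OF _ _ _ u, of "int i"] that True by simp
  have b: "hoch_b' (n + 1) ?u = (\<Oplus>\<^bsub>chain n\<^esub>i\<in>{..?k}. signed_face (n + 1) (int i) ?u)"
    using True u by (simp add: hoch_b'_eq partial_b_def nat_add_distrib lessThan_Suc_atMost)
  have D0: "signed_face (n + 1) (int 0) ?u = x" using signed_face_zero_add_unit_row[OF True x] by simp
  show ?thesis
  proof (cases ?k)
    case 0
    then have "n = 0" using True by simp
    moreover have "hoch_b' (n + 1) ?u = x"
      unfolding b 0 using D0 x by simp
    ultimately show ?thesis using x lin_map_zero[OF nl] by (simp add: hoch_trivial)
  next
    case (Suc m)
    have E: "signed_face n (int i) x \<in> carrier (chain (n - 1))" if "i \<le> m" for i
      using signed_face_closed[OF _ _ _ x, of "int i"] that Suc by simp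
    have "hoch_b' (n + 1) ?u = (\<Oplus>\<^bsub>chain n\<^esub>i\<in>{..m}. signed_face (n + 1) (int (Suc i)) ?u)
        \<oplus>\<^bsub>chain n\<^esub> signed_face (n + 1) (int 0) ?u"
      unfolding b Suc using Suc
      by (intro C.finsum_Suc2) (auto intro!: D simp del: of_nat_Suc)
    also note D0
    also have "(\<Oplus>\<^bsub>chain n\<^esub>i\<in>{..m}. signed_face (n + 1) (int (Suc i)) ?u) =
        (\<Oplus>\<^bsub>chain n\<^esub>i\<in>{..m}. \<ominus>\<^bsub>chain n\<^esub> add_unit_row (n - 1) (signed_face n (int i) x))"
    proof (intro C.finsum_cong')
      fix i assume i: "i \<in> {..m}"
      then have "int i + 1 \<le> n" using Suc by auto
      then show "signed_face (n + 1) (int (Suc i)) ?u = \<ominus>\<^bsub>chain n\<^esub> add_unit_row (n - 1) (signed_face n (int i) x)"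
        using signed_face_add_unit_row[OF _ _ x, of "int (Suc i)"] by simp
    qed (use lin_mapD(6)[OF nl E] in auto)
    also have "\<dots> = \<ominus>\<^bsub>chain n\<^esub> add_unit_row (n - 1) (hoch_b' n x)"
      using lin_map_finsum[OF lin_map_uminus[OF nl], of "{..m}" "\<lambda>i. signed_face n (int i) x"] E Suc x
      by (simp add: hoch_b'_eq partial_b_def lessThan_Suc_atMost Pi_iff)
    finally show ?thesis
      using x lin_mapD(6)[OF nl] by (simp add: C.a_ac C.r_neg C.l_neg)
  qed
next
  case False
  have "hoch_b' (n + 1) (add_unit_row n x) \<oplus>\<^bsub>chain n\<^esub> add_unit_row (n - 1) (hoch_b' n x) \<in> carrier (chain n)"
    using hoch_b'_closed[of "add_unit_row n x" "n + 1"] add_unit_row_closed[of "hoch_b' n x" "n - 1"]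
      add_unit_row_closed[OF x] x by simp
  from chain_negative[OF _ this] chain_negative[OF _ x] show ?thesis using False by simp
qed

end

section \<open>Exactness of the rows in characteristic zero\<close>

locale secondary_triple_char_0 = secondary_triple +
  assumes char_zero: "0 < m \<Longrightarrow> add_pow K (m::nat) \<one>\<^bsub>K\<^esub> \<noteq> \<zero>\<^bsub>K\<^esub>"
begin

interpretation C: module K "chain n" for n
  by (rule module_chain)

lemma add_pow_smult:
  assumes "x \<in> carrier (chain n)"
  shows "add_pow K (k::nat) \<one>\<^bsub>K\<^esub> \<odot>\<^bsub>chain n\<^esub> x = add_pow (chain n) k x"
  using assms by (induction k) (simp_all add: C.smult_l_distr)

lemma divide_by_nat:
  assumes k: "0 < k" and x: "x \<in> carrier (chain n)"
  obtains c where "c \<in> carrier K" "c \<odot>\<^bsub>chain n\<^esub> add_pow (chain n) (k::nat) x = x"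
    "add_pow (chain n) k (c \<odot>\<^bsub>chain n\<^esub> x) = x"
proof -
  interpret F: field K by (rule K_field)
  let ?k = "add_pow K k \<one>\<^bsub>K\<^esub>"
  have "?k \<in> Units K" using char_zero[OF k] by (simp add: F.field_Units)
  then have c: "inv\<^bsub>K\<^esub> ?k \<in> carrier K" "inv\<^bsub>K\<^esub> ?k \<otimes>\<^bsub>K\<^esub> ?k = \<one>\<^bsub>K\<^esub>" "?k \<otimes>\<^bsub>K\<^esub> inv\<^bsub>K\<^esub> ?k = \<one>\<^bsub>K\<^esub>" by auto
  show ?thesis
  proof
    show "inv\<^bsub>K\<^esub> ?k \<in> carrier K" by (rule c)
    show "inv\<^bsub>K\<^esub> ?k \<odot>\<^bsub>chain n\<^esub> add_pow (chain n) k x = x"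
      using c x by (simp add: add_pow_smult[symmetric] C.smult_assoc1[symmetric])
    show "add_pow (chain n) k (inv\<^bsub>K\<^esub> ?k \<odot>\<^bsub>chain n\<^esub> x) = x"
      using c x by (simp add: add_pow_smult[symmetric] C.smult_assoc1[symmetric])
  qed
qed

text \<open>
  If \<open>\<lambda> x = x\<close>, then \<open>N x = (n + 1) x\<close>.
\<close>

lemma kernel_one_minus_lam:
  assumes x: "x \<in> carrier (chain n)" and 0: "one_minus_lam n x = \<zero>\<^bsub>chain n\<^esub>"
  obtains y where "y \<in> carrier (chain n)" "norm_op n y = x"
proof (cases "0 \<le> n")
  case True
  obtain c where c: "c \<in> carrier K" "add_pow (chain n) (Suc (nat n)) (c \<odot>\<^bsub>chain n\<^esub> x) = x"
    by (rule divide_by_nat[of "Suc (nat n)" x n]) (use x in auto)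
  have "lam n x = x" using 0 x by (simp add: one_minus_lam_def C.diff_eq_zero_iff)
  then have "lam n (c \<odot>\<^bsub>chain n\<^esub> x) = c \<odot>\<^bsub>chain n\<^esub> x" using lin_mapD(8)[OF lam_lin c(1) x] by simp
  then have "(lam n ^^ j) (c \<odot>\<^bsub>chain n\<^esub> x) = c \<odot>\<^bsub>chain n\<^esub> x" for j by (induction j) simp_all
  then have "norm_op n (c \<odot>\<^bsub>chain n\<^esub> x) = (\<Oplus>\<^bsub>chain n\<^esub>j\<in>{..<Suc (nat n)}. c \<odot>\<^bsub>chain n\<^esub> x)"
    using True by (simp add: norm_op_eq)
  also have "\<dots> = add_pow (chain n) (Suc (nat n)) (c \<odot>\<^bsub>chain n\<^esub> x)"
    using c x C.add.finprod_const[of "c \<odot>\<^bsub>chain n\<^esub> x" n "{..<Suc (nat n)}"] by (simp del: C.add.nat_pow_Suc)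
  finally have "norm_op n (c \<odot>\<^bsub>chain n\<^esub> x) = x" using c by simp
  then show ?thesis using that[of "c \<odot>\<^bsub>chain n\<^esub> x"] c x by simp
next
  case False
  then have "norm_op n x = x"
    using chain_negative[OF _ x] chain_negative[OF _ norm_op_closed[OF x]] by simp
  then show ?thesis using that x by blast
qed

text \<open>
  If \<open>N x = 0\<close>, then \<open>(n + 1) x\<close> is the sum of the elements \<open>x - \<lambda>^j x\<close> for \<open>0 \<le> j \<le> n\<close>, and each of these
  is in the image of \<open>1 - \<lambda>\<close>.
\<close>

lemma kernel_norm_op:
  assumes x: "x \<in> carrier (chain n)" and 0: "norm_op n x = \<zero>\<^bsub>chain n\<^esub>"
  obtains y where "y \<in> carrier (chain n)" "one_minus_lam n y = x"
proof (cases "0 \<le> n")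
  case True
  let ?I = "one_minus_lam n ` carrier (chain n)"
  note I = C.submoduleE[OF submodule_image[OF one_minus_lam_lin, of n]]
  have zI: "\<zero>\<^bsub>chain n\<^esub> \<in> ?I"
    using lin_map_zero[OF one_minus_lam_lin[of n]] by (intro image_eqI[of _ _ "\<zero>\<^bsub>chain n\<^esub>"]) auto
  have pow: "x \<ominus>\<^bsub>chain n\<^esub> (lam n ^^ j) x \<in> ?I" for j
  proof (induction j)
    case 0
    then show ?case using zI x by (simp add: a_minus_def C.r_neg)
  next
    case (Suc j)
    have "x \<ominus>\<^bsub>chain n\<^esub> (lam n ^^ Suc j) x =
        (x \<ominus>\<^bsub>chain n\<^esub> (lam n ^^ j) x) \<oplus>\<^bsub>chain n\<^esub> one_minus_lam n ((lam n ^^ j) x)"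
      using x by (simp add: one_minus_lam_def a_minus_def C.a_ac C.r_neg1 C.r_neg2)
    then show ?case using Suc I(5) x by simp
  qed
  have sum: "add_pow (chain n) k x \<ominus>\<^bsub>chain n\<^esub> (\<Oplus>\<^bsub>chain n\<^esub>j\<in>{..<k}. (lam n ^^ j) x) \<in> ?I" for k :: nat
  proof (induction k)
    case 0
    then show ?case using zI by (simp add: C.diff_zero)
  next
    case (Suc k)
    let ?s = "\<Oplus>\<^bsub>chain n\<^esub>j\<in>{..<k}. (lam n ^^ j) x"
    have s: "?s \<in> carrier (chain n)" using x by (intro C.finsum_closed) auto
    have "(\<Oplus>\<^bsub>chain n\<^esub>j\<in>{..<Suc k}. (lam n ^^ j) x) = (lam n ^^ k) x \<oplus>\<^bsub>chain n\<^esub> ?s"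
      using x by (intro C.finsum_lessThan_Suc) auto
    then have "add_pow (chain n) (Suc k) x \<ominus>\<^bsub>chain n\<^esub> (\<Oplus>\<^bsub>chain n\<^esub>j\<in>{..<Suc k}. (lam n ^^ j) x) =
        (add_pow (chain n) k x \<ominus>\<^bsub>chain n\<^esub> ?s) \<oplus>\<^bsub>chain n\<^esub> (x \<ominus>\<^bsub>chain n\<^esub> (lam n ^^ k) x)"
      using x s by (simp add: a_minus_def C.minus_add C.a_ac)
    then show ?case using Suc pow I(5) by simp
  qed
  have "add_pow (chain n) (Suc (nat n)) x \<in> ?I"
    using sum[of "Suc (nat n)"] 0 x norm_op_eq[OF True, of x] by (simp add: C.diff_zero)
  moreover obtain c where c: "c \<in> carrier K" "c \<odot>\<^bsub>chain n\<^esub> add_pow (chain n) (Suc (nat n)) x = x"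
    by (rule divide_by_nat[of "Suc (nat n)" x n]) (use x in auto)
  ultimately have "x \<in> ?I" using I(4) by metis
  then show ?thesis using that by blast
next
  case False
  then have "one_minus_lam n x = x"
    using chain_negative[OF _ x] chain_negative[OF _ one_minus_lam_closed[OF x]] by simp
  then show ?thesis using that x by blast
qed

end

section \<open>The total complex\<close>

context secondary_triple
begin

interpretation C: module K "chain n" for n
  by (rule module_chain)

lemma Tot_simps [simp]:
  "\<zero>\<^bsub>Tot n\<^esub> = (\<lambda>i. \<zero>\<^bsub>chain i\<^esub>)"
  "x \<oplus>\<^bsub>Tot n\<^esub> y = (\<lambda>i. x i \<oplus>\<^bsub>chain i\<^esub> y i)"
  "c \<odot>\<^bsub>Tot n\<^esub> x = (\<lambda>i. c \<odot>\<^bsub>chain i\<^esub> x i)"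
  by (simp_all add: Tot_def)

lemma Tot_carrier:
  "x \<in> carrier (Tot n) \<longleftrightarrow> (\<forall>i. x i \<in> carrier (chain i)) \<and> (\<forall>i. i \<notin> {0..n} \<longrightarrow> x i = \<zero>\<^bsub>chain i\<^esub>)"
  by (simp add: Tot_def)

lemma Tot_entry: "x \<in> carrier (Tot n) \<Longrightarrow> x i \<in> carrier (chain i)"
  by (simp add: Tot_carrier)

text \<open>
  Chains vanish in negative rows, so only the rows above \<open>n\<close> impose a condition.
\<close>

lemma Tot_carrierI:
  assumes "\<And>i. x i \<in> carrier (chain i)" "\<And>i. n < i \<Longrightarrow> x i = \<zero>\<^bsub>chain i\<^esub>"
  shows "x \<in> carrier (Tot n)"
  using assms chain_negative by (auto simp: Tot_carrier not_le)

lemma module_Tot: "module K (Tot n)"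
proof (rule moduleI)
  show "abelian_group (Tot n)"
  proof (rule abelian_groupI)
    fix x assume x: "x \<in> carrier (Tot n)"
    then have "(\<lambda>i. \<ominus>\<^bsub>chain i\<^esub> x i) \<oplus>\<^bsub>Tot n\<^esub> x = \<zero>\<^bsub>Tot n\<^esub>"
      by (simp add: Tot_carrier C.l_neg)
    moreover have "(\<lambda>i. \<ominus>\<^bsub>chain i\<^esub> x i) \<in> carrier (Tot n)"
      using x by (auto simp: Tot_carrier)
    ultimately show "\<exists>y\<in>carrier (Tot n). y \<oplus>\<^bsub>Tot n\<^esub> x = \<zero>\<^bsub>Tot n\<^esub>" by blast
  qed (auto simp: Tot_carrier C.a_ac)
qed (auto simp: Tot_carrier K.is_cring C.smult_l_distr C.smult_r_distr C.smult_assoc1)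

lemma lin_map_to_Tot:
  assumes "module K M" "\<And>i. lin_map K M (chain i) (\<lambda>x. f x i)"
    and "\<And>x. x \<in> carrier M \<Longrightarrow> f x \<in> carrier (Tot n)"
  shows "lin_map K M (Tot n) f"
  using lin_mapD(7,8)[OF assms(2)] assms(1,3) by (intro lin_mapI module_Tot) (auto simp: fun_eq_iff)

lemma lin_map_Tot_entry: "lin_map K (Tot n) (chain i) (\<lambda>x. x i)"
  by (intro lin_mapI module_Tot module_chain) (auto simp: Tot_carrier)

lemma Tot_minus: "x \<in> carrier (Tot n) \<Longrightarrow> y \<in> carrier (Tot n) \<Longrightarrow> (x \<ominus>\<^bsub>Tot n\<^esub> y) i = x i \<ominus>\<^bsub>chain i\<^esub> y i"
  by (rule lin_map_minus[OF lin_map_Tot_entry])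

abbreviation vert :: "int \<Rightarrow> int \<Rightarrow> (('a, 'b) array \<Rightarrow> 'k) set \<Rightarrow> (('a, 'b) array \<Rightarrow> 'k) set"
  where "vert \<equiv> bicomplex_vert"

abbreviation horiz :: "int \<Rightarrow> int \<Rightarrow> (('a, 'b) array \<Rightarrow> 'k) set \<Rightarrow> (('a, 'b) array \<Rightarrow> 'k) set"
  where "horiz \<equiv> bicomplex_horiz"

lemma vert_lin: "lin_map K (chain q) (chain (q - 1)) (vert p q)"
  using hoch_b_lin lin_map_uminus[OF hoch_b'_lin]
  by (cases "even p") (simp_all add: bicomplex_vert_def[abs_def])

lemma horiz_lin: "lin_map K (chain q) (chain q) (horiz p q)"
  using one_minus_lam_lin norm_op_lin by (cases "odd p") (simp_all add: bicomplex_horiz_def[abs_def])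

lemmas vert_closed = lin_mapD(6)[OF vert_lin]
lemmas horiz_closed [simp] = lin_mapD(6)[OF horiz_lin]

lemma vert_closed_up [simp]: "x \<in> carrier (chain (q + 1)) \<Longrightarrow> vert p (q + 1) x \<in> carrier (chain q)"
  using vert_closed[of x "q + 1"] by simp

lemma vert_vert:
  assumes "x \<in> carrier (chain q)"
  shows "vert p (q - 1) (vert p q x) = \<zero>\<^bsub>chain (q - 2)\<^esub>"
  using assms hoch_b_hoch_b hoch_b'_hoch_b' lin_map_neg[OF hoch_b'_lin hoch_b'_closed[OF assms]]
  by (simp add: bicomplex_vert_def)

lemma vert_vert_up:
  "x \<in> carrier (chain (j + 2)) \<Longrightarrow> vert p (j + 1) (vert p (j + 2) x) = \<zero>\<^bsub>chain j\<^esub>"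
  using vert_vert[of x "j + 2" p] by (simp add: add.commute)

lemma horiz_horiz:
  assumes "x \<in> carrier (chain q)"
  shows "horiz (p - 1) q (horiz p q x) = \<zero>\<^bsub>chain q\<^esub>"
  using assms by (simp add: bicomplex_horiz_def one_minus_lam_norm_op norm_op_one_minus_lam)

lemma vert_horiz:
  assumes x: "x \<in> carrier (chain q)"
  shows "vert (p - 1) q (horiz p q x) \<oplus>\<^bsub>chain (q - 1)\<^esub> horiz p (q - 1) (vert p q x) = \<zero>\<^bsub>chain (q - 1)\<^esub>"
proof (cases "odd p")
  case True
  then show ?thesis
    using x lin_map_neg[OF one_minus_lam_lin hoch_b'_closed[OF x]] hoch_b_one_minus_lam[OF x]
    by (simp add: bicomplex_vert_def bicomplex_horiz_def C.r_neg)
next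
  case False
  then show ?thesis
    using x norm_op_hoch_b[OF x]
    by (simp add: bicomplex_vert_def bicomplex_horiz_def C.l_neg)
qed

lemma vert_horiz_up:
  "x \<in> carrier (chain (j + 1)) \<Longrightarrow>
    vert (p - 1) (j + 1) (horiz p (j + 1) x) \<oplus>\<^bsub>chain j\<^esub> horiz p j (vert p (j + 1) x) = \<zero>\<^bsub>chain j\<^esub>"
  using vert_horiz[of x "j + 1" p] by simp

lemma vert_horiz_period: "vert (p - 2) = vert p" "horiz (p - 2) = horiz p"
  by (auto simp: fun_eq_iff bicomplex_vert_def bicomplex_horiz_def)

lemma tot_d_entry:
  "0 \<le> j \<Longrightarrow> j < n \<Longrightarrow>
    tot_d n x j = vert (n - 1 - j) (j + 1) (x (j + 1)) \<oplus>\<^bsub>chain j\<^esub> horiz (n - j) j (x j)"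
  "j < 0 \<or> n \<le> j \<Longrightarrow> tot_d n x j = \<zero>\<^bsub>chain j\<^esub>"
  by (auto simp: tot_d_def)

lemma tot_d_entry_lin: "lin_map K (Tot n) (chain j) (\<lambda>x. tot_d n x j)"
proof (cases "0 \<le> j \<and> j < n")
  case True
  have v: "lin_map K (chain (j + 1)) (chain j) (vert (n - 1 - j) (j + 1))"
    using vert_lin[of "j + 1"] by simp
  show ?thesis
    using True
    by (intro lin_map_cong[OF lin_map_plus[OF lin_map_compose[OF lin_map_Tot_entry v]
          lin_map_compose[OF lin_map_Tot_entry horiz_lin]]])
      (simp add: tot_d_entry)
next
  case False
  then show ?thesis
    by (intro lin_map_cong[OF lin_map_const_zero[OF module_Tot module_chain]]) (auto simp: tot_d_entry)
qed

lemma tot_d_closed: "x \<in> carrier (Tot n) \<Longrightarrow> tot_d n x \<in> carrier (Tot (n - 1))"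
  by (rule Tot_carrierI) (auto simp: tot_d_entry lin_mapD(6)[OF tot_d_entry_lin])

lemma tot_d_lin: "lin_map K (Tot n) (Tot (n - 1)) (tot_d n)"
  by (rule lin_map_to_Tot[OF module_Tot tot_d_entry_lin tot_d_closed])

text \<open>
  Row \<open>j\<close> receives contributions from the rows \<open>j\<close>, \<open>j + 1\<close> and \<open>j + 2\<close>. The outer two vanish because
  rows and columns are complexes, the middle one because the squares anticommute.
\<close>

lemma tot_d_tot_d:
  assumes x: "x \<in> carrier (Tot n)"
  shows "tot_d (n - 1) (tot_d n x) = \<zero>\<^bsub>Tot (n - 2)\<^esub>"
proof
  fix j
  show "tot_d (n - 1) (tot_d n x) j = \<zero>\<^bsub>Tot (n - 2)\<^esub> j"
  proof (cases "0 \<le> j \<and> j < n - 1")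
    case False
    then show ?thesis by (auto simp: tot_d_entry)
  next
    case True
    \<comment> \<open>\<open>p\<close> is the column of the entry \<open>x (j + 1)\<close>\<close>
    define p where "p = n - 1 - j"
    have e: "x i \<in> carrier (chain i)" for i using x by (rule Tot_entry)
    have eqs: "n - 1 - (j + 1) = p - 1" "n - 1 - 1 - j = p - 1" "n - (j + 1) = p" "n - 1 - j = p" "n - j = p + 1"
      by (auto simp: p_def)
    let ?u = "x (j + 1)"
    have v2: "vert (p - 1) (j + 2) (x (j + 2)) \<in> carrier (chain (j + 1))"
      using vert_closed[OF e, of "p - 1" "j + 2"] by (simp add: algebra_simps)
    have d1: "tot_d n x (j + 1) = vert (p - 1) (j + 2) (x (j + 2)) \<oplus>\<^bsub>chain (j + 1)\<^esub> horiz p (j + 1) ?u"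
      using True by (simp add: tot_d_entry eqs) (simp add: add.commute)
    have d0: "tot_d n x j = vert p (j + 1) ?u \<oplus>\<^bsub>chain j\<^esub> horiz (p + 1) j (x j)"
      using True by (simp add: tot_d_entry eqs)
    have lv: "lin_map K (chain (j + 1)) (chain j) (vert (p - 1) (j + 1))"
      using vert_lin[of "j + 1"] by simp
    have "tot_d (n - 1) (tot_d n x) j =
        vert (p - 1) (j + 1) (tot_d n x (j + 1)) \<oplus>\<^bsub>chain j\<^esub> horiz p j (tot_d n x j)"
      using True tot_d_entry(1)[of j "n - 1" "tot_d n x", unfolded eqs] by simp
    also have "vert (p - 1) (j + 1) (tot_d n x (j + 1)) = vert (p - 1) (j + 1) (horiz p (j + 1) ?u)"
      unfolding d1 using lin_mapD(7)[OF lv v2, of "horiz p (j + 1) ?u"] vert_vert_up[OF e, of "p - 1" j] e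
      by simp
    also have "horiz p j (tot_d n x j) = horiz p j (vert p (j + 1) ?u)"
      unfolding d0 using lin_mapD(7)[OF horiz_lin, of "vert p (j + 1) ?u" j "horiz (p + 1) j (x j)" p]
        horiz_horiz[OF e, of "p + 1" j] e
      by simp
    also have "vert (p - 1) (j + 1) (horiz p (j + 1) ?u) \<oplus>\<^bsub>chain j\<^esub> horiz p j (vert p (j + 1) ?u) = \<zero>\<^bsub>chain j\<^esub>"
      by (rule vert_horiz_up[OF e])
    finally show ?thesis by simp
  qed
qed

lemma Tot_complex: "chain_complex K Tot tot_d"
  using tot_d_lin tot_d_tot_d by unfold_locales

lemma hoch_complex: "chain_complex K chain hoch_b"
  using hoch_b_lin hoch_b_hoch_b by unfold_locales

section \<open>The truncation\<close>

lemma trunc_lin: "lin_map K (Tot n) (Tot (n - 2)) (trunc n)"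
proof (rule lin_map_to_Tot[OF module_Tot])
  fix i
  show "lin_map K (Tot n) (chain i) (\<lambda>x. trunc n x i)"
    using lin_map_Tot_entry lin_map_const_zero[OF module_Tot module_chain]
    by (cases "i \<le> n - 2") (simp_all add: trunc_def)
qed (auto simp: Tot_carrier trunc_def)

text \<open>
  Deleting two columns preserves the parity of the remaining ones, hence their differentials.
\<close>

lemma trunc_tot_d:
  assumes x: "x \<in> carrier (Tot n)"
  shows "trunc (n - 1) (tot_d n x) = tot_d (n - 2) (trunc n x)"
proof
  fix j
  show "trunc (n - 1) (tot_d n x) j = tot_d (n - 2) (trunc n x) j"
  proof (cases "0 \<le> j \<and> j < n - 2")
    case True
    have "vert (n - 2 - 1 - j) = vert (n - 1 - j)" "horiz (n - 2 - j) = horiz (n - j)"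
      using vert_horiz_period[of "n - 1 - j"] vert_horiz_period[of "n - j"] by (simp_all add: algebra_simps)
    moreover have "trunc (n - 1) (tot_d n x) j = tot_d n x j" "trunc n x j = x j"
      "trunc n x (j + 1) = x (j + 1)"
      using True by (simp_all add: trunc_def)
    ultimately show ?thesis using True by (simp add: tot_d_entry)
  next
    case False
    then show ?thesis by (auto simp: tot_d_entry trunc_def)
  qed
qed

sublocale trunc: complex_surjection K Tot tot_d "\<lambda>n. Tot (n - 2)" "\<lambda>n. tot_d (n - 2)" trunc
proof (intro complex_surjection.intro complex_surjection_axioms.intro Tot_complex
    chain_complex_shift[OF Tot_complex] trunc_lin)
  show "trunc n ` carrier (Tot n) = carrier (Tot (n - 2))" for n
  proof
    show "trunc n ` carrier (Tot n) \<subseteq> carrier (Tot (n - 2))" using lin_mapD(6)[OF trunc_lin] by auto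
    show "carrier (Tot (n - 2)) \<subseteq> trunc n ` carrier (Tot n)"
    proof
      fix x assume x: "x \<in> carrier (Tot (n - 2))"
      have "x = trunc n x" using x by (auto simp: trunc_def Tot_carrier fun_eq_iff)
      moreover have "x \<in> carrier (Tot n)" using x by (auto simp: Tot_carrier)
      ultimately show "x \<in> trunc n ` carrier (Tot n)" by blast
    qed
  qed
qed (rule trunc_tot_d)

lemma trunc_ker: "trunc.ker = Tot'"
  by (intro ext) (simp add: trunc.ker_def Tot'_def)

lemma trunc_connecting: "trunc.connecting_map n = connecting n"
  by (intro ext) (simp add: trunc.connecting_map_def connecting_def trunc_ker)

lemma Tot'_carrier: "x \<in> carrier (Tot' n) \<longleftrightarrow> x \<in> carrier (Tot n) \<and> (\<forall>i\<le>n - 2. x i = \<zero>\<^bsub>chain i\<^esub>)"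
  using trunc.ker_carrier[of x n] by (auto simp: trunc_ker trunc_def fun_eq_iff)

section \<open>Columns zero and one\<close>

lemma Tot'_carrierI:
  assumes "\<And>i. x i \<in> carrier (chain i)" "\<And>i. i \<noteq> n \<Longrightarrow> i \<noteq> n - 1 \<Longrightarrow> x i = \<zero>\<^bsub>chain i\<^esub>"
  shows "x \<in> carrier (Tot' n)"
  using assms by (auto simp: Tot'_carrier intro!: Tot_carrierI)

lemma col0_incl_Tot': "y \<in> carrier (chain m) \<Longrightarrow> m = n \<or> m = n - 1 \<Longrightarrow> col0_incl m y \<in> carrier (Tot' n)"
  by (rule Tot'_carrierI) (auto simp: col0_incl_def)

lemma col0_incl_lin: "lin_map K (chain n) (Tot' n) (col0_incl n)"
proof -
  have "lin_map K (chain n) (Tot n) (col0_incl n)"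
  proof (rule lin_map_to_Tot[OF module_chain])
    fix i show "lin_map K (chain n) (chain i) (\<lambda>x. col0_incl n x i)"
      using lin_map_id[OF module_chain] lin_map_const_zero[OF module_chain module_chain]
      by (cases "i = n") (simp_all add: col0_incl_def)
  qed (use col0_incl_Tot' Tot'_carrier in blast)
  then show ?thesis
    using trunc.module_ker[of n] col0_incl_Tot'[of _ n n] lin_mapD(7,8)[of K "chain n" "Tot n" "col0_incl n"]
    unfolding trunc_ker by (intro lin_mapI module_chain) (auto simp: Tot'_def)
qed

lemma tot_d_columns:
  assumes x: "x \<in> carrier (Tot' n)"
  shows "1 \<le> n \<Longrightarrow> tot_d n x (n - 1) = hoch_b n (x n) \<oplus>\<^bsub>chain (n - 1)\<^esub> one_minus_lam (n - 1) (x (n - 1))"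
    and "2 \<le> n \<Longrightarrow> tot_d n x (n - 2) = \<ominus>\<^bsub>chain (n - 2)\<^esub> hoch_b' (n - 1) (x (n - 1))"
proof -
  have c: "x i \<in> carrier (chain i)" for i using x Tot_entry by (auto simp: Tot'_carrier)
  show "tot_d n x (n - 1) = hoch_b n (x n) \<oplus>\<^bsub>chain (n - 1)\<^esub> one_minus_lam (n - 1) (x (n - 1))" if "1 \<le> n"
    using that by (simp add: tot_d_entry bicomplex_vert_def bicomplex_horiz_def)
  have "x (n - 2) = \<zero>\<^bsub>chain (n - 2)\<^esub>" using x by (simp add: Tot'_carrier)
  then show "tot_d n x (n - 2) = \<ominus>\<^bsub>chain (n - 2)\<^esub> hoch_b' (n - 1) (x (n - 1))" if "2 \<le> n"
    using that hoch_b'_closed[OF c[of "n - 1"]] lin_map_zero[OF norm_op_lin]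
    by (simp add: tot_d_entry bicomplex_vert_def bicomplex_horiz_def)
qed

lemma tot_d_Tot'_zero:
  assumes x: "x \<in> carrier (Tot' n)" and j: "j \<noteq> n - 1" "j \<noteq> n - 2"
  shows "tot_d n x j = \<zero>\<^bsub>chain j\<^esub>"
proof -
  have "tot_d n x \<in> carrier (Tot' (n - 1))" using trunc.d_ker[of x n] x by (simp add: trunc_ker)
  then show ?thesis
    using j by (cases "j \<le> n - 3") (auto simp: Tot'_carrier Tot_carrier)
qed

lemma tot_d_col0_incl:
  assumes y: "y \<in> carrier (chain n)"
  shows "tot_d n (col0_incl n y) = col0_incl (n - 1) (hoch_b n y)"
proof
  fix j
  have c: "col0_incl n y \<in> carrier (Tot' n)" using y by (rule col0_incl_Tot') simp
  have v: "col0_incl n y n = y" "col0_incl n y (n - 1) = \<zero>\<^bsub>chain (n - 1)\<^esub>" by (simp_all add: col0_incl_def)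
  consider "j = n - 1" "1 \<le> n" | "j = n - 1" "n \<le> 0" | "j = n - 2" "2 \<le> n" | "j = n - 2" "n \<le> 1"
    | "j \<noteq> n - 1" "j \<noteq> n - 2" by linarith
  then show "tot_d n (col0_incl n y) j = col0_incl (n - 1) (hoch_b n y) j"
  proof cases
    case 1
    then show ?thesis
      using tot_d_columns(1)[OF c] y lin_map_zero[OF one_minus_lam_lin] by (simp add: v) (simp add: col0_incl_def)
  next
    case 2
    then show ?thesis by (simp add: tot_d_entry col0_incl_def hoch_trivial)
  next
    case 3
    then show ?thesis
      using tot_d_columns(2)[OF c] lin_map_zero[OF hoch_b'_lin, of "n - 1"] by (simp add: v) (simp add: col0_incl_def)
  next
    case 4
    then show ?thesis by (simp add: tot_d_entry col0_incl_def)
  next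
    case 5
    then show ?thesis using tot_d_Tot'_zero[OF c] by (simp add: col0_incl_def)
  qed
qed

text \<open>
  A cycle of \<open>Tot'\<close> is a pair of chains \<open>y\<^sub>n\<close> in column zero and \<open>y\<^sub>n\<^sub>-\<^sub>1\<close> in column one, with \<open>b' y\<^sub>n\<^sub>-\<^sub>1 = 0\<close>. The
  contraction gives \<open>u\<close> with \<open>b' u = y\<^sub>n\<^sub>-\<^sub>1\<close>, and adding the boundary of \<open>u\<close>, placed in column one, moves
  the cycle into column zero. If a chain \<open>y\<close> in column zero is the boundary of \<open>(z\<^sub>n\<^sub>+\<^sub>1, z\<^sub>n)\<close>, then
  \<open>b' z\<^sub>n = 0\<close>, so \<open>z\<^sub>n = b' w\<close> and \<open>y = b z\<^sub>n\<^sub>+\<^sub>1 + (1 - \<lambda>) b' w = b (z\<^sub>n\<^sub>+\<^sub>1 + (1 - \<lambda>) w)\<close>.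
\<close>

theorem HH_ident_lin_iso: "lin_iso K (HH n) (homology Tot' tot_d n) (HH_ident n)"
  unfolding HH_def HH_ident_def
proof (rule lin_iso_hmapI)
  show "chain_complex K chain hoch_b" by (rule hoch_complex)
  show "chain_complex K Tot' tot_d" using trunc.ker_complex by (simp add: trunc_ker)
  show "lin_map K (chain n) (Tot' n) (col0_incl n)" by (rule col0_incl_lin)
  have zero: "\<zero>\<^bsub>Tot' n\<^esub> = col0_incl n (\<zero>\<^bsub>chain n\<^esub>)" for n by (auto simp: Tot'_def col0_incl_def fun_eq_iff)
  show "tot_d n (col0_incl n y) = \<zero>\<^bsub>Tot' (n - 1)\<^esub>"
    if "y \<in> carrier (chain n)" "hoch_b n y = \<zero>\<^bsub>chain (n - 1)\<^esub>" for y
    using that by (simp add: tot_d_col0_incl zero)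
  show "col0_incl n (hoch_b (n + 1) y) \<in> boundaries Tot' tot_d n" if "y \<in> carrier (chain (n + 1))" for y
    using tot_d_col0_incl[OF that] col0_incl_Tot'[OF that, of "n + 1"]
    by (auto simp: boundaries_def intro!: image_eqI[of _ _ "col0_incl (n + 1) y"])
  show "y \<in> boundaries chain hoch_b n"
    if y: "y \<in> carrier (chain n)" "hoch_b n y = \<zero>\<^bsub>chain (n - 1)\<^esub>" "col0_incl n y \<in> boundaries Tot' tot_d n" for y
  proof (cases "0 \<le> n")
    case False
    then have "y = hoch_b (n + 1) (\<zero>\<^bsub>chain (n + 1)\<^esub>)"
      using chain_negative[OF _ y(1)] lin_map_zero[OF hoch_b_lin, of "n + 1"] by simp
    then show ?thesis by (auto simp: boundaries_def)
  next
    case True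
    obtain z where z: "z \<in> carrier (Tot' (n + 1))" "col0_incl n y = tot_d (n + 1) z"
      using y(3) by (auto simp: boundaries_def)
    have c: "z i \<in> carrier (chain i)" for i using z Tot_entry by (auto simp: Tot'_carrier)
    let ?w = "add_unit_row n (z n)"
    have w: "?w \<in> carrier (chain (n + 1))" by (rule add_unit_row_closed[OF c])
    have "y = tot_d (n + 1) z n" unfolding z(2)[symmetric] by (simp add: col0_incl_def)
    then have y_eq: "y = hoch_b (n + 1) (z (n + 1)) \<oplus>\<^bsub>chain n\<^esub> one_minus_lam n (z n)"
      using tot_d_columns(1)[OF z(1)] True by simp
    have "hoch_b' n (z n) = \<zero>\<^bsub>chain (n - 1)\<^esub>"
    proof (cases "n = 0")
      case False
      have "tot_d (n + 1) z (n - 1) = \<zero>\<^bsub>chain (n - 1)\<^esub>"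
        unfolding z(2)[symmetric] by (simp add: col0_incl_def)
      moreover have "tot_d (n + 1) z (n - 1) = \<ominus>\<^bsub>chain (n - 1)\<^esub> hoch_b' n (z n)"
        using tot_d_columns(2)[OF z(1)] True False by simp
      ultimately have "\<ominus>\<^bsub>chain (n - 1)\<^esub> hoch_b' n (z n) = \<zero>\<^bsub>chain (n - 1)\<^esub>" by (simp only:)
      then show ?thesis using hoch_b'_closed[OF c[of n]] by simp
    qed (simp add: hoch_trivial)
    then have "z n = hoch_b' (n + 1) ?w"
      using hoch_b'_contraction[OF c[of n]] lin_map_zero[OF add_unit_row_lin, of "n - 1"]
        hoch_b'_closed[OF w] by simp
    then have "one_minus_lam n (z n) = hoch_b (n + 1) (one_minus_lam (n + 1) ?w)"
      using hoch_b_one_minus_lam[OF w] by simp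
    then have "y = hoch_b (n + 1) (z (n + 1) \<oplus>\<^bsub>chain (n + 1)\<^esub> one_minus_lam (n + 1) ?w)"
      using y_eq lin_mapD(7)[OF hoch_b_lin c one_minus_lam_closed[OF w]] by simp
    then show ?thesis using c w by (auto simp: boundaries_def)
  qed
  show "\<exists>x. x \<in> carrier (chain n) \<and> hoch_b n x = \<zero>\<^bsub>chain (n - 1)\<^esub> \<and>
      col0_incl n x \<ominus>\<^bsub>Tot' n\<^esub> y \<in> boundaries Tot' tot_d n"
    if y: "y \<in> carrier (Tot' n)" "tot_d n y = \<zero>\<^bsub>Tot' (n - 1)\<^esub>" for y
  proof -
    have c: "y i \<in> carrier (chain i)" for i using y Tot_entry by (auto simp: Tot'_carrier)
    have y0: "tot_d n y j = \<zero>\<^bsub>chain j\<^esub>" for j using y(2) by (simp add: Tot'_def)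
    let ?u = "add_unit_row (n - 1) (y (n - 1))"
    have u: "?u \<in> carrier (chain n)" using add_unit_row_closed[OF c, of "n - 1"] by simp
    have "hoch_b' (n - 1) (y (n - 1)) = \<zero>\<^bsub>chain (n - 2)\<^esub>"
    proof (cases "2 \<le> n")
      case True
      then have "\<ominus>\<^bsub>chain (n - 2)\<^esub> hoch_b' (n - 1) (y (n - 1)) = \<zero>\<^bsub>chain (n - 2)\<^esub>"
        using tot_d_columns(2)[OF y(1)] y0[of "n - 2"] by (simp only:)
      then show ?thesis using hoch_b'_closed[OF c[of "n - 1"]] by simp
    qed (simp add: hoch_trivial)
    then have bu: "hoch_b' n ?u = y (n - 1)"
      using hoch_b'_contraction[OF c[of "n - 1"]] lin_map_zero[OF add_unit_row_lin, of "n - 2"]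
        hoch_b'_closed[OF u] by simp
    let ?x = "y n \<oplus>\<^bsub>chain n\<^esub> one_minus_lam n ?u"
    have x: "?x \<in> carrier (chain n)" using c u by simp
    have "hoch_b n ?x = hoch_b n (y n) \<oplus>\<^bsub>chain (n - 1)\<^esub> one_minus_lam (n - 1) (y (n - 1))"
      using lin_mapD(7)[OF hoch_b_lin c one_minus_lam_closed[OF u]] hoch_b_one_minus_lam[OF u] bu by simp
    also have "\<dots> = \<zero>\<^bsub>chain (n - 1)\<^esub>"
    proof (cases "1 \<le> n")
      case True
      then show ?thesis using tot_d_columns(1)[OF y(1)] y0[of "n - 1"] by simp
    next
      case False
      then have "y (n - 1) = \<zero>\<^bsub>chain (n - 1)\<^esub>" using chain_negative[OF _ c[of "n - 1"]] by simp
      then show ?thesis using False lin_map_zero[OF one_minus_lam_lin] by (simp add: hoch_trivial)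
    qed
    finally have bx: "hoch_b n ?x = \<zero>\<^bsub>chain (n - 1)\<^esub>" .
    let ?v = "col0_incl n ?u"
    have v: "?v \<in> carrier (Tot' (n + 1))" using u by (rule col0_incl_Tot') simp
    have cx: "col0_incl n ?x \<in> carrier (Tot' n)" using x by (rule col0_incl_Tot') simp
    have "col0_incl n ?x \<ominus>\<^bsub>Tot' n\<^esub> y = tot_d (n + 1) ?v"
    proof
      fix j
      have "(col0_incl n ?x \<ominus>\<^bsub>Tot' n\<^esub> y) j = (col0_incl n ?x \<ominus>\<^bsub>Tot n\<^esub> y) j"
        using trunc.ker_minus[of "col0_incl n ?x" n y] cx y(1) by (simp add: trunc_ker)
      also have "\<dots> = col0_incl n ?x j \<ominus>\<^bsub>chain j\<^esub> y j"
        using cx y(1) by (intro Tot_minus) (auto simp: Tot'_carrier)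
      also have "\<dots> = tot_d (n + 1) ?v j"
      proof -
        have cj: "col0_incl n ?x j \<in> carrier (chain j)" using x by (simp add: col0_incl_def)
        have vn: "?v n = ?u" "?v (n + 1) = \<zero>\<^bsub>chain (n + 1)\<^esub>" by (simp_all add: col0_incl_def)
        consider "j < 0" | "j = n" "0 \<le> n" | "j = n - 1" "1 \<le> n" | "0 \<le> j" "j \<noteq> n" "j \<noteq> n - 1" by linarith
        then show ?thesis
        proof cases
          case 1
          then show ?thesis
            using chain_negative[OF 1 c] chain_negative[OF 1 cj] by (simp add: tot_d_entry a_minus_def)
        next
          case 2
          then show ?thesis
            using tot_d_columns(1)[OF v] vn c u lin_map_zero[OF hoch_b_lin, of "n + 1"]
            by (simp add: col0_incl_def a_minus_def C.a_ac C.r_neg1 C.r_neg2)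
        next
          case 3
          then show ?thesis
            using tot_d_columns(2)[OF v] vn c u bu by (simp add: col0_incl_def a_minus_def)
        next
          case 4
          then have "y j = \<zero>\<^bsub>chain j\<^esub>" using y(1) by (cases "j \<le> n - 2") (auto simp: Tot'_carrier Tot_carrier)
          then show ?thesis using 4 tot_d_Tot'_zero[OF v, of j] by (simp add: col0_incl_def a_minus_def)
        qed
      qed
      finally show "(col0_incl n ?x \<ominus>\<^bsub>Tot' n\<^esub> y) j = tot_d (n + 1) ?v j" .
    qed
    then have "col0_incl n ?x \<ominus>\<^bsub>Tot' n\<^esub> y \<in> boundaries Tot' tot_d n"
      using v by (simp add: boundaries_def)
    then show ?thesis using x bx by blast
  qed
qed

section \<open>The cyclic complex\<close>

lemma submodule_im: "submodule (im_one_minus_lam n) K (chain n)"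
  unfolding im_one_minus_lam_def by (rule submodule_image[OF one_minus_lam_lin])

lemma hoch_b_im: "x \<in> im_one_minus_lam n \<Longrightarrow> hoch_b n x \<in> im_one_minus_lam (n - 1)"
  by (auto simp: im_one_minus_lam_def hoch_b_one_minus_lam)

lemma cyc_b_lin: "lin_map K (cyc_chain n) (cyc_chain (n - 1)) (cyc_b n)"
  unfolding cyc_chain_def cyc_b_def by (rule lin_map_induced[OF hoch_b_lin submodule_im submodule_im hoch_b_im])

lemma cyc_b_coset:
  "x \<in> carrier (chain n) \<Longrightarrow>
    cyc_b n (im_one_minus_lam n +>\<^bsub>chain n\<^esub> x) = im_one_minus_lam (n - 1) +>\<^bsub>chain (n - 1)\<^esub> hoch_b n x"
  unfolding cyc_b_def by (rule induced_coset[OF hoch_b_lin submodule_im submodule_im hoch_b_im])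

lemma cyc_chain_carrier: "carrier (cyc_chain n) = (\<lambda>x. im_one_minus_lam n +>\<^bsub>chain n\<^esub> x) ` carrier (chain n)"
  unfolding cyc_chain_def by (rule quot_mod_carrier[OF module_chain submodule_im])

lemma cyc_chain_zero: "\<zero>\<^bsub>cyc_chain n\<^esub> = im_one_minus_lam n +>\<^bsub>chain n\<^esub> \<zero>\<^bsub>chain n\<^esub>"
  unfolding cyc_chain_def by (rule quot_mod_zero_coset[OF module_chain submodule_im])

lemma cyc_complex: "chain_complex K cyc_chain cyc_b"
proof (unfold_locales, rule cyc_b_lin)
  fix n X assume "X \<in> carrier (cyc_chain n)"
  then obtain x where x: "x \<in> carrier (chain n)" "X = im_one_minus_lam n +>\<^bsub>chain n\<^esub> x"
    by (auto simp: cyc_chain_carrier)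
  then show "cyc_b (n - 1) (cyc_b n X) = \<zero>\<^bsub>cyc_chain (n - 2)\<^esub>"
    using cyc_b_coset[OF hoch_b_closed[OF x(1)]] hoch_b_hoch_b[OF x(1)]
    by (simp add: cyc_b_coset cyc_chain_zero)
qed

lemma cyc_proj_lin: "lin_map K (Tot n) (cyc_chain n) (cyc_proj n)"
  unfolding cyc_proj_def[abs_def] cyc_chain_def
  by (rule lin_map_compose[OF lin_map_Tot_entry lin_map_coset[OF module_chain submodule_im]])

lemma cyc_proj_tot_d:
  assumes x: "x \<in> carrier (Tot n)"
  shows "cyc_proj (n - 1) (tot_d n x) = cyc_b n (cyc_proj n x)"
proof (cases "1 \<le> n")
  case True
  have c: "x i \<in> carrier (chain i)" for i using x by (rule Tot_entry)
  have e: "tot_d n x (n - 1) = hoch_b n (x n) \<oplus>\<^bsub>chain (n - 1)\<^esub> one_minus_lam (n - 1) (x (n - 1))"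
    using True by (simp add: tot_d_entry bicomplex_vert_def bicomplex_horiz_def)
  have "tot_d n x (n - 1) \<ominus>\<^bsub>chain (n - 1)\<^esub> hoch_b n (x n) = one_minus_lam (n - 1) (x (n - 1))"
    unfolding e by (intro C.add_diff_cancel_left hoch_b_closed one_minus_lam_closed c)
  then have "tot_d n x (n - 1) \<ominus>\<^bsub>chain (n - 1)\<^esub> hoch_b n (x n) \<in> im_one_minus_lam (n - 1)"
    using c by (simp add: im_one_minus_lam_def)
  then show ?thesis
    using coset_eq_iff[OF module_chain submodule_im, of "tot_d n x (n - 1)" "n - 1" "hoch_b n (x n)"]
      c lin_mapD(6)[OF tot_d_entry_lin x]
    by (simp add: cyc_proj_def cyc_b_coset)
next
  case False
  then show ?thesis
    using Tot_entry[OF x] by (simp add: cyc_proj_def cyc_b_coset tot_d_entry hoch_trivial)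
qed

sublocale cyc: complex_surjection K Tot tot_d cyc_chain cyc_b cyc_proj
proof (intro complex_surjection.intro complex_surjection_axioms.intro Tot_complex
    cyc_complex cyc_proj_lin)
  show "cyc_proj n ` carrier (Tot n) = carrier (cyc_chain n)" for n
  proof
    show "cyc_proj n ` carrier (Tot n) \<subseteq> carrier (cyc_chain n)" using lin_mapD(6)[OF cyc_proj_lin] by auto
    show "carrier (cyc_chain n) \<subseteq> cyc_proj n ` carrier (Tot n)"
    proof
      fix X assume "X \<in> carrier (cyc_chain n)"
      then obtain x where x: "x \<in> carrier (chain n)" "X = im_one_minus_lam n +>\<^bsub>chain n\<^esub> x"
        by (auto simp: cyc_chain_carrier)
      then have "X = cyc_proj n (col0_incl n x)" by (simp add: cyc_proj_def col0_incl_def)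
      moreover have "col0_incl n x \<in> carrier (Tot n)"
        using col0_incl_Tot'[OF x(1), of n] by (simp add: Tot'_carrier)
      ultimately show "X \<in> cyc_proj n ` carrier (Tot n)" by blast
    qed
  qed
qed (rule cyc_proj_tot_d)

lemma cyc_ker_carrier: "x \<in> carrier (cyc.ker n) \<longleftrightarrow> x \<in> carrier (Tot n) \<and> x n \<in> im_one_minus_lam n"
proof (cases "x \<in> carrier (Tot n)")
  case True
  have "cyc_proj n x = \<zero>\<^bsub>cyc_chain n\<^esub> \<longleftrightarrow> x n \<in> im_one_minus_lam n"
    unfolding cyc_proj_def cyc_chain_def quot_mod_zero[OF module_chain submodule_im]
    by (rule coset_eq_subgroup_iff[OF module_chain submodule_im Tot_entry[OF True]])
  then show ?thesis using True by (simp add: cyc.ker_carrier)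
qed (simp add: cyc.ker_carrier)

end

context secondary_triple_char_0
begin

interpretation C: module K "chain n" for n
  by (rule module_chain)

lemma row_exact:
  assumes y: "y \<in> carrier (chain q)" and 0: "horiz p q y = \<zero>\<^bsub>chain q\<^esub>"
  obtains z where "z \<in> carrier (chain q)" "horiz (p + 1) q z = y"
proof (cases "odd p")
  case True
  then show ?thesis
    using kernel_one_minus_lam[OF y] 0 that by (auto simp: bicomplex_horiz_def)
next
  case False
  then show ?thesis
    using kernel_norm_op[OF y] 0 that by (auto simp: bicomplex_horiz_def)
qed

text \<open>
  Let \<open>x\<close> be a cycle of total degree \<open>n\<close> with \<open>x\<^sub>n = (1 - \<lambda>) w\<close>. A preimage \<open>z\<close> is found by solving
  \<open>horiz z\<^sub>j = x\<^sub>j - vert z\<^sub>j\<^sub>+\<^sub>1\<close> for \<open>j = n - 1, \<dots>, 0\<close>, starting with \<open>z\<^sub>n\<^sub>+\<^sub>1 = 0\<close> and \<open>z\<^sub>n = w\<close>. The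
  right-hand side lies in the kernel of the horizontal differential: since \<open>x\<close> is a cycle,
  \<open>horiz x\<^sub>j = - vert x\<^sub>j\<^sub>+\<^sub>1\<close>, and the equation for row \<open>j + 1\<close> gives
  \<open>vert x\<^sub>j\<^sub>+\<^sub>1 = vert (horiz z\<^sub>j\<^sub>+\<^sub>1) = - horiz (vert z\<^sub>j\<^sub>+\<^sub>1)\<close>.
\<close>

lemma cyc_ker_acyclic:
  assumes x: "x \<in> carrier (cyc.ker n)" and dx: "tot_d n x = \<zero>\<^bsub>Tot (n - 1)\<^esub>"
  shows "x \<in> boundaries cyc.ker tot_d n"
proof -
  have xT: "x \<in> carrier (Tot n)" using x by (simp add: cyc_ker_carrier)
  note c = Tot_entry[OF xT]
  obtain w where w: "w \<in> carrier (chain n)" "one_minus_lam n w = x n"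
    using x by (auto simp: cyc_ker_carrier im_one_minus_lam_def)
  have dx0: "vert (n - 1 - j) (j + 1) (x (j + 1)) \<oplus>\<^bsub>chain j\<^esub> horiz (n - j) j (x j) = \<zero>\<^bsub>chain j\<^esub>"
    if "0 \<le> j" "j < n" for j
    using dx tot_d_entry(1)[OF that, of x] by simp
  \<comment> \<open>the equations for the rows \<open>n, n - 1, \<dots>, n - k\<close> have a common solution\<close>
  have ex: "\<exists>z. (\<forall>i. z i \<in> carrier (chain i)) \<and> (\<forall>i>n. z i = \<zero>\<^bsub>chain i\<^esub>) \<and>
      (\<forall>j. n - int k \<le> j \<and> 0 \<le> j \<and> j \<le> n \<longrightarrow>
        vert (n - j) (j + 1) (z (j + 1)) \<oplus>\<^bsub>chain j\<^esub> horiz (n + 1 - j) j (z j) = x j)" for k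
  proof (induction k)
    case 0
    have lv: "vert 0 (n + 1) (\<zero>\<^bsub>chain (n + 1)\<^esub>) = \<zero>\<^bsub>chain n\<^esub>"
      using lin_map_zero[OF vert_lin[of "n + 1" 0]] by simp
    show ?case
      by (intro exI[of _ "col0_incl n w"])
        (use w c lv in \<open>auto simp: col0_incl_def bicomplex_horiz_def\<close>)
  next
    case (Suc k)
    then obtain z where z: "\<And>i. z i \<in> carrier (chain i)" "\<And>i. i > n \<Longrightarrow> z i = \<zero>\<^bsub>chain i\<^esub>"
      and ze: "\<And>j. n - int k \<le> j \<Longrightarrow> 0 \<le> j \<Longrightarrow> j \<le> n \<Longrightarrow>
        vert (n - j) (j + 1) (z (j + 1)) \<oplus>\<^bsub>chain j\<^esub> horiz (n + 1 - j) j (z j) = x j"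
      by blast
    define j where "j = n - int (Suc k)"
    define p where "p = n - j"
    let ?y = "x j \<ominus>\<^bsub>chain j\<^esub> vert p (j + 1) (z (j + 1))"
    show ?case
    proof (cases "0 \<le> j")
      case False
      then show ?thesis using z ze by (intro exI[of _ z]) (auto simp: j_def)
    next
      case True
      have jn: "j < n" by (simp add: j_def)
      have eqs: "n - (j + 1) = p - 1" "n + 1 - (j + 1) = p" "n - 1 - j = p - 1" "n - j = p" "n + 1 - j = p + 1"
        by (auto simp: p_def)
      let ?u = "z (j + 1)" and ?v = "z (j + 2)"
      have vv: "vert (p - 1) (j + 2) ?v \<in> carrier (chain (j + 1))"
        using vert_closed[OF z(1), of "p - 1" "j + 2"] by (simp add: algebra_simps)
      have lv: "lin_map K (chain (j + 1)) (chain j) (vert (p - 1) (j + 1))"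
        using vert_lin[of "j + 1"] by simp
      have vu: "vert p (j + 1) ?u \<in> carrier (chain j)" using z by simp
      have x1: "x (j + 1) = vert (p - 1) (j + 2) ?v \<oplus>\<^bsub>chain (j + 1)\<^esub> horiz p (j + 1) ?u"
      proof -
        have r: "n - int k \<le> j + 1" "0 \<le> j + 1" "j + 1 \<le> n" and e2: "j + 1 + 1 = j + 2"
          using True by (auto simp: j_def)
        show ?thesis using ze[OF r] unfolding eqs e2 by (rule sym)
      qed
      let ?w = "vert (p - 1) (j + 1) (horiz p (j + 1) ?u)"
      have w: "?w \<in> carrier (chain j)" using z(1) by simp
      have "vert (p - 1) (j + 1) (x (j + 1)) = ?w"
        unfolding x1 using lin_mapD(7)[OF lv vv, of "horiz p (j + 1) ?u"] vert_vert_up[OF z(1), of "p - 1" j] z(1)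
        by simp
      then have "?w \<oplus>\<^bsub>chain j\<^esub> horiz p j (x j) = \<zero>\<^bsub>chain j\<^esub>"
        using dx0[OF True jn] unfolding eqs by simp
      then have "horiz p j (x j) \<oplus>\<^bsub>chain j\<^esub> ?w = \<zero>\<^bsub>chain j\<^esub>"
        using C.a_comm[OF w horiz_closed[OF c]] by simp
      then have 1: "\<ominus>\<^bsub>chain j\<^esub> ?w = horiz p j (x j)"
        by (rule C.minus_equality[OF _ w horiz_closed[OF c]])
      have "horiz p j (vert p (j + 1) ?u) \<oplus>\<^bsub>chain j\<^esub> ?w = \<zero>\<^bsub>chain j\<^esub>"
        using vert_horiz_up[OF z(1), of j p] C.a_comm[OF w horiz_closed[OF vu]] by simp
      then have "\<ominus>\<^bsub>chain j\<^esub> ?w = horiz p j (vert p (j + 1) ?u)"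
        by (rule C.minus_equality[OF _ w horiz_closed[OF vu]])
      with 1 have "horiz p j (x j) = horiz p j (vert p (j + 1) ?u)" by simp
      then have "horiz p j ?y = \<zero>\<^bsub>chain j\<^esub>"
        using lin_map_minus[OF horiz_lin c vu] vu by (simp add: a_minus_def C.r_neg)
      then obtain y where y: "y \<in> carrier (chain j)" "horiz (p + 1) j y = ?y"
        using row_exact[of ?y j p] c vu by blast
      have e: "vert p (j + 1) (z (j + 1)) \<oplus>\<^bsub>chain j\<^esub> horiz (p + 1) j y = x j"
        unfolding y(2) using c[of j] vu by (simp add: a_minus_def C.a_ac C.r_neg C.r_neg1 C.r_neg2)
      show ?thesis
      proof (intro exI[of _ "z(j := y)"] conjI allI impI)
        fix i
        show "(z(j := y)) i \<in> carrier (chain i)" using z y by simp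
        show "(z(j := y)) i = \<zero>\<^bsub>chain i\<^esub>" if "n < i" using z(2)[OF that] that jn by simp
        assume i: "n - int (Suc k) \<le> i \<and> 0 \<le> i \<and> i \<le> n"
        show "vert (n - i) (i + 1) ((z(j := y)) (i + 1)) \<oplus>\<^bsub>chain i\<^esub> horiz (n + 1 - i) i ((z(j := y)) i) = x i"
        proof (cases "i = j")
          case True
          then show ?thesis using e by (simp add: eqs)
        next
          case False
          then have "n - int k \<le> i" using i by (simp add: j_def)
          moreover have "i + 1 \<noteq> j" using i by (simp add: j_def)
          ultimately show ?thesis using ze[of i] i False by simp
        qed
      qed
    qed
  qed
  have bound: "n - int (nat n) \<le> j" if "0 \<le> j" for j using that by simp
  from ex[of "nat n"] obtain z where z: "\<And>i. z i \<in> carrier (chain i)" "\<And>i. i > n \<Longrightarrow> z i = \<zero>\<^bsub>chain i\<^esub>"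
      and ze: "\<And>j. 0 \<le> j \<Longrightarrow> j \<le> n \<Longrightarrow>
        vert (n - j) (j + 1) (z (j + 1)) \<oplus>\<^bsub>chain j\<^esub> horiz (n + 1 - j) j (z j) = x j"
    using bound by blast
  have zT: "z \<in> carrier (Tot (n + 1))" using z by (intro Tot_carrierI) auto
  have "z (n + 1) \<in> im_one_minus_lam (n + 1)"
    using z(2)[of "n + 1"] lin_map_zero[OF one_minus_lam_lin, of "n + 1"]
    by (auto simp: im_one_minus_lam_def intro!: image_eqI[of _ _ "\<zero>\<^bsub>chain (n + 1)\<^esub>"])
  then have "z \<in> carrier (cyc.ker (n + 1))" using zT by (simp add: cyc_ker_carrier)
  moreover have "x = tot_d (n + 1) z"
  proof
    fix j
    show "x j = tot_d (n + 1) z j"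
    proof (cases "0 \<le> j \<and> j \<le> n")
      case True
      then show ?thesis using ze[of j] by (simp add: tot_d_entry)
    next
      case False
      then show ?thesis using xT by (auto simp: tot_d_entry Tot_carrier)
    qed
  qed
  ultimately show ?thesis by (auto simp: boundaries_def)
qed

theorem HC_ident_lin_iso: "lin_iso K (homology Tot tot_d n) (HC n) (HC_ident n)"
  unfolding HC_def HC_ident_def by (rule cyc.proj_iso_if_acyclic[OF cyc_ker_acyclic])

section \<open>The long exact sequence\<close>

text \<open>
  The maps \<open>I\<close>, \<open>S\<close> and \<open>B\<close> are the maps of the homology sequence of the truncation, conjugated by the
  identifications. The squares required by the transfer of exactness therefore commute by cancellation.
\<close>

lemma ident_inv:
  "x \<in> carrier (homology Tot tot_d n) \<Longrightarrow> HC_ident_inv n (HC_ident n x) = x"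
  "y \<in> carrier (homology Tot' tot_d n) \<Longrightarrow> HH_ident n (HH_ident_inv n y) = y"
  using HC_ident_lin_iso[of n] HH_ident_lin_iso[of n]
  by (simp_all add: lin_iso_def bij_betw_def HC_ident_inv_def HH_ident_inv_def f_inv_into_f)

lemma HH_ident_inv_lin_iso: "lin_iso K (homology Tot' tot_d n) (HH n) (HH_ident_inv n)"
  unfolding HH_ident_inv_def by (rule lin_iso_inv_into[OF HH_ident_lin_iso])

lemma exact_I_S: "exact_at K (HH n) (I_map n) (HC n) (S_map n) (HC (n - 2))"
proof (rule exact_at_transfer)
  show "exact_at K (homology Tot' tot_d n) (hmap Tot tot_d n (\<lambda>x. x)) (homology Tot tot_d n)
      (hmap Tot tot_d (n - 2) (trunc n)) (homology Tot tot_d (n - 2))"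
    using trunc.exact_at_middle[of n] by (simp only: homology_shift trunc_ker)
qed ((rule HH_ident_inv_lin_iso HC_ident_lin_iso)+, simp_all add: I_map_def S_map_def ident_inv)

lemma exact_S_B: "exact_at K (HC n) (S_map n) (HC (n - 2)) (B_map n) (HH (n - 1))"
proof (rule exact_at_transfer)
  show "exact_at K (homology Tot tot_d n) (hmap Tot tot_d (n - 2) (trunc n)) (homology Tot tot_d (n - 2))
      (connecting n) (homology Tot' tot_d (n - 1))"
    using trunc.exact_at_quotient[of n] by (simp only: homology_shift trunc_ker trunc_connecting)
qed ((rule HH_ident_inv_lin_iso HC_ident_lin_iso)+, simp_all add: B_map_def S_map_def ident_inv)

lemma exact_B_I: "exact_at K (HC (n - 2)) (B_map n) (HH (n - 1)) (I_map (n - 1)) (HC (n - 1))"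
proof (rule exact_at_transfer)
  show "exact_at K (homology Tot tot_d (n - 2)) (connecting n) (homology Tot' tot_d (n - 1))
      (hmap Tot tot_d (n - 1) (\<lambda>x. x)) (homology Tot tot_d (n - 1))"
    using trunc.exact_at_kernel[of n] by (simp only: homology_shift trunc_ker trunc_connecting)
qed ((rule HH_ident_inv_lin_iso HC_ident_lin_iso)+, simp_all add: B_map_def I_map_def ident_inv)

end

theorem theorem4p11:
  fixes K :: "('k, 'i) ring_scheme"
    and A :: "('k, 'a, 'j) module_scheme"
    and B :: "('k, 'b, 'l) module_scheme"
    and \<epsilon> :: "'b \<Rightarrow> 'a"
  assumes triple: "secondary_triple K A B \<epsilon>"
    and char_zero: "\<And>m::nat. 0 < m \<Longrightarrow> add_pow K m \<one>\<^bsub>K\<^esub> \<noteq> \<zero>\<^bsub>K\<^esub>"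
  shows "\<forall>n::int.
      lin_iso K (homology (secondary_triple.Tot K A B) (secondary_triple.tot_d K A B \<epsilon>) n)
        (secondary_triple.HC K A B \<epsilon> n) (secondary_triple.HC_ident K A B \<epsilon> n) \<and>
      lin_iso K (secondary_triple.HH K A B \<epsilon> n)
        (homology (secondary_triple.Tot' K A B) (secondary_triple.tot_d K A B \<epsilon>) n)
        (secondary_triple.HH_ident K A B \<epsilon> n) \<and>
      exact_at K
        (secondary_triple.HH K A B \<epsilon> n) (secondary_triple.I_map K A B \<epsilon> n)
        (secondary_triple.HC K A B \<epsilon> n) (secondary_triple.S_map K A B \<epsilon> n)
        (secondary_triple.HC K A B \<epsilon> (n - 2)) \<and>
      exact_at K
        (secondary_triple.HC K A B \<epsilon> n) (secondary_triple.S_map K A B \<epsilon> n)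
        (secondary_triple.HC K A B \<epsilon> (n - 2)) (secondary_triple.B_map K A B \<epsilon> n)
        (secondary_triple.HH K A B \<epsilon> (n - 1)) \<and>
      exact_at K
        (secondary_triple.HC K A B \<epsilon> (n - 2)) (secondary_triple.B_map K A B \<epsilon> n)
        (secondary_triple.HH K A B \<epsilon> (n - 1)) (secondary_triple.I_map K A B \<epsilon> (n - 1))
        (secondary_triple.HC K A B \<epsilon> (n - 1))"
proof -
  interpret secondary_triple K A B \<epsilon> by (rule triple)
  interpret secondary_triple_char_0 K A B \<epsilon> by unfold_locales (rule char_zero)
  show ?thesis
    by (intro allI conjI HC_ident_lin_iso HH_ident_lin_iso exact_I_S exact_S_B exact_B_I)
qed

end
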